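(* Let $n\geqslant 2$, let $D\subset\mathbb{R}^n$ be a domain whose closure $\overline{D}$ is a compact set in $\mathbb{R}^n$, and let $n-1<\alpha\leqslant n$. Let $f:D\rightarrow\mathbb{R}^n$ be a (continuous) open, discrete and closed mapping that is differentiable almost everywhere and has the $N$-Luzin property with respect to the Lebesgue measure in $\mathbb{R}^n$. Let $y_0\in\overline{f(D)}\setminus\{\infty\}$ and $r_0=\sup_{y\in f(D)}|y-y_0|>0$. Suppose that $J(x,f)\neq0$ for almost every $x\in D$. Suppose that for every $\varepsilon\in(0,r_0)$ the mapping $f$ has the $N^{-1}$-property on $S(y_0,r)\cap f(D)$ for almost all $r\in(\varepsilon,r_0)$ relative to the Hausdorff measure $\mathcal{H}^{n-1}$ on $S(y_0,r)$. If the function $$Q(y)=\sum_{x\in f^{-1}(y)}K_{O,\alpha}(x,f)$$ belongs to $L^1(f(D))$, then $f$ satisfies the inverse Poletsky inequality at the point $y_0$ with respect to $\alpha$-modulus with $Q_*(y):=N^{\alpha}(f,D)\cdot Q(y)$.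
   Context: Notation: $m$ is Lebesgue measure in $\mathbb{R}^n$, $\mathcal{H}^{n-1}$ is the $(n-1)$-dimensional Hausdorff measure, $B(y_0,r)=\{y\in\mathbb{R}^n:|y-y_0|<r\}$, $S(y_0,r)=\{y\in\mathbb{R}^n:|y-y_0|=r\}$, and $A(y_0,r_1,r_2)=\{y\in\mathbb{R}^n: r_1<|y-y_0|<r_2\}$. A mapping is open if images of open sets are open, discrete if each point has a discrete set of preimages, closed if the image of every set closed in $D$ is closed in $f(D)$. $N$-Luzin property: $m(E)=0$ implies $m(f(E))=0$ for $E\subset D$. The $N^{-1}$-property on $S(y_0,r)\cap f(D)$ relative to $\mathcal{H}^{n-1}$: if $E\subset S(y_0,r)\cap f(D)$ and $\mathcal{H}^{n-1}(E)=0$, then $\mathcal{H}^{n-1}(f^{-1}(E))=0$. At points $x$ of differentiability of $f$, put $\|f'(x)\|=\max_{h\in\mathbb{R}^n\setminus\{0\}}\frac{|f'(x)h|}{|h|}$ and $J(x,f)=\det f'(x)$. The outer dilatation of order $\alpha$ is $$K_{O,\alpha}(x,f)=\begin{cases}\dfrac{\|f'(x)\|^{\alpha}}{|J(x,f)|},& J(x,f)\neq0,\\ 1,& f'(x)=0,\\ \infty,&\text{otherwise.}\end{cases}$$ The multiplicity is $N(f,D)=\sup_{y\in\mathbb{R}^n}\mathrm{card}\{x\in D: f(x)=y\}$; it is finite for open, discrete and closed mappings of $D$. The function $Q(y)=\sum_{x\in f^{-1}(y)}K_{O,\alpha}(x,f)$ (also denoted $K_{I,\alpha}(y,f^{-1})$)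 is defined for those $y$ that are not images of points at which $f$ fails to have a total differential; this is almost every $y$, by the $N$-Luzin property. For sets $E,F\subset\overline{\mathbb{R}^n}=\mathbb{R}^n\cup\{\infty\}$ and a domain $G\subset\mathbb{R}^n$, $\Gamma(E,F,G)$ is the family of all paths $\gamma:[a,b]\rightarrow\overline{\mathbb{R}^n}$ with $\gamma(a)\in E$, $\gamma(b)\in F$ and $\gamma(t)\in G$ for $t\in(a,b)$. For $0<r_1<r_2<\sup_{y\in f(D)}|y-y_0|$, $\Gamma_f(y_0,C_1,C_2)$ is the family of all paths $\gamma$ in $D$ such that $f(\gamma)\in\Gamma(C_1,C_2,A(y_0,r_1,r_2))$. $M_\alpha(\Gamma)$ is the usual $\alpha$-modulus of a family of paths: $M_\alpha(\Gamma)=\inf\int_{\mathbb{R}^n}\rho^\alpha\,dm$ over all Borel $\rho:\mathbb{R}^n\to[0,\infty]$ with $\int_\gamma\rho\,ds\geqslant1$ for all locally rectifiable $\gamma\in\Gamma$. Definition. For a Lebesgue measurable function $Q_*$ with values in $[0,\infty]$, $f$ satisfies the inverse Poletsky inequality at $y_0\in\overline{f(D)}\setminus\{\infty\}$ with respect to $\alpha$-modulus (with $Q_*$) if there is $R_0>0$ such that $$M_\alpha(\Gamma_f(y_0,C_1,C_2))\leqslant\int_{A(y_0,r_1,r_2)\cap f(D)}Q_*(y)\,\eta^\alpha(|y-y_0|)\,dm(y)$$ for any $0<r_1<r_2<R_0$, any continua $C_1\subset\overline{B(y_0,r_1)}\cap f(D)$ and $C_2\subset f(D)\setminus B(y_0,r_2)$,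 and any Lebesgue measurable $\eta:(r_1,r_2)\rightarrow[0,\infty]$ with $\int_{r_1}^{r_2}\eta(r)\,dr\geqslant1$. *)

theory Defs
  imports "HOL-Analysis.Analysis"
begin

(* Power of an extended nonnegative number; intended for exponents a > 0. *)
definition ennreal_powr :: "ennreal \<Rightarrow> real \<Rightarrow> ennreal" where
  "ennreal_powr x a = (if x = \<infinity> then \<infinity> else ennreal (enn2real x powr a))"

definition annulus :: "'a::metric_space \<Rightarrow> real \<Rightarrow> real \<Rightarrow> 'a set" where
  "annulus y0 r1 r2 = {y. r1 < dist y y0 \<and> dist y y0 < r2}"

definition continuum :: "'a::topological_space set \<Rightarrow> bool" where
  "continuum C \<longleftrightarrow> C \<noteq> {} \<and> compact C \<and> connected C"

(* The s-dimensional Hausdorff outer measure, normalised so that it agrees with Lebesgue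
   measure when s is the dimension of the space. The covering sets are required to be bounded
   because the library's diameter has no meaningful value on unbounded sets. *)
definition hausdorff_content :: "nat \<Rightarrow> real \<Rightarrow> 'a::metric_space set \<Rightarrow> ennreal" where
  "hausdorff_content s \<delta> E =
     (INF U \<in> {U :: nat \<Rightarrow> 'a set. E \<subseteq> (\<Union>i. U i) \<and> (\<forall>i. bounded (U i) \<and> diameter (U i) \<le> \<delta>)}.
        \<Sum>i. if U i = {} then 0
            else ennreal (unit_ball_vol (real s) * (diameter (U i) / 2) ^ s))"

definition hausdorff_measure :: "nat \<Rightarrow> 'a::metric_space set \<Rightarrow> ennreal" where
  "hausdorff_measure s E = (SUP \<delta> \<in> {0<..}. hausdorff_content s \<delta> E)"

(* Paths are the library's, parametrised by [0,1]; a path on [a,b] is turned into one of these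
   by an affine change of parameter, which changes neither lengths nor line integrals. *)

definition path_length :: "(real \<Rightarrow> 'a::metric_space) \<Rightarrow> real \<Rightarrow> real \<Rightarrow> ennreal" where
  "path_length \<gamma> a b =
     (SUP ts \<in> {ts. sorted ts \<and> set ts \<subseteq> {a..b}}.
        \<Sum>i<length ts - 1. ennreal (dist (\<gamma> (ts ! i)) (\<gamma> (ts ! Suc i))))"

(* On a compact parameter interval, locally rectifiable and rectifiable mean the same. *)
definition rectifiable_path :: "(real \<Rightarrow> 'a::metric_space) \<Rightarrow> bool" where
  "rectifiable_path \<gamma> \<longleftrightarrow> path \<gamma> \<and> path_length \<gamma> 0 1 < \<infinity>"

(* Parametrisation by arc length. For rectifiable paths and 0 \<le> s \<le> length, such a t exists,
   and the point does not depend on its choice, since the path is constant between any two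
   such parameters. *)
definition arc_length_param :: "(real \<Rightarrow> 'a::metric_space) \<Rightarrow> real \<Rightarrow> 'a" where
  "arc_length_param \<gamma> s = \<gamma> (SOME t. t \<in> {0..1} \<and> path_length \<gamma> 0 t = ennreal s)"

(* The integral of \<rho> along \<gamma> with respect to arc length; meaningful for rectifiable \<gamma>. *)
definition line_integral :: "(real \<Rightarrow> 'a::metric_space) \<Rightarrow> ('a \<Rightarrow> ennreal) \<Rightarrow> ennreal" where
  "line_integral \<gamma> \<rho> =
     (\<integral>\<^sup>+ s. \<rho> (arc_length_param \<gamma> s) \<partial>(lebesgue_on {0..enn2real (path_length \<gamma> 0 1)}))"

definition admissible :: "('a::euclidean_space \<Rightarrow> ennreal) \<Rightarrow> (real \<Rightarrow> 'a) set \<Rightarrow> bool" where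
  "admissible \<rho> \<Gamma> \<longleftrightarrow>
     \<rho> \<in> borel_measurable borel \<and> (\<forall>\<gamma>\<in>\<Gamma>. rectifiable_path \<gamma> \<longrightarrow> 1 \<le> line_integral \<gamma> \<rho>)"

definition path_modulus :: "real \<Rightarrow> (real \<Rightarrow> 'a::euclidean_space) set \<Rightarrow> ennreal" where
  "path_modulus \<alpha> \<Gamma> = (INF \<rho> \<in> {\<rho>. admissible \<rho> \<Gamma>}. \<integral>\<^sup>+ x. ennreal_powr (\<rho> x) \<alpha> \<partial>lebesgue)"

(* Only families with E, F inside the finite space are needed, so the point at infinity is
   not represented: a path with end points in E and F and interior in G cannot meet it. *)
definition connecting_paths ::
    "'a::topological_space set \<Rightarrow> 'a set \<Rightarrow> 'a set \<Rightarrow> (real \<Rightarrow> 'a) set" where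
  "connecting_paths E F G =
     {\<gamma>. path \<gamma> \<and> pathstart \<gamma> \<in> E \<and> pathfinish \<gamma> \<in> F \<and> \<gamma> ` {0<..<1} \<subseteq> G}"

definition lifted_paths ::
    "'a::topological_space set \<Rightarrow> ('a \<Rightarrow> 'b::metric_space) \<Rightarrow> 'b \<Rightarrow> real \<Rightarrow> real
      \<Rightarrow> 'b set \<Rightarrow> 'b set \<Rightarrow> (real \<Rightarrow> 'a) set" where
  "lifted_paths D f y0 r1 r2 C1 C2 =
     {\<gamma>. path \<gamma> \<and> path_image \<gamma> \<subseteq> D \<and> f \<circ> \<gamma> \<in> connecting_paths C1 C2 (annulus y0 r1 r2)}"

definition inverse_poletsky_at ::
    "'a::euclidean_space set \<Rightarrow> ('a \<Rightarrow> 'a) \<Rightarrow> real \<Rightarrow> ('a \<Rightarrow> ennreal) \<Rightarrow> 'a \<Rightarrow> bool" where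
  "inverse_poletsky_at D f \<alpha> Q y0 \<longleftrightarrow>
     y0 \<in> closure (f ` D) \<and>
     Q \<in> borel_measurable (lebesgue_on (f ` D)) \<and>
     (\<exists>R0>0. \<forall>r1 r2 C1 C2. \<forall>\<eta> :: real \<Rightarrow> ennreal.
        0 < r1 \<and> r1 < r2 \<and> r2 < R0 \<and>
        continuum C1 \<and> C1 \<subseteq> cball y0 r1 \<inter> f ` D \<and>
        continuum C2 \<and> C2 \<subseteq> f ` D - ball y0 r2 \<and>
        \<eta> \<in> borel_measurable (lebesgue_on {r1<..<r2}) \<and>
        1 \<le> (\<integral>\<^sup>+ r. \<eta> r \<partial>(lebesgue_on {r1<..<r2})) \<longrightarrow>
        path_modulus \<alpha> (lifted_paths D f y0 r1 r2 C1 C2)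
          \<le> (\<integral>\<^sup>+ y. Q y * ennreal_powr (\<eta> (dist y y0)) \<alpha>
               \<partial>(lebesgue_on (annulus y0 r1 r2 \<inter> f ` D))))"

(* Meaningful at points of differentiability. *)
definition outer_dilatation ::
    "real \<Rightarrow> (real ^ 'n \<Rightarrow> real ^ 'n) \<Rightarrow> real ^ 'n \<Rightarrow> ennreal" where
  "outer_dilatation \<alpha> f x =
     (let f' = frechet_derivative f (at x); J = det (jacobian f (at x)) in
      if J \<noteq> 0 then ennreal (onorm f' powr \<alpha> / \<bar>J\<bar>)
      else if f' = (\<lambda>h. 0) then 1
      else \<infinity>)"

(* The value is 0 where the mathematical function is undefined, that is, at images of points
   of non-differentiability. *)
definition inner_dilatation ::
    "(real ^ 'n) set \<Rightarrow> real \<Rightarrow> (real ^ 'n \<Rightarrow> real ^ 'n) \<Rightarrow> real ^ 'n \<Rightarrow> ennreal" where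
  "inner_dilatation D \<alpha> f y =
     (if \<forall>x\<in>D. f x = y \<longrightarrow> f differentiable (at x)
      then \<Sum>\<^sub>\<infinity>x\<in>{x\<in>D. f x = y}. outer_dilatation \<alpha> f x
      else 0)"

(* Counting measure rather than card, which is 0 on infinite sets. *)
definition map_multiplicity :: "('a \<Rightarrow> 'b) \<Rightarrow> 'a set \<Rightarrow> ennreal" where
  "map_multiplicity f D = (SUP y. emeasure (count_space UNIV) {x\<in>D. f x = y})"

definition luzin_N :: "('a::euclidean_space \<Rightarrow> 'a) \<Rightarrow> 'a set \<Rightarrow> bool" where
  "luzin_N f D \<longleftrightarrow> (\<forall>E\<subseteq>D. E \<in> null_sets lebesgue \<longrightarrow> f ` E \<in> null_sets lebesgue)"

definition luzin_N_inverse_on_sphere ::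
    "(real ^ 'n \<Rightarrow> real ^ 'n) \<Rightarrow> (real ^ 'n) set \<Rightarrow> real ^ 'n \<Rightarrow> real \<Rightarrow> bool" where
  "luzin_N_inverse_on_sphere f D y0 r \<longleftrightarrow>
     (\<forall>E \<subseteq> sphere y0 r \<inter> f ` D.
        hausdorff_measure (CARD('n) - 1) E = 0 \<longrightarrow>
        hausdorff_measure (CARD('n) - 1) {x\<in>D. f x \<in> E} = 0)"

end

theory Submission
  imports Defs
begin

text \<open>
  Put \<open>v = |f - y\<^sub>0|\<close>, let \<open>E\<close> be a \<open>G\<^sub>\<delta>\<close> null set containing the points where \<open>f\<close> is not
  differentiable or \<open>J = 0\<close>, and let \<open>G = \<eta>(v) \<parallel>f'\<parallel>\<close> on the part of \<open>D - E\<close> lying over the annulus.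
  The area formula gives \<open>\<integral> G\<^sup>\<alpha> \<le> \<integral> Q \<eta>\<^sup>\<alpha>\<close>, so it would suffice that \<open>G\<close> be admissible; this may fail,
  because \<open>f\<close> need not be absolutely continuous along every path. Therefore \<open>G\<close> is averaged over balls
  \<open>B(x, \<kappa> R(x))\<close>, where the radius \<open>R\<close> is 1-Lipschitz and so small that \<open>v\<close> oscillates little
  on \<open>B(x, R(x))\<close>; by convexity and Tonelli this costs only a factor that tends to 1 with \<open>\<kappa> \<rightarrow> 0\<close>.

  The average is admissible up to such a factor: given a path \<open>\<gamma>\<close>, for almost every \<open>w\<close> in the unit
  ball the perturbed path \<open>\<gamma> + \<kappa> R(\<gamma>) w\<close> meets \<open>E\<close> only in a set with Lebesgue null image under \<open>v\<close>,
  and off \<open>E\<close> the one-dimensional area inequality applies. Indeed the Luzin properties show that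
  \<open>E \<inter> {v = r}\<close> is \<open>\<H>\<^sup>n\<^sup>-\<^sup>1\<close>-null for almost every \<open>r\<close>, so almost no perturbation of the
  rectifiable \<open>\<gamma>\<close> hits it, and Fubini's theorem in \<open>(w, r)\<close> concludes.
\<close>

section \<open>Change of variables for arbitrary finite index types\<close>

text \<open>On \<open>E\<close> the weight \<open>G\<close> vanishes, while the levels of
  \<open>v\<close> that a path passes there may fill a set of positive length; this is how
  admissibility can fail. Moving the path helps because a curve is one-dimensional: the directions
  \<open>w\<close> that bring a path of length \<open>L\<close> into a given ball of radius
  \<open>d\<close> are covered by about \<open>L / d\<close> balls of radius comparable to
  \<open>d\<close>. Their volume is of order \<open>d ^ (n - 1)\<close>, the quantity that Hausdorff
  null sets control. No single displacement suits all paths in \<open>D\<close>, so the radius must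
  shrink towards the boundary; the Lipschitz condition on \<open>R\<close> keeps the stretching of
  perturbed paths below \<open>1 + \<kappa>\<close> and makes balls centred at nearby points
  comparable. The displacement also moves the end points across levels, which costs a little of the
  integral of \<open>\<eta>\<close> at both ends of the interval. The set \<open>E\<close> is a
  \<open>G\<^sub>\<delta>\<close> so that the pairs \<open>(w, s)\<close> hitting it form one too;
  their image under direction and level need not be Borel, and Fubini is applied to the images of
  compact subsets only.\<close>

text \<open>The library proves the change of variables formula only for index types that are well-ordered.\<close>

typedef 'a ordered_copy = "UNIV :: 'a set" morphisms of_copy to_copy
  by simp

text \<open>Any injection into the naturals will do: it pulls their well-order back, and
  \<open>SOME\<close> merely fixes one.\<close>

definition copy_index :: "'a::finite ordered_copy \<Rightarrow> nat" where
  "copy_index x = (SOME h :: 'a \<Rightarrow> nat. inj h) (of_copy x)"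

lemma inj_copy_index: "inj (copy_index :: 'a::finite ordered_copy \<Rightarrow> nat)"
proof -
  have "\<exists>h :: 'a \<Rightarrow> nat. inj h"
    using finite_imp_inj_to_nat_seg[OF finite[of "UNIV :: 'a set"]] by (elim exE conjE) (rule exI)
  then have "inj (SOME h :: 'a \<Rightarrow> nat. inj h)" by (rule someI_ex)
  then have "of_copy x = of_copy y" if "copy_index x = copy_index y" for x y :: "'a ordered_copy"
    using that unfolding copy_index_def by (rule injD)
  then show ?thesis
    by (intro injI) (simp add: of_copy_inject)
qed

instantiation ordered_copy :: (finite) "{finite, wellorder}"
begin

definition less_eq_ordered_copy :: "'a ordered_copy \<Rightarrow> 'a ordered_copy \<Rightarrow> bool" where
  "x \<le> y \<longleftrightarrow> copy_index x \<le> copy_index y"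

definition less_ordered_copy :: "'a ordered_copy \<Rightarrow> 'a ordered_copy \<Rightarrow> bool" where
  "x < y \<longleftrightarrow> copy_index x < copy_index y"

instance
proof
  fix x y z :: "'a ordered_copy" and P :: "'a ordered_copy \<Rightarrow> bool"
  show "(x < y) = (x \<le> y \<and> \<not> y \<le> x)" "x \<le> x" "x \<le> y \<Longrightarrow> y \<le> z \<Longrightarrow> x \<le> z"
    "x \<le> y \<or> y \<le> x"
    by (auto simp: less_eq_ordered_copy_def less_ordered_copy_def)
  show "x \<le> y \<Longrightarrow> y \<le> x \<Longrightarrow> x = y"
    using inj_copy_index by (auto simp: less_eq_ordered_copy_def inj_def)
  show "(\<And>x. (\<And>y. y < x \<Longrightarrow> P y) \<Longrightarrow> P x) \<Longrightarrow> P x"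
    by (rule measure_induct_rule[of copy_index P x]) (auto simp: less_ordered_copy_def)
  have "(UNIV :: 'a ordered_copy set) = to_copy ` UNIV"
    by (rule type_definition.univ[OF type_definition_ordered_copy])
  then show "finite (UNIV :: 'a ordered_copy set)"
    by (rule ssubst) (rule finite_imageI[OF finite])
qed

end

definition vec_copy :: "real ^ 'n::finite \<Rightarrow> real ^ 'n ordered_copy" where
  "vec_copy x = (\<chi> i. x $ of_copy i)"

definition vec_uncopy :: "real ^ 'n::finite ordered_copy \<Rightarrow> real ^ 'n" where
  "vec_uncopy x = (\<chi> i. x $ to_copy i)"

lemma vec_uncopy_copy [simp]: "vec_uncopy (vec_copy x) = x"
  by (simp add: vec_uncopy_def vec_copy_def to_copy_inverse vec_eq_iff)

lemma vec_copy_uncopy [simp]: "vec_copy (vec_uncopy x) = x"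
  by (simp add: vec_uncopy_def vec_copy_def of_copy_inverse vec_eq_iff)

lemma vec_copy_nth: "vec_copy x $ i = x $ of_copy i"
  by (simp add: vec_copy_def)

lemma linear_vec_copy: "linear vec_copy"
  by (rule linearI) (auto simp: vec_copy_def vec_eq_iff)

lemma linear_vec_uncopy: "linear vec_uncopy"
  by (rule linearI) (auto simp: vec_uncopy_def vec_eq_iff)

lemma of_copy_to_copy [simp]: "of_copy (to_copy x) = x"
  by (simp add: to_copy_inverse)

lemma bij_of_copy: "bij of_copy"
  by (rule o_bij[of to_copy]) (auto simp: fun_eq_iff of_copy_inverse)

lemma bij_to_copy: "bij to_copy"
  by (rule o_bij[of of_copy]) (auto simp: fun_eq_iff of_copy_inverse)

lemma borel_vec_copy [measurable]:
  "vec_copy \<in> borel_measurable borel" "vec_uncopy \<in> borel_measurable borel"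
  by (intro borel_measurable_continuous_onI linear_continuous_on
      linear_vec_copy[unfolded linear_conv_bounded_linear]
      linear_vec_uncopy[unfolded linear_conv_bounded_linear])+

text \<open>Relabelling coordinates carries a box to a box with the same side lengths, and
  \<open>lborel\<close> is determined by its values on boxes.\<close>

lemma distr_vec_copy: "distr lborel borel (vec_copy :: real ^ 'n::finite \<Rightarrow> _) = lborel"
proof (rule sym, rule lborel_eqI)
  fix l u :: "real ^ 'n ordered_copy"
  assume le: "\<And>b. b \<in> Basis \<Longrightarrow> l \<bullet> b \<le> u \<bullet> b"
  have lu: "l $ i \<le> u $ i" for i
    using le[of "axis i 1"] by (simp add: inner_axis)
  have pre: "vec_copy -` box l u = box (vec_uncopy l) (vec_uncopy u)"
  proof -
    have "(\<forall>i. l $ i < x $ of_copy i \<and> x $ of_copy i < u $ i) \<longleftrightarrow>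
        (\<forall>i. l $ to_copy i < x $ i \<and> x $ i < u $ to_copy i)" for x :: "real ^ 'n"
      using of_copy_inverse of_copy_to_copy by metis
    then show ?thesis
      by (auto simp: mem_box_cart vec_copy_def vec_uncopy_def)
  qed
  have prod_cart: "(\<Prod>b\<in>Basis. (v - w) \<bullet> b) = (\<Prod>i\<in>UNIV. v $ i - w $ i)" for v w :: "real ^ 'k::finite"
    by (subst Basis_vec_def, simp add: prod.UNION_disjoint)
       (subst prod.UNION_disjoint; auto simp: axis_eq_axis inner_axis)
  have "emeasure (distr lborel borel vec_copy) (box l u)
      = emeasure lborel (box (vec_uncopy l) (vec_uncopy u))"
    by (subst emeasure_distr) (auto simp: pre)
  also have "\<dots> = (\<Prod>b\<in>Basis. (vec_uncopy u - vec_uncopy l) \<bullet> b)"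
  proof (rule emeasure_lborel_box)
    fix b :: "real ^ 'n" assume "b \<in> Basis"
    then show "vec_uncopy l \<bullet> b \<le> vec_uncopy u \<bullet> b"
      using lu by (auto simp: Basis_vec_def inner_axis vec_uncopy_def)
  qed
  also have "(\<Prod>b\<in>Basis. (vec_uncopy u - vec_uncopy l) \<bullet> b) = (\<Prod>i\<in>UNIV. u $ to_copy i - l $ to_copy i)"
    unfolding prod_cart by (simp add: vec_uncopy_def)
  also have "\<dots> = (\<Prod>i\<in>UNIV. u $ i - l $ i)"
    using bij_of_copy
    by (subst prod.reindex_bij_betw[OF bij_of_copy, symmetric]) (simp add: of_copy_inverse)
  finally show "emeasure (distr lborel borel vec_copy) (box l u) = (\<Prod>b\<in>Basis. (u - l) \<bullet> b)"
    unfolding prod_cart .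
qed simp

text \<open>Conjugation with the relabelling is a bijection between the permutations of the two
  index types and preserves signs, so the two Leibniz sums agree term by term.\<close>

lemma det_of_copy: "det (\<chi> i j. A $ of_copy i $ of_copy j) = det (A :: real ^ 'n ^ 'n)"
proof -
  have bij: "bij_betw of_copy (UNIV :: 'n ordered_copy set) UNIV" by (rule bij_of_copy)
  have inj: "inj_on of_copy (UNIV :: 'n ordered_copy set)" using bij by (rule bij_betw_imp_inj_on)
  let ?m = "map_permutation (UNIV :: 'n ordered_copy set) of_copy"
  have bb: "bij_betw ?m {p. p permutes (UNIV :: 'n ordered_copy set)} {p. p permutes (UNIV :: 'n set)}"
  proof (rule bij_betw_byWitness[where f' = "map_permutation UNIV to_copy"])
    have tc: "bij_betw to_copy (UNIV :: 'n set) UNIV" by (rule bij_to_copy)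
    show "\<forall>p\<in>{p. p permutes (UNIV :: 'n ordered_copy set)}. map_permutation UNIV to_copy (?m p) = p"
      using map_permutation_compose_inv[OF bij] by (simp add: of_copy_inverse)
    show "\<forall>p\<in>{p. p permutes (UNIV :: 'n set)}. ?m (map_permutation UNIV to_copy p) = p"
      using map_permutation_compose_inv[OF tc] by (simp add: to_copy_inverse)
    show "?m ` {p. p permutes UNIV} \<subseteq> {p. p permutes UNIV}"
      using map_permutation_permutes[OF bij] by auto
    show "map_permutation UNIV to_copy ` {p. p permutes (UNIV :: 'n set)} \<subseteq> {p. p permutes UNIV}"
      using map_permutation_permutes[OF tc] by auto
  qed
  have "det A = (\<Sum>p | p permutes (UNIV :: 'n ordered_copy set). of_int (sign (?m p)) * (\<Prod>i\<in>UNIV. A $ i $ ?m p i))"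
    unfolding det_def by (subst sum.reindex_bij_betw[OF bb, symmetric]) simp
  also have "\<dots> = (\<Sum>p | p permutes (UNIV :: 'n ordered_copy set). of_int (sign p) * (\<Prod>i\<in>UNIV. A $ of_copy i $ of_copy (p i)))"
  proof (rule sum.cong[OF refl])
    fix p assume "p \<in> {p. p permutes (UNIV :: 'n ordered_copy set)}"
    then have p: "p permutes UNIV" by simp
    have "(\<Prod>i\<in>UNIV. A $ i $ ?m p i) = (\<Prod>i\<in>UNIV. A $ of_copy i $ ?m p (of_copy i))"
      by (subst prod.reindex_bij_betw[OF bij, symmetric]) simp
    also have "\<dots> = (\<Prod>i\<in>UNIV. A $ of_copy i $ of_copy (p i))"
      by (simp add: map_permutation_apply[OF inj])
    finally show "of_int (sign (?m p)) * (\<Prod>i\<in>UNIV. A $ i $ ?m p i) =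
        of_int (sign p) * (\<Prod>i\<in>UNIV. A $ of_copy i $ of_copy (p i))"
      using sign_map_permutation[OF inj p] by simp
  qed
  also have "\<dots> = det (\<chi> i j. A $ of_copy i $ of_copy j)"
    unfolding det_def by simp
  finally show ?thesis by simp
qed

section \<open>Integral of the Jacobian against the measure of an injective image\<close>

lemma lebesgue_borel_hull:
  fixes B :: "'a::euclidean_space set"
  assumes "B \<in> sets lebesgue"
  obtains C where "C \<in> sets borel" "B \<subseteq> C" "emeasure lborel C = emeasure lebesgue B"
proof -
  obtain N where N: "N \<in> null_sets lborel" "null_part lborel B \<subseteq> N"
    using null_part[OF assms] by blast
  have "main_part lborel B \<in> sets lborel" using main_part_sets[OF assms] .
  moreover have "main_part lborel B \<union> null_part lborel B = B" using main_part_null_part_Un[OF assms] .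
  moreover have "emeasure lborel (main_part lborel B \<union> N) = emeasure lebesgue B"
    using emeasure_Un_null_set[OF main_part_sets[OF assms] N(1)] assms by (simp add: emeasure_completion)
  ultimately show ?thesis
    using N by (intro that[of "main_part lborel B \<union> N"]) auto
qed

text \<open>When the image has finite measure, the change of variables theorem even gives equality;
  when the measure is infinite, the bound is trivial.\<close>

lemma nn_integral_det_le_emeasure_image_ordered:
  fixes f :: "real ^ 'n::{finite,wellorder} \<Rightarrow> real ^ 'n::_"
  assumes S: "S \<in> sets lebesgue"
    and der: "\<And>x. x \<in> S \<Longrightarrow> (f has_derivative f' x) (at x within S)"
    and inj: "inj_on f S"
  shows "(\<integral>\<^sup>+ x. indicator S x * ennreal \<bar>det (matrix (f' x))\<bar> \<partial>lborel) \<le> emeasure lebesgue (f ` S)"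
proof (cases "f ` S \<in> lmeasurable")
  case True
  then have "((\<lambda>x. \<bar>det (matrix (f' x))\<bar>) has_integral measure lebesgue (f ` S)) S"
    using has_measure_differentiable_image[OF S der inj] by blast
  then have "(\<integral>\<^sup>+ x. indicator S x * ennreal \<bar>det (matrix (f' x))\<bar> \<partial>lborel) = measure lebesgue (f ` S)"
    by (subst nn_integral_has_integral_lebesgue[symmetric, where \<Omega>=S and f="\<lambda>x. \<bar>det (matrix (f' x))\<bar>"])
      (auto simp: ennreal_mult ennreal_indicator)
  then show ?thesis
    by (simp add: emeasure_eq_measure2[OF True])
next
  case False
  have "f ` S \<in> sets lebesgue"
    by (rule differentiable_image_in_sets_lebesgue[OF S])
      (auto simp: differentiable_on_def differentiable_def intro: der)
  then have "emeasure lebesgue (f ` S) = \<infinity>"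
    using False by (metis fmeasurableI infinity_ennreal_def less_top)
  then show ?thesis by simp
qed

text \<open>Conjugating \<open>f\<close> with the relabelling of coordinates reduces this to an
  ordered index type, because relabelling preserves both Lebesgue measure and determinants.\<close>

lemma nn_integral_det_le_emeasure_image:
  fixes f :: "real ^ 'n \<Rightarrow> real ^ 'n"
  assumes S: "S \<in> sets borel"
    and der: "\<And>x. x \<in> S \<Longrightarrow> (f has_derivative f' x) (at x within S)"
    and inj: "inj_on f S"
    and J [measurable]: "(\<lambda>x. indicator S x * ennreal \<bar>det (matrix (f' x))\<bar>) \<in> borel_measurable borel"
  shows "(\<integral>\<^sup>+ x. indicator S x * ennreal \<bar>det (matrix (f' x))\<bar> \<partial>lborel) \<le> emeasure lebesgue (f ` S)"
proof -
  let ?T = "vec_copy ` S"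
  let ?F = "\<lambda>z. vec_copy (f (vec_uncopy z))"
  let ?F' = "\<lambda>z h. vec_copy (f' (vec_uncopy z) (vec_uncopy h))"
  have T_eq: "?T = vec_uncopy -` S"
    by (auto simp: image_iff) (metis vec_copy_uncopy)
  have T: "?T \<in> sets borel"
    unfolding T_eq using measurable_sets[OF borel_vec_copy(2) S] by simp
  have image: "?F ` ?T = vec_copy ` f ` S"
    by (auto simp: image_iff)
  have derF: "(?F has_derivative ?F' z) (at z within ?T)" if "z \<in> ?T" for z
  proof -
    have z: "vec_uncopy z \<in> S" using that by (simp add: T_eq)
    have "vec_uncopy ` ?T = S" by (auto simp: image_image)
    then have "(f has_derivative f' (vec_uncopy z)) (at (vec_uncopy z) within vec_uncopy ` ?T)"
      using der[OF z] by simp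
    moreover have "(vec_uncopy has_derivative vec_uncopy) (at z within ?T)"
      using linear_vec_uncopy by (intro bounded_linear_imp_has_derivative) (simp add: linear_conv_bounded_linear)
    ultimately have "(f \<circ> vec_uncopy has_derivative f' (vec_uncopy z) \<circ> vec_uncopy) (at z within ?T)"
      by (intro diff_chain_within)
    from bounded_linear.has_derivative[OF linear_vec_copy[unfolded linear_conv_bounded_linear] this]
    show ?thesis by (simp add: o_def)
  qed
  have injF: "inj_on ?F ?T"
  proof (rule inj_onI)
    fix z w assume "z \<in> ?T" "w \<in> ?T" "?F z = ?F w"
    moreover from this(3) have "f (vec_uncopy z) = f (vec_uncopy w)" by (metis vec_uncopy_copy)
    ultimately have "vec_uncopy z = vec_uncopy w"
      using inj by (auto simp: T_eq inj_on_def)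
    then show "z = w" by (metis vec_copy_uncopy)
  qed
  have det: "det (matrix (?F' (vec_copy x))) = det (matrix (f' x))" for x
  proof -
    have "vec_uncopy (axis j 1) = axis (of_copy j) 1" for j :: "'n ordered_copy"
      by (auto simp: vec_uncopy_def axis_def vec_eq_iff to_copy_inverse of_copy_inverse)
    then have "matrix (?F' (vec_copy x)) = (\<chi> i j. matrix (f' x) $ of_copy i $ of_copy j)"
      by (simp add: matrix_def vec_eq_iff[where 'b="'n ordered_copy"] vec_copy_nth)
    then show ?thesis by (simp add: det_of_copy)
  qed
  have "f ` S \<in> sets lebesgue"
    using S by (intro differentiable_image_in_sets_lebesgue)
      (auto simp: differentiable_on_def differentiable_def intro: der)
  \<comment> \<open>The image is only Lebesgue measurable, whereas transport along
    \<open>vec_copy\<close> is a statement on Borel sets; hence a Borel hull of equal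
    measure.\<close>
  then obtain C where C: "C \<in> sets borel" "f ` S \<subseteq> C" "emeasure lborel C = emeasure lebesgue (f ` S)"
    by (rule lebesgue_borel_hull)
  have vC: "vec_copy ` C = vec_uncopy -` C"
    by (auto simp: image_iff) (metis vec_copy_uncopy)
  have vCb: "vec_copy ` C \<in> sets borel"
    unfolding vC using measurable_sets[OF borel_vec_copy(2) C(1)] by simp
  have "(\<integral>\<^sup>+ x. indicator S x * ennreal \<bar>det (matrix (f' x))\<bar> \<partial>lborel)
      = (\<integral>\<^sup>+ x. (\<lambda>z. indicator S (vec_uncopy z) * ennreal \<bar>det (matrix (f' (vec_uncopy z)))\<bar>) (vec_copy x) \<partial>lborel)"
    by simp
  also have "\<dots> = (\<integral>\<^sup>+ z. indicator S (vec_uncopy z) * ennreal \<bar>det (matrix (f' (vec_uncopy z)))\<bar> \<partial>distr lborel borel vec_copy)"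
  proof (rule nn_integral_distr[symmetric])
    show "vec_copy \<in> lborel \<rightarrow>\<^sub>M borel" by simp
    show "(\<lambda>z. indicator S (vec_uncopy z) * ennreal \<bar>det (matrix (f' (vec_uncopy z)))\<bar>) \<in> borel_measurable (distr lborel borel vec_copy)"
      using measurable_compose[OF borel_vec_copy(2) J] by simp
  qed
  also have "\<dots> = (\<integral>\<^sup>+ z. indicator ?T z * ennreal \<bar>det (matrix (?F' z))\<bar> \<partial>lborel)"
    unfolding distr_vec_copy
  proof (rule nn_integral_cong)
    fix z :: "real ^ 'n ordered_copy"
    show "indicator S (vec_uncopy z) * ennreal \<bar>det (matrix (f' (vec_uncopy z)))\<bar> =
        indicator ?T z * ennreal \<bar>det (matrix (?F' z))\<bar>"
      using det[of "vec_uncopy z"] by (simp add: T_eq indicator_def)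
  qed
  also have "\<dots> \<le> emeasure lebesgue (?F ` ?T)"
    using T by (intro nn_integral_det_le_emeasure_image_ordered derF injF) auto
  also have "\<dots> \<le> emeasure lebesgue (vec_copy ` C)"
    unfolding image using C vCb by (intro emeasure_mono) auto
  also have "\<dots> = emeasure lborel (vec_copy ` C)" using vCb by simp
  also have "\<dots> = emeasure (distr lborel borel vec_copy) (vec_copy ` C)" by (simp add: distr_vec_copy)
  also have "\<dots> = emeasure lborel C"
    using vCb by (subst emeasure_distr) (auto simp: vC vimage_def)
  finally show ?thesis by (simp add: C)
qed

section \<open>The area inequality with multiplicity\<close>

lemma derivative_borel_measurable:
  fixes f :: "'a::euclidean_space \<Rightarrow> 'b::euclidean_space"
  assumes D: "open D" and cont: "continuous_on D f" and W: "W \<in> sets borel" "W \<subseteq> D"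
    and diff: "\<And>x. x \<in> W \<Longrightarrow> f differentiable (at x)"
  shows "(\<lambda>x. if x \<in> W then frechet_derivative f (at x) h else 0) \<in> borel_measurable borel"
proof -
  have [measurable]: "W \<in> sets borel" "D \<in> sets borel" using W D by auto
  \<comment> \<open>The difference quotients evaluate \<open>f\<close> at points that may lie
    outside \<open>D\<close>. Extension by 0 makes them Borel and, \<open>D\<close> being open, does
    not affect the limit.\<close>
  define f0 where "f0 x = (if x \<in> D then f x else 0)" for x
  have [measurable]: "f0 \<in> borel_measurable borel"
    using borel_measurable_continuous_on_if[of D f "\<lambda>_. 0"] D cont unfolding f0_def by auto
  define q where "q i x = (if x \<in> W then real (Suc i) *\<^sub>R (f0 (x + h /\<^sub>R real (Suc i)) - f0 x) else 0)" for i x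
  show ?thesis
  proof (rule borel_measurable_LIMSEQ_metric)
    show "q i \<in> borel_measurable borel" for i unfolding q_def by measurable
    fix x :: 'a
    show "(\<lambda>i. q i x) \<longlonglongrightarrow> (if x \<in> W then frechet_derivative f (at x) h else 0)"
    proof (cases "x \<in> W")
      case True
      let ?f' = "frechet_derivative f (at x)"
      have der: "(f has_derivative ?f') (at x)"
        using diff[OF True] frechet_derivative_works by blast
      have "(f0 has_derivative ?f') (at x)"
        using der D W(2) True by (intro has_derivative_transform_within_open[OF der D]) (auto simp: f0_def)
      moreover have "((\<lambda>t :: real. x + t *\<^sub>R h) has_derivative (\<lambda>t. t *\<^sub>R h)) (at 0)"
        by (auto intro!: derivative_eq_intros)
      ultimately have "((\<lambda>t :: real. f0 (x + t *\<^sub>R h)) has_derivative (\<lambda>t. ?f' (t *\<^sub>R h))) (at 0)"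
        using has_derivative_compose[of "\<lambda>t :: real. x + t *\<^sub>R h" "\<lambda>t. t *\<^sub>R h" 0 UNIV f0 ?f'] by simp
      moreover have "?f' (t *\<^sub>R h) = t *\<^sub>R ?f' h" for t
        using has_derivative_linear[OF der] by (rule linear_scale)
      ultimately have "((\<lambda>t :: real. norm (f0 (x + t *\<^sub>R h) - f0 x - t *\<^sub>R ?f' h) / norm t) \<longlongrightarrow> 0) (at 0)"
        by (simp add: has_derivative_at)
      moreover have "norm (f0 (x + t *\<^sub>R h) - f0 x - t *\<^sub>R ?f' h) / norm t = norm ((f0 (x + t *\<^sub>R h) - f0 x) /\<^sub>R t - ?f' h)"
        if "t \<noteq> 0" for t :: real
      proof -
        have "(f0 (x + t *\<^sub>R h) - f0 x) /\<^sub>R t - ?f' h = (f0 (x + t *\<^sub>R h) - f0 x - t *\<^sub>R ?f' h) /\<^sub>R t"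
          using that by (simp add: scaleR_diff_right)
        then show ?thesis by (simp add: divide_inverse mult.commute)
      qed
      then have "\<forall>\<^sub>F t in at (0 :: real). norm (f0 (x + t *\<^sub>R h) - f0 x - t *\<^sub>R ?f' h) / norm t
          = norm ((f0 (x + t *\<^sub>R h) - f0 x) /\<^sub>R t - ?f' h)"
        by (auto simp: eventually_at_filter)
      ultimately have "((\<lambda>t :: real. norm ((f0 (x + t *\<^sub>R h) - f0 x) /\<^sub>R t - ?f' h)) \<longlongrightarrow> 0) (at 0)"
        by (rule Lim_transform_eventually)
      then have "((\<lambda>t. (f0 (x + t *\<^sub>R h) - f0 x) /\<^sub>R t) \<longlongrightarrow> ?f' h) (at 0)"
        by (subst Lim_null) (rule tendsto_norm_zero_cancel)
      moreover have "filterlim (\<lambda>i. 1 / real (Suc i)) (at 0) sequentially"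
        unfolding filterlim_at using LIMSEQ_Suc[OF lim_1_over_n] by (auto intro!: always_eventually)
      ultimately have "(\<lambda>i. (f0 (x + (1 / real (Suc i)) *\<^sub>R h) - f0 x) /\<^sub>R (1 / real (Suc i))) \<longlonglongrightarrow> ?f' h"
        by (rule filterlim_compose)
      then show ?thesis using True by (simp add: q_def divide_inverse)
    qed (simp add: q_def)
  qed
qed

text \<open>By continuity in \<open>h\<close>, the bound
  \<open>norm (g h x) \<le> a * norm h\<close> holds everywhere once it holds on a countable dense
  set, so sublevel sets of the operator norm are countable intersections of Borel sets.\<close>

lemma onorm_derivative_borel_measurable:
  fixes f :: "'a::euclidean_space \<Rightarrow> 'b::euclidean_space"
  assumes D: "open D" and cont: "continuous_on D f" and W: "W \<in> sets borel" "W \<subseteq> D"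
    and diff: "\<And>x. x \<in> W \<Longrightarrow> f differentiable (at x)"
  shows "(\<lambda>x. if x \<in> W then onorm (frechet_derivative f (at x)) else 0) \<in> borel_measurable borel"
proof -
  define g where "g h x = (if x \<in> W then frechet_derivative f (at x) h else 0)" for h x
  have [measurable]: "g h \<in> borel_measurable borel" for h
    unfolding g_def by (rule derivative_borel_measurable[OF assms])
  have bl: "bounded_linear (\<lambda>h. g h x)" for x
  proof (cases "x \<in> W")
    case True
    then have "(f has_derivative frechet_derivative f (at x)) (at x)"
      using diff frechet_derivative_works by blast
    then show ?thesis using True by (simp add: g_def has_derivative_bounded_linear)
  qed (simp add: g_def)
  obtain S :: "'a set" where S: "countable S" "\<And>X. open X \<Longrightarrow> X \<noteq> {} \<Longrightarrow> \<exists>d\<in>S. d \<in> X"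
    by (erule countable_dense_setE)
  have iff: "onorm (\<lambda>h. g h x) \<le> a \<longleftrightarrow> (\<forall>h\<in>S. norm (g h x) \<le> a * norm h)" for x a
  proof
    assume "onorm (\<lambda>h. g h x) \<le> a"
    then show "\<forall>h\<in>S. norm (g h x) \<le> a * norm h"
      using onorm[OF bl] by (meson mult_right_mono norm_ge_zero order_trans)
  next
    assume le: "\<forall>h\<in>S. norm (g h x) \<le> a * norm h"
    have cl: "closed {h. norm (g h x) \<le> a * norm h}"
      by (intro closed_Collect_le continuous_intros linear_continuous_on bl)
    have "h \<in> {h. norm (g h x) \<le> a * norm h}" for h
    proof (rule ccontr)
      assume "h \<notin> {h. norm (g h x) \<le> a * norm h}"
      then obtain d where "d \<in> S" "d \<in> - {h. norm (g h x) \<le> a * norm h}"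
        using S(2)[of "- {h. norm (g h x) \<le> a * norm h}"] cl by auto
      then show False using le by auto
    qed
    then show "onorm (\<lambda>h. g h x) \<le> a" by (intro onorm_le) auto
  qed
  have "(\<lambda>x. onorm (\<lambda>h. g h x)) \<in> borel_measurable borel"
    unfolding borel_measurable_iff_le iff
  proof
    fix a
    have "(\<Inter>h\<in>S. {x. norm (g h x) \<le> a * norm h}) \<in> sets borel"
      using S(1) by (intro sets.countable_INT'') auto
    then show "{x \<in> space borel. \<forall>h\<in>S. norm (g h x) \<le> a * norm h} \<in> sets borel"
      by (rule back_subst[where P = "\<lambda>A. A \<in> sets borel"]) auto
  qed
  moreover have "(\<lambda>x. onorm (\<lambda>h. g h x)) = (\<lambda>x. if x \<in> W then onorm (frechet_derivative f (at x)) else 0)"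
    by (auto simp: g_def onorm_zero)
  ultimately show ?thesis by simp
qed

lemma det_jacobian_borel_measurable:
  fixes f :: "real ^ 'n \<Rightarrow> real ^ 'n"
  assumes "open D" "continuous_on D f" "W \<in> sets borel" "W \<subseteq> D"
    and "\<And>x. x \<in> W \<Longrightarrow> f differentiable (at x)"
  shows "(\<lambda>x. if x \<in> W then det (jacobian f (at x)) else 0) \<in> borel_measurable borel"
proof -
  have [measurable]: "W \<in> sets borel" by fact
  define g where "g h x = (if x \<in> W then frechet_derivative f (at x) h else 0)" for h x
  have [measurable]: "g h \<in> borel_measurable borel" for h
    unfolding g_def by (rule derivative_borel_measurable[OF assms])
  have [measurable]: "(\<lambda>x. g h x $ i) \<in> borel_measurable borel" for h i
    unfolding cart_eq_inner_axis by measurable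
  have "(\<lambda>x. if x \<in> W then det (\<chi> i j. g (axis j 1) x $ i) else 0) \<in> borel_measurable borel"
    unfolding det_def vec_lambda_beta by measurable
  moreover have "(\<lambda>x. if x \<in> W then det (\<chi> i j. g (axis j 1) x $ i) else 0)
      = (\<lambda>x. if x \<in> W then det (jacobian f (at x)) else 0)"
    by (auto simp: g_def jacobian_def matrix_def)
  ultimately show ?thesis by simp
qed

section \<open>Decomposition into countably many injective pieces\<close>

lemma locally_expanding:
  fixes f :: "real ^ 'n \<Rightarrow> real ^ 'n"
  assumes "f differentiable (at x)" "det (jacobian f (at x)) \<noteq> 0"
  obtains j :: nat where
    "\<And>x'. dist x' x < 1 / real (Suc j) \<Longrightarrow> dist x' x / real (Suc j) \<le> dist (f x') (f x)"
proof -
  let ?f' = "frechet_derivative f (at x)"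
  have der: "(f has_derivative ?f') (at x)" using assms(1) frechet_derivative_works by blast
  have lin: "linear ?f'" using der by (rule has_derivative_linear)
  have "inj ?f'"
    using assms(2) det_nz_iff_inj[OF lin] by (simp add: jacobian_def)
  then obtain B where B: "0 < B" "\<And>h. B * norm h \<le> norm (?f' h)"
    using linear_inj_bounded_below_pos[OF lin] by blast
  obtain d where d: "0 < d" "\<And>y. norm (y - x) < d \<Longrightarrow> norm (f y - f x - ?f' (y - x)) \<le> B / 2 * norm (y - x)"
    using der B(1) unfolding has_derivative_at_alt by (metis half_gt_zero)
  \<comment> \<open>One integer serves both as scale and as rate: \<open>1 / (j + 1)\<close> lies
    below \<open>d\<close> and below \<open>B / 2\<close>, where the other half of the lower bound
    \<open>B\<close> of the derivative absorbs the error term.\<close>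
  have "0 < min d (B / 2)" using d B by simp
  then obtain j where j: "1 / real (Suc j) < min d (B / 2)" by (metis nat_approx_posE)
  show thesis
  proof (rule that[of j])
    fix y assume y: "dist y x < 1 / real (Suc j)"
    then have "norm (y - x) < d" using j by (simp add: dist_norm)
    from d(2)[OF this] B(2)[of "y - x"]
    have "B / 2 * norm (y - x) \<le> norm (f y - f x)"
      using norm_triangle_ineq2[of "?f' (y - x)" "?f' (y - x) - (f y - f x)"] by (simp add: norm_minus_commute)
    moreover have "1 / real (Suc j) * norm (y - x) \<le> B / 2 * norm (y - x)"
      using j by (intro mult_right_mono) auto
    ultimately have "1 / real (Suc j) * norm (y - x) \<le> norm (f y - f x)" by (rule order_trans[rotated])
    then show "dist y x / real (Suc j) \<le> dist (f y) (f x)" by (simp add: dist_norm)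
  qed
qed

text \<open>Points at which \<open>f\<close> expands distances at a common scale and rate form
  \<open>A j\<close>, and two such points close together have distinct images. Small balls around a
  countable dense set cut \<open>A j\<close> into countably many pieces, which are made disjoint at
  the end.\<close>

lemma injective_decomposition:
  fixes f :: "real ^ 'n \<Rightarrow> real ^ 'n"
  assumes W: "W \<in> sets borel" and diff: "\<And>x. x \<in> W \<Longrightarrow> f differentiable (at x)"
    and det: "\<And>x. x \<in> W \<Longrightarrow> det (jacobian f (at x)) \<noteq> 0"
  shows "\<exists>P :: nat \<Rightarrow> (real ^ 'n) set. (\<forall>k. P k \<in> sets borel) \<and> disjoint_family P \<and>
    (\<Union>k. P k) = W \<and> (\<forall>k. inj_on f (P k))"
proof -
  have cont: "continuous_on W f"
    using diff by (meson differentiable_imp_continuous_within continuous_at_imp_continuous_on)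
  define A where "A j = {x \<in> W. \<forall>x'\<in>W. dist x' x < 1 / real (Suc j) \<longrightarrow> dist x' x / real (Suc j) \<le> dist (f x') (f x)}" for j
  have A_borel: "A j \<in> sets borel" for j
  proof (cases "W = {}")
    case False
    let ?B = "\<lambda>x'. {x \<in> W. dist x' x < 1 / real (Suc j) \<longrightarrow> dist x' x / real (Suc j) \<le> dist (f x') (f x)}"
    \<comment> \<open>The implication is a union of two conditions, distance at least the radius or
      the expansion inequality, and each is closed in \<open>W\<close> by continuity of
      \<open>f\<close> there.\<close>
    have "closedin (top_of_set W) (?B x')" for x'
    proof -
      have "continuous_on W (\<lambda>x. dist x' x)" "continuous_on W (\<lambda>x. dist (f x') (f x) - dist x' x / real (Suc j))"
        by (intro continuous_intros cont; simp)+
      then have "closedin (top_of_set W) (W \<inter> (\<lambda>x. dist x' x) -` {1 / real (Suc j)..})"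
        "closedin (top_of_set W) (W \<inter> (\<lambda>x. dist (f x') (f x) - dist x' x / real (Suc j)) -` {0..})"
        by (intro continuous_closedin_preimage; simp)+
      then have "closedin (top_of_set W) (W \<inter> (\<lambda>x. dist x' x) -` {1 / real (Suc j)..} \<union>
          W \<inter> (\<lambda>x. dist (f x') (f x) - dist x' x / real (Suc j)) -` {0..})"
        by (rule closedin_Un)
      then show ?thesis by (rule back_subst[where P = "closedin _"]) auto
    qed
    then have "closedin (top_of_set W) (\<Inter>x'\<in>W. ?B x')"
      using False by (intro closedin_INT) auto
    also have "(\<Inter>x'\<in>W. ?B x') = A j"
      using False by (auto simp: A_def)
    finally show ?thesis using W by (auto simp: closedin_closed)
  qed (simp add: A_def)
  obtain S :: "(real ^ 'n) set" where S: "countable S" "\<And>X. open X \<Longrightarrow> X \<noteq> {} \<Longrightarrow> \<exists>d\<in>S. d \<in> X"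
    by (erule countable_dense_setE)
  have "S \<noteq> {}" using S(2)[of UNIV] by auto
  define q where "q = from_nat_into S"
  \<comment> \<open>Half the radius keeps any two points of a piece within
    \<open>1 / (j + 1)\<close>, the scale at which points of \<open>A j\<close> expand
    distances.\<close>
  define R where "R k = A (fst (prod_decode k)) \<inter> ball (q (snd (prod_decode k))) (1 / (2 * real (Suc (fst (prod_decode k)))))" for k
  have R_borel: "range R \<subseteq> sets borel" using A_borel by (auto simp: R_def)
  have R_inj: "inj_on f (R k)" for k
  proof (rule inj_onI)
    fix x y assume xy: "x \<in> R k" "y \<in> R k" "f x = f y"
    let ?j = "fst (prod_decode k)" and ?z = "q (snd (prod_decode k))"
    have "dist ?z x < 1 / (2 * real (Suc ?j))" "dist ?z y < 1 / (2 * real (Suc ?j))"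
      using xy by (simp_all add: R_def)
    then have "dist x y < 1 / (2 * real (Suc ?j)) + 1 / (2 * real (Suc ?j))"
      using dist_triangle3[of x y ?z] by linarith
    then have "dist x y < 1 / real (Suc ?j)" by (simp add: field_simps)
    then have "dist x y / real (Suc ?j) \<le> dist (f x) (f y)"
      using xy by (auto simp: R_def A_def)
    then show "x = y" using xy(3) by (simp add: divide_le_0_iff)
  qed
  have R_UN: "(\<Union>k. R k) = W"
  proof
    show "W \<subseteq> (\<Union>k. R k)"
    proof
      fix x assume x: "x \<in> W"
      obtain j where "\<And>x'. dist x' x < 1 / real (Suc j) \<Longrightarrow> dist x' x / real (Suc j) \<le> dist (f x') (f x)"
        using locally_expanding[OF diff[OF x] det[OF x]] by blast
      then have "x \<in> A j" using x by (auto simp: A_def)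
      moreover obtain d where "d \<in> S" "d \<in> ball x (1 / (2 * real (Suc j)))"
        using S(2)[of "ball x (1 / (2 * real (Suc j)))"] by auto
      moreover obtain i where "q i = d"
        using \<open>d \<in> S\<close> S(1) by (metis q_def from_nat_into_to_nat_on)
      ultimately have "x \<in> R (prod_encode (j, i))"
        by (simp add: R_def dist_commute)
      then show "x \<in> (\<Union>k. R k)" by blast
    qed
  qed (auto simp: R_def A_def)
  show ?thesis
  proof (intro exI[of _ "disjointed R"] conjI allI)
    show "disjointed R k \<in> sets borel" for k
      using sets.range_disjointed_sets[OF R_borel] by auto
    show "disjoint_family (disjointed R)" by (rule disjoint_family_disjointed)
    show "(\<Union>k. disjointed R k) = W" unfolding UN_disjointed_eq R_UN ..
    show "inj_on f (disjointed R k)" for k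
      using R_inj disjointed_subset by (rule inj_on_subset)
  qed
qed

text \<open>On an injective piece the fibre over \<open>y\<close> is at most one point, and the
  change of variables bound can be carried from sets to integrands. Adding the pieces turns the
  single value of \<open>F\<close> into the sum over the fibre.\<close>

lemma area_inequality:
  fixes f :: "real ^ 'n \<Rightarrow> real ^ 'n" and F :: "real ^ 'n \<Rightarrow> ennreal"
  assumes D: "open D" "continuous_on D f" and W: "W \<in> sets borel" "W \<subseteq> D"
    and diff: "\<And>x. x \<in> W \<Longrightarrow> f differentiable (at x)"
    and det: "\<And>x. x \<in> W \<Longrightarrow> det (jacobian f (at x)) \<noteq> 0"
    and F [measurable]: "F \<in> borel_measurable borel"
  shows "(\<integral>\<^sup>+ x. F x * (indicator W x * ennreal \<bar>det (jacobian f (at x))\<bar>) \<partial>lborel)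
    \<le> (\<integral>\<^sup>+ y. (\<Sum>\<^sub>\<infinity>x\<in>{x \<in> W. f x = y}. F x) \<partial>lebesgue)"
proof -
  have [measurable]: "W \<in> sets borel" by fact
  let ?d = "\<lambda>x. ennreal \<bar>det (jacobian f (at x))\<bar>"
  define J where "J x = (if x \<in> W then det (jacobian f (at x)) else 0)" for x
  have [measurable]: "J \<in> borel_measurable borel"
    unfolding J_def by (rule det_jacobian_borel_measurable[OF D W diff])
  have J_eq: "indicator A x * ?d x = indicator A x * ennreal \<bar>J x\<bar>" if "A \<subseteq> W" for A x
    using that by (auto simp: J_def indicator_def)
  obtain P :: "nat \<Rightarrow> (real ^ 'n) set" where P': "(\<forall>k. P k \<in> sets borel) \<and> disjoint_family P \<and>
      (\<Union>k. P k) = W \<and> (\<forall>k. inj_on f (P k))"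
    by (rule exE[OF injective_decomposition[OF W(1) diff det]]) (assumption, assumption, rule that)
  then have P: "\<And>k. P k \<in> sets borel" "disjoint_family P" "(\<Union>k. P k) = W" "\<And>k. inj_on f (P k)"
    by simp_all
  have [measurable]: "P k \<in> sets borel" for k by (rule P)
  let ?S = "\<lambda>y. \<Sum>\<^sub>\<infinity>x\<in>{x \<in> W. f x = y}. F x"
  let ?p = "\<lambda>k x. F x * (indicator (P k) x * ennreal \<bar>J x\<bar>)"
  have P_sub: "P k \<subseteq> W" for k using P(3) by blast
  have der: "(f has_derivative frechet_derivative f (at x)) (at x within A)" if "x \<in> W" for x A
    using diff[OF that] frechet_derivative_works has_derivative_at_withinI by blast
  have img: "f ` A \<in> sets lebesgue" if "A \<in> sets borel" "A \<subseteq> W" for A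
    using that by (intro differentiable_image_in_sets_lebesgue)
      (auto simp: differentiable_on_def differentiable_def intro: der)
  \<comment> \<open>The inverse branch of \<open>f\<close> on a piece, with default 0 off the image;
    because of the default, the preimage of \<open>A\<close> below depends on whether
    \<open>0 \<in> A\<close>.\<close>
  define \<phi> where "\<phi> k y = (if y \<in> f ` P k then inv_into (P k) f y else 0)" for k y
  have \<phi>_eq: "\<phi> k (f x) = x" if "x \<in> P k" for k x
    using that P(4) by (simp add: \<phi>_def)
  let ?q = "\<lambda>k y. F (\<phi> k y) * indicator (f ` P k) y"
  have \<phi>_img: "\<phi> k -` A \<inter> f ` P k = f ` (A \<inter> P k)" for k A
    using \<phi>_eq by (auto simp: image_iff)
  have \<phi>_meas [measurable]: "\<phi> k \<in> borel_measurable lebesgue" for k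
  proof (rule measurableI)
    fix A :: "(real ^ 'n) set" assume A: "A \<in> sets borel"
    have "\<phi> k -` A = f ` (A \<inter> P k) \<union> (if 0 \<in> A then - f ` P k else {})"
    proof -
      have "\<phi> k -` A = (\<phi> k -` A \<inter> f ` P k) \<union> (\<phi> k -` A \<inter> - f ` P k)" by blast
      moreover have "\<phi> k -` A \<inter> - f ` P k = (if 0 \<in> A then - f ` P k else {})"
        by (auto simp: \<phi>_def)
      ultimately show ?thesis by (simp only: \<phi>_img)
    qed
    moreover have "f ` (A \<inter> P k) \<in> sets lebesgue" "- f ` P k \<in> sets lebesgue"
      using A P P_sub[of k] by (auto intro!: img Compl_in_sets_lebesgue[THEN iffD2])
    ultimately show "\<phi> k -` A \<inter> space lebesgue \<in> sets lebesgue" by auto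
  qed simp
  have fP [measurable]: "f ` P k \<in> sets lebesgue" for k using img P P_sub by blast
  have piece: "(\<integral>\<^sup>+ x. ?p k x \<partial>lborel)
      \<le> (\<integral>\<^sup>+ y. ?q k y \<partial>lebesgue)" for k
  proof -
    \<comment> \<open>Jacobian density on \<open>P k\<close> against the pushforward, under the
      inverse branch, of Lebesgue measure on the image. Comparing them on sets gives the inequality
      for every Borel \<open>F\<close> at once; the restriction to the image removes the default
      value of \<open>\<phi>\<close>.\<close>
    define N1 where "N1 = density lborel (\<lambda>x. indicator (P k) x * ennreal \<bar>J x\<bar>)"
    define N2 where "N2 = distr (density lebesgue (indicator (f ` P k) :: _ \<Rightarrow> ennreal)) borel (\<phi> k)"
    have "N1 \<le> N2"
    proof (subst le_measure)
      show "\<forall>A\<in>sets N1. emeasure N1 A \<le> emeasure N2 A"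
      proof
        fix A assume "A \<in> sets N1"
        then have A [measurable]: "A \<in> sets borel" by (simp add: N1_def)
        have AP: "A \<inter> P k \<in> sets borel" "A \<inter> P k \<subseteq> W" using P_sub by auto
        have "emeasure N1 A = (\<integral>\<^sup>+ x. indicator (A \<inter> P k) x * ?d x \<partial>lborel)"
          unfolding N1_def J_eq[OF AP(2)] by (subst emeasure_density) (auto intro!: nn_integral_cong simp: indicator_def)
        also have "\<dots> \<le> emeasure lebesgue (f ` (A \<inter> P k))"
          unfolding jacobian_def
        proof (rule nn_integral_det_le_emeasure_image)
          show "inj_on f (A \<inter> P k)" using P(4) by (rule inj_on_subset) auto
          show "(\<lambda>x. indicator (A \<inter> P k) x * ennreal \<bar>det (matrix (frechet_derivative f (at x)))\<bar>) \<in> borel_measurable borel"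
            unfolding jacobian_def[symmetric] J_eq[OF AP(2)] by measurable
        qed (use AP der in auto)
        also have "\<dots> = emeasure N2 A"
          unfolding N2_def
          by (subst emeasure_distr; simp?; subst emeasure_density)
            (auto simp: \<phi>_img[symmetric] Int_commute indicator_inter_arith[symmetric] measurable_sets[OF \<phi>_meas A, simplified])
        finally show "emeasure N1 A \<le> emeasure N2 A" .
      qed
    qed (simp add: N1_def N2_def)
    then have "integral\<^sup>N N1 F \<le> integral\<^sup>N N2 F"
      by (intro nn_integral_mono_measure) (simp_all add: N1_def N2_def)
    also have "integral\<^sup>N N1 F = (\<integral>\<^sup>+ x. ?p k x \<partial>lborel)"
      unfolding N1_def by (subst nn_integral_density) (auto simp: mult.commute)
    also have "integral\<^sup>N N2 F = (\<integral>\<^sup>+ y. ?q k y \<partial>lebesgue)"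
      unfolding N2_def by (subst nn_integral_distr; simp?; subst nn_integral_density) (auto simp: mult.commute)
    finally show ?thesis .
  qed
  have "(\<integral>\<^sup>+ x. F x * (indicator W x * ?d x) \<partial>lborel)
      = (\<integral>\<^sup>+ x. (\<Sum>k. ?p k x) \<partial>lborel)"
  proof (rule nn_integral_cong)
    fix x
    have "(\<Sum>k. ?p k x) = (\<Sum>k. (F x * ennreal \<bar>J x\<bar>) * indicator (P k) x)"
      by (simp add: mult_ac)
    also have "\<dots> = (F x * ennreal \<bar>J x\<bar>) * indicator W x"
      by (subst ennreal_suminf_cmult, subst suminf_indicator[OF P(2)]) (simp add: P(3))
    finally show "F x * (indicator W x * ?d x) = (\<Sum>k. ?p k x)"
      by (simp add: J_eq mult_ac)
  qed
  also have "\<dots> = (\<Sum>k. \<integral>\<^sup>+ x. ?p k x \<partial>lborel)"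
    by (rule nn_integral_suminf) measurable
  also have "\<dots> \<le> (\<Sum>k. \<integral>\<^sup>+ y. ?q k y \<partial>lebesgue)"
    using piece by (intro suminf_le) auto
  also have "\<dots> = (\<integral>\<^sup>+ y. (\<Sum>k. ?q k y) \<partial>lebesgue)"
    by (rule nn_integral_suminf[symmetric]) measurable
  also have "\<dots> \<le> (\<integral>\<^sup>+ y. ?S y \<partial>lebesgue)"
  proof (rule nn_integral_mono)
    fix y
    \<comment> \<open>Disjoint pieces supply distinct preimages of \<open>y\<close>, so a partial
      sum over pieces is a sum of \<open>F\<close> over a finite part of the fibre.\<close>
    have "(\<Sum>k<m. ?q k y) \<le> ?S y" for m
    proof -
      let ?I = "{k \<in> {..<m}. y \<in> f ` P k}"
      have in_P: "\<phi> k y \<in> P k \<and> f (\<phi> k y) = y" if "k \<in> ?I" for k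
        using that \<phi>_eq by auto
      have inj: "inj_on (\<lambda>k. \<phi> k y) ?I"
      proof (rule inj_onI)
        fix i j assume ij: "i \<in> ?I" "j \<in> ?I" "\<phi> i y = \<phi> j y"
        then have "\<phi> i y \<in> P i \<inter> P j" using in_P by fastforce
        then show "i = j" using P(2) unfolding disjoint_family_on_def by blast
      qed
      have "(\<Sum>k<m. ?q k y) = (\<Sum>k\<in>?I. F (\<phi> k y))"
        by (rule sum.mono_neutral_cong_right) (auto simp: indicator_def)
      also have "\<dots> = (\<Sum>x\<in>(\<lambda>k. \<phi> k y) ` ?I. F x)"
        using sum.reindex[OF inj, of F] by simp
      also have "\<dots> = (\<Sum>\<^sub>\<infinity>x\<in>(\<lambda>k. \<phi> k y) ` ?I. F x)" by simp
      also have "\<dots> \<le> ?S y"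
        using in_P P_sub by (intro infsum_mono_neutral nonneg_summable_on_complete) auto
      finally show ?thesis .
    qed
    then show "(\<Sum>k. ?q k y) \<le> ?S y"
      unfolding suminf_eq_SUP by (rule SUP_least)
  qed
  finally show ?thesis .
qed

section \<open>Parametrisation by arc length\<close>

text \<open>A recursive form of the partition sums in \<open>path_length\<close>, suited to
  induction when partitions are joined or cut.\<close>

fun chain_length :: "(real \<Rightarrow> 'a::metric_space) \<Rightarrow> real list \<Rightarrow> real" where
  "chain_length \<gamma> (s # t # ts) = dist (\<gamma> s) (\<gamma> t) + chain_length \<gamma> (t # ts)"
| "chain_length \<gamma> _ = 0"

lemma chain_length_nonneg: "0 \<le> chain_length \<gamma> ts"
  by (induction \<gamma> ts rule: chain_length.induct) auto

lemma chain_length_eq_sum: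
  "(\<Sum>i<length ts - 1. ennreal (dist (\<gamma> (ts ! i)) (\<gamma> (ts ! Suc i)))) = ennreal (chain_length \<gamma> ts)"
proof (induction \<gamma> ts rule: chain_length.induct)
  case (1 \<gamma> s t ts)
  have "(\<Sum>i<length (s # t # ts) - 1. ennreal (dist (\<gamma> ((s # t # ts) ! i)) (\<gamma> ((s # t # ts) ! Suc i))))
     = ennreal (dist (\<gamma> s) (\<gamma> t)) + ennreal (chain_length \<gamma> (t # ts))"
    using 1 by (simp del: sum.lessThan_Suc add: sum.lessThan_Suc_shift)
  then show ?case by (simp add: ennreal_plus chain_length_nonneg)
qed auto

lemma path_length_eq:
  "path_length \<gamma> a b = (SUP ts \<in> {ts. sorted ts \<and> set ts \<subseteq> {a..b}}. ennreal (chain_length \<gamma> ts))"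
  unfolding path_length_def chain_length_eq_sum ..

lemma chain_length_le_path_length:
  "sorted ts \<Longrightarrow> set ts \<subseteq> {a..b} \<Longrightarrow> ennreal (chain_length \<gamma> ts) \<le> path_length \<gamma> a b"
  unfolding path_length_eq by (rule SUP_upper) auto

lemma chain_length_append:
  "ts \<noteq> [] \<Longrightarrow> us \<noteq> [] \<Longrightarrow>
    chain_length \<gamma> (ts @ us) = chain_length \<gamma> ts + dist (\<gamma> (last ts)) (\<gamma> (hd us)) + chain_length \<gamma> us"
proof (induction \<gamma> ts rule: chain_length.induct)
  case ("2_2" \<gamma> v) then show ?case by (cases us) auto
qed auto

lemma chain_length_append_ge:
  "chain_length \<gamma> ts + chain_length \<gamma> us \<le> chain_length \<gamma> (ts @ us)"
  by (cases "ts = [] \<or> us = []") (auto simp: chain_length_append)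

text \<open>The triangle inequality across the gap containing \<open>t\<close> shows that a
  refinement at \<open>t\<close> cannot shorten the chain. If one side is empty, the extra chain is
  merely nonnegative, hence the case distinction.\<close>

lemma chain_length_insert:
  assumes "sorted ts"
  shows "chain_length \<gamma> ts \<le> chain_length \<gamma> (filter (\<lambda>x. x \<le> t) ts @ [t]) + chain_length \<gamma> (t # filter (\<lambda>x. t < x) ts)"
proof -
  let ?p = "filter (\<lambda>x. x \<le> t) ts" and ?q = "filter (\<lambda>x. t < x) ts"
  have ts: "ts = ?p @ ?q"
    using assms
  proof (induction ts)
    case (Cons a ts)
    show ?case
    proof (cases "a \<le> t")
      case False
      then have "filter (\<lambda>x. x \<le> t) ts = []" "filter (\<lambda>x. t < x) ts = ts"
        using Cons.prems by (auto simp: filter_empty_conv filter_id_conv)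
      then show ?thesis using False by auto
    qed (use Cons in auto)
  qed simp
  have q: "chain_length \<gamma> (t # ?q) = dist (\<gamma> t) (\<gamma> (hd ?q)) + chain_length \<gamma> ?q" if "?q \<noteq> []"
    using that chain_length_append[of "[t]" ?q \<gamma>] by simp
  have p: "chain_length \<gamma> (?p @ [t]) = chain_length \<gamma> ?p + dist (\<gamma> (last ?p)) (\<gamma> t)" if "?p \<noteq> []"
    using that chain_length_append[of ?p "[t]" \<gamma>] by simp
  note nn = chain_length_nonneg[of \<gamma> "t # ?q"] chain_length_nonneg[of \<gamma> "?p @ [t]"]
  show ?thesis
  proof (cases "?p = [] \<or> ?q = []")
    case False
    then have ne: "?p \<noteq> []" "?q \<noteq> []" by blast+
    have "chain_length \<gamma> ts = chain_length \<gamma> ?p + dist (\<gamma> (last ?p)) (\<gamma> (hd ?q)) + chain_length \<gamma> ?q"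
      by (subst ts, rule chain_length_append[OF ne])
    then show ?thesis
      using p[OF ne(1)] q[OF ne(2)] dist_triangle[of "\<gamma> (last ?p)" "\<gamma> (hd ?q)" "\<gamma> t"] by linarith
  next
    case True
    then consider "?p = []" "?q = []" | "?p = []" "?q \<noteq> []" | "?p \<noteq> []" "?q = []" by blast
    then show ?thesis
    proof cases
      case 1
      then have "ts = []" using ts by simp
      then show ?thesis by simp
    next
      case 2
      then have "ts = ?q" using ts by simp
      then have "chain_length \<gamma> ts = chain_length \<gamma> ?q" by (rule arg_cong)
      then show ?thesis using q[OF 2(2)] nn zero_le_dist[of "\<gamma> t" "\<gamma> (hd ?q)"] by linarith
    next
      case 3
      then have "ts = ?p" using ts by simp
      then have "chain_length \<gamma> ts = chain_length \<gamma> ?p" by (rule arg_cong)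
      then show ?thesis using p[OF 3(1)] nn zero_le_dist[of "\<gamma> (last ?p)" "\<gamma> t"] by linarith
    qed
  qed
qed

text \<open>Joining partitions of the two parts gives one inequality, cutting a partition of the
  whole at \<open>t\<close> gives the other.\<close>

lemma path_length_add:
  assumes "a \<le> t" "t \<le> b"
  shows "path_length \<gamma> a t + path_length \<gamma> t b = path_length \<gamma> a b"
proof (rule antisym)
  let ?S = "\<lambda>a b. {ts. sorted ts \<and> set ts \<subseteq> {a..b}} :: real list set"
  have ne: "?S a t \<noteq> {}" "?S t b \<noteq> {}" by (auto intro!: exI[of _ "[]"])
  have "ennreal (chain_length \<gamma> ts) + path_length \<gamma> t b \<le> path_length \<gamma> a b" if ts: "ts \<in> ?S a t" for ts
  proof -
    have "ennreal (chain_length \<gamma> us) + ennreal (chain_length \<gamma> ts) \<le> path_length \<gamma> a b" if us: "us \<in> ?S t b" for us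
    proof -
      have "sorted (ts @ us)" "set (ts @ us) \<subseteq> {a..b}"
        using ts us assms by (fastforce simp: sorted_append)+
      from chain_length_le_path_length[OF this, of \<gamma>]
      have "ennreal (chain_length \<gamma> (ts @ us)) \<le> path_length \<gamma> a b" .
      moreover have "ennreal (chain_length \<gamma> us + chain_length \<gamma> ts) \<le> ennreal (chain_length \<gamma> (ts @ us))"
        using chain_length_append_ge[of \<gamma> ts us] by (intro ennreal_leI) simp
      ultimately show ?thesis by (simp add: ennreal_plus chain_length_nonneg)
    qed
    then have "(SUP us\<in>?S t b. ennreal (chain_length \<gamma> us) + ennreal (chain_length \<gamma> ts)) \<le> path_length \<gamma> a b"
      by (rule SUP_least)
    then show ?thesis
      unfolding path_length_eq[of _ t b] by (subst add.commute, subst (asm) ennreal_SUP_add_left[OF ne(2)])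
  qed
  then have "(SUP ts\<in>?S a t. ennreal (chain_length \<gamma> ts) + path_length \<gamma> t b) \<le> path_length \<gamma> a b"
    by (rule SUP_least)
  then show "path_length \<gamma> a t + path_length \<gamma> t b \<le> path_length \<gamma> a b"
    unfolding path_length_eq[of _ a t] by (subst (asm) ennreal_SUP_add_left[OF ne(1)])
  show "path_length \<gamma> a b \<le> path_length \<gamma> a t + path_length \<gamma> t b"
    unfolding path_length_eq[of _ a b]
  proof (rule SUP_least)
    fix ts assume ts: "ts \<in> ?S a b"
    have "ennreal (chain_length \<gamma> ts) \<le> ennreal (chain_length \<gamma> (filter (\<lambda>x. x \<le> t) ts @ [t])) + ennreal (chain_length \<gamma> (t # filter (\<lambda>x. t < x) ts))"
      using chain_length_insert[of ts \<gamma> t] ts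
      by (simp add: ennreal_plus[symmetric] chain_length_nonneg ennreal_leI del: ennreal_plus)
    also have "\<dots> \<le> path_length \<gamma> a t + path_length \<gamma> t b"
      using ts assms by (intro add_mono chain_length_le_path_length) (auto simp: sorted_append sorted_wrt_filter)
    finally show "ennreal (chain_length \<gamma> ts) \<le> path_length \<gamma> a t + path_length \<gamma> t b" .
  qed
qed

lemma path_length_mono: "a' \<le> a \<Longrightarrow> b \<le> b' \<Longrightarrow> path_length \<gamma> a b \<le> path_length \<gamma> a' b'"
  unfolding path_length_eq by (intro SUP_subset_mono) (auto 0 4)

lemma dist_le_path_length: "s \<le> t \<Longrightarrow> ennreal (dist (\<gamma> s) (\<gamma> t)) \<le> path_length \<gamma> s t"
  using chain_length_le_path_length[of "[s, t]" s t \<gamma>] by simp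

lemma path_length_trivial: "path_length \<gamma> a a = 0"
proof -
  have "chain_length \<gamma> ts = 0" if "set ts \<subseteq> {a}" for ts
    using that by (induction \<gamma> ts rule: chain_length.induct) auto
  then have "path_length \<gamma> a a = (SUP ts \<in> {ts. sorted ts \<and> set ts \<subseteq> {a..a}}. 0)"
    unfolding path_length_eq by (intro SUP_cong) auto
  then show ?thesis by (metis SUP_bot bot_ennreal)
qed

text \<open>The partition points move with the parameter \<open>x\<close>. With a clipping map for
  \<open>h\<close>, this is the continuity behind the semicontinuity of length below.\<close>

lemma continuous_on_chain_length:
  fixes h :: "real \<Rightarrow> 'b::topological_space \<Rightarrow> real"
  assumes "continuous_on S \<gamma>" "\<And>t. t \<in> set ts \<Longrightarrow> continuous_on T (h t)" "\<And>t x. t \<in> set ts \<Longrightarrow> x \<in> T \<Longrightarrow> h t x \<in> S"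
  shows "continuous_on T (\<lambda>x. chain_length \<gamma> (map (\<lambda>t. h t x) ts))"
  using assms
proof (induction \<gamma> ts rule: chain_length.induct)
  case (1 \<gamma> s t ts)
  have "continuous_on T (\<lambda>x. \<gamma> (h u x))" if "u \<in> {s, t}" for u
    using 1 that by (intro continuous_on_compose2[OF "1.prems"(1)]) auto
  then show ?case using 1 by (auto intro!: continuous_on_add continuous_on_dist)
qed auto

section \<open>The length function of a rectifiable path and its arc length parametrisation\<close>

locale rectifiable =
  fixes \<gamma> :: "real \<Rightarrow> 'a::metric_space"
  assumes rect: "rectifiable_path \<gamma>"
begin

definition len :: "real \<Rightarrow> real" where "len t = enn2real (path_length \<gamma> 0 t)"

lemma cont: "continuous_on {0..1} \<gamma>"
  using rect by (simp add: rectifiable_path_def path_def)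

lemma path_length_finite: "0 \<le> s \<Longrightarrow> s \<le> t \<Longrightarrow> t \<le> 1 \<Longrightarrow> path_length \<gamma> s t < \<infinity>"
proof -
  assume "0 \<le> s" "s \<le> t" "t \<le> 1"
  then have "path_length \<gamma> s t \<le> path_length \<gamma> 0 1"
    by (intro path_length_mono) auto
  then show ?thesis using rect by (auto simp: rectifiable_path_def)
qed

lemma path_length_eq_len: "0 \<le> t \<Longrightarrow> t \<le> 1 \<Longrightarrow> path_length \<gamma> 0 t = ennreal (len t)"
  using path_length_finite[of 0 t] by (simp add: len_def)

lemma len_diff: "0 \<le> s \<Longrightarrow> s \<le> t \<Longrightarrow> t \<le> 1 \<Longrightarrow> path_length \<gamma> s t = ennreal (len t - len s)"
proof -
  assume *: "0 \<le> s" "s \<le> t" "t \<le> 1"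
  obtain r where r: "0 \<le> r" "path_length \<gamma> s t = ennreal r"
    using path_length_finite[OF *] by (cases "path_length \<gamma> s t" rule: ennreal_cases) auto
  have nn: "0 \<le> len s" "0 \<le> len t" by (simp_all add: len_def)
  have "ennreal (len s + r) = path_length \<gamma> 0 s + path_length \<gamma> s t"
    using path_length_eq_len[of s] * r nn by (simp add: ennreal_plus)
  also have "\<dots> = ennreal (len t)"
    using path_length_add[of 0 s t \<gamma>] path_length_eq_len[of t] * by simp
  finally have "len s + r = len t"
    using r nn by (subst (asm) ennreal_inj) auto
  then have "len t - len s = r" by simp
  then show ?thesis using r(2) by simp
qed

lemma len_0 [simp]: "len 0 = 0"
  by (simp add: len_def path_length_trivial)

lemma len_1_nonneg: "0 \<le> len 1"
  by (simp add: len_def)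

lemma len_mono: "0 \<le> s \<Longrightarrow> s \<le> t \<Longrightarrow> t \<le> 1 \<Longrightarrow> len s \<le> len t"
  unfolding len_def using path_length_mono[of 0 0 s t \<gamma>] path_length_finite[of 0 t]
  by (intro enn2real_mono) auto

lemma dist_le_len: "0 \<le> s \<Longrightarrow> s \<le> t \<Longrightarrow> t \<le> 1 \<Longrightarrow> dist (\<gamma> s) (\<gamma> t) \<le> len t - len s"
  using dist_le_path_length[of s t \<gamma>] len_diff[of s t] len_mono[of s t] by (simp add: ennreal_le_iff)

text \<open>Take a partition whose chain is already longer than \<open>c\<close> and clip its points
  to the moved interval; the clipped chain varies continuously with the end point and still bounds
  the length from below. The clipping map \<open>m\<close> is \<open>min\<close> for initial and
  \<open>max\<close> for final intervals.\<close>

lemma path_length_lower: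
  assumes x0: "x0 \<in> {0..1}" and c: "0 \<le> c"
  shows "ennreal c < path_length \<gamma> 0 x0 \<Longrightarrow> \<forall>\<^sub>F x in at x0 within {0..1}. ennreal c < path_length \<gamma> 0 x"
    and "ennreal c < path_length \<gamma> x0 1 \<Longrightarrow> \<forall>\<^sub>F x in at x0 within {0..1}. ennreal c < path_length \<gamma> x 1"
proof -
  have *: "\<forall>\<^sub>F x in at x0 within {0..1}. ennreal c < path_length \<gamma> (a x) (b x)"
    if gt: "ennreal c < path_length \<gamma> (a x0) (b x0)" and ab: "0 \<le> a x0" "b x0 \<le> 1"
      and m: "\<And>t. t \<in> {a x0..b x0} \<Longrightarrow> m t x0 = t" "\<And>t. continuous_on {0..1} (m t)"
      "\<And>t x. t \<in> {a x0..b x0} \<Longrightarrow> x \<in> {0..1} \<Longrightarrow> m t x \<in> {a x..b x} \<inter> {0..1}"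
      "\<And>t u x. t \<le> u \<Longrightarrow> m t x \<le> m u x"
    for a b and m :: "real \<Rightarrow> real \<Rightarrow> real"
  proof -
    obtain ts where ts: "sorted ts" "set ts \<subseteq> {a x0..b x0}" "ennreal c < ennreal (chain_length \<gamma> ts)"
      using gt unfolding path_length_eq by (auto simp: less_SUP_iff)
    let ?ts = "\<lambda>x. map (\<lambda>t. m t x) ts"
    have "continuous_on {0..1} (\<lambda>x. chain_length \<gamma> (?ts x))"
      using ts(2) m(2,3) by (intro continuous_on_chain_length[OF cont]) auto
    then have "((\<lambda>x. chain_length \<gamma> (?ts x)) \<longlongrightarrow> chain_length \<gamma> (?ts x0)) (at x0 within {0..1})"
      using x0 by (auto simp: continuous_on_def)
    moreover have "?ts x0 = ts" using ts(2) m(1) by (intro map_idI) blast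
    moreover have "c < chain_length \<gamma> ts" using ts(3) c by (simp add: ennreal_less_iff)
    ultimately have "\<forall>\<^sub>F x in at x0 within {0..1}. c < chain_length \<gamma> (?ts x)"
      by (metis order_tendstoD(1))
    moreover have "\<forall>\<^sub>F x in at x0 within {0..1}. x \<in> {0..1}"
      by (auto simp: eventually_at_topological)
    ultimately show ?thesis
    proof eventually_elim
      fix x assume x: "c < chain_length \<gamma> (?ts x)" "x \<in> {0..1}"
      have "sorted (?ts x)"
        using ts(1) m(4) by (simp add: sorted_wrt_map) (auto intro: sorted_wrt_mono_rel[of _ "(\<le>)"])
      moreover have "set (?ts x) \<subseteq> {a x..b x}" using ts(2) m(3) x(2) by auto
      ultimately have "ennreal (chain_length \<gamma> (?ts x)) \<le> path_length \<gamma> (a x) (b x)"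
        by (rule chain_length_le_path_length)
      moreover have "ennreal c < ennreal (chain_length \<gamma> (?ts x))"
        using x(1) c by (simp add: ennreal_less_iff)
      ultimately show "ennreal c < path_length \<gamma> (a x) (b x)" by (rule less_le_trans[rotated])
    qed
  qed
  show "ennreal c < path_length \<gamma> 0 x0 \<Longrightarrow> \<forall>\<^sub>F x in at x0 within {0..1}. ennreal c < path_length \<gamma> 0 x"
    using x0 by (intro *[of "\<lambda>_. 0" "\<lambda>x. x" min]) (auto intro!: continuous_intros)
  show "ennreal c < path_length \<gamma> x0 1 \<Longrightarrow> \<forall>\<^sub>F x in at x0 within {0..1}. ennreal c < path_length \<gamma> x 1"
    using x0 by (intro *[of "\<lambda>x. x" "\<lambda>_. 1" max]) (auto intro!: continuous_intros)
qed

text \<open>Both \<open>len x\<close> and the remaining length \<open>len 1 - len x\<close> are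
  lower semicontinuous by the previous lemma. Since their sum is constant, \<open>len\<close> is
  upper semicontinuous as well.\<close>

lemma continuous_on_len: "continuous_on {0..1} len"
  unfolding continuous_on_def
proof (intro ballI order_tendstoI)
  fix x0 c :: real assume x0: "x0 \<in> {0..1}"
  have in01: "\<forall>\<^sub>F x in at x0 within {0..1}. x \<in> {0..1}"
    by (auto simp: eventually_at_topological)
  have nn: "0 \<le> len x" for x by (simp add: len_def)
  {
    assume c: "c < len x0"
    show "\<forall>\<^sub>F x in at x0 within {0..1}. c < len x"
    proof (cases "c < 0")
      case False
      then have "ennreal c < path_length \<gamma> 0 x0"
        using c x0 by (simp add: path_length_eq_len ennreal_less_iff)
      moreover have "0 \<le> c" using False by simp
      ultimately have "\<forall>\<^sub>F x in at x0 within {0..1}. ennreal c < path_length \<gamma> 0 x"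
        by (intro path_length_lower(1)[OF x0])
      from eventually_conj[OF this in01] show ?thesis
        by eventually_elim (use False in \<open>auto simp: path_length_eq_len ennreal_less_iff\<close>)
    qed (use nn in \<open>auto intro!: always_eventually elim: less_le_trans\<close>)
  }
  {
    assume c: "len x0 < c"
    show "\<forall>\<^sub>F x in at x0 within {0..1}. len x < c"
    proof (cases "c > len 1")
      case True
      from in01 show ?thesis
        by eventually_elim (use True len_mono[of _ 1] in \<open>auto intro: le_less_trans\<close>)
    next
      case False
      then have "ennreal (len 1 - c) < path_length \<gamma> x0 1"
        using c x0 by (simp add: len_diff ennreal_less_iff)
      moreover have "0 \<le> len 1 - c" using False by simp
      ultimately have "\<forall>\<^sub>F x in at x0 within {0..1}. ennreal (len 1 - c) < path_length \<gamma> x 1"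
        by (intro path_length_lower(2)[OF x0])
      from eventually_conj[OF this in01] show ?thesis
        by eventually_elim (use False in \<open>auto simp: len_diff ennreal_less_iff\<close>)
    qed
  }
qed

definition arc :: "real \<Rightarrow> 'a" where "arc = arc_length_param \<gamma>"

text \<open>Continuity of \<open>len\<close> and the intermediate value theorem provide a parameter
  at which the length is \<open>s\<close>, so the choice in \<open>arc_length_param\<close> is a
  genuine one.\<close>

lemma arc_eq:
  assumes s: "s \<in> {0..len 1}"
  obtains t where "t \<in> {0..1}" "len t = s" "arc s = \<gamma> t"
proof -
  define t where "t = (SOME t. t \<in> {0..1} \<and> path_length \<gamma> 0 t = ennreal s)"
  obtain u where u: "0 \<le> u" "u \<le> 1" "len u = s"
    using IVT'[of len 0 s 1] continuous_on_len s by auto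
  then have "u \<in> {0..1} \<and> path_length \<gamma> 0 u = ennreal s"
    by (simp add: path_length_eq_len)
  then have t: "t \<in> {0..1}" "path_length \<gamma> 0 t = ennreal s"
    unfolding t_def by (metis (mono_tags, lifting) someI_ex)+
  have "len t = s" unfolding len_def t(2) using s by simp
  moreover have "arc s = \<gamma> t" by (simp add: arc_def arc_length_param_def t_def)
  ultimately show ?thesis using that t(1) by blast
qed

lemma arc_in_path_image: "s \<in> {0..len 1} \<Longrightarrow> arc s \<in> path_image \<gamma>"
  by (rule arc_eq[of s]) (auto simp: path_image_def)

lemma arc_lipschitz:
  assumes "s \<in> {0..len 1}" "s' \<in> {0..len 1}"
  shows "dist (arc s) (arc s') \<le> \<bar>s - s'\<bar>"
proof -
  obtain t t' where t: "t \<in> {0..1}" "len t = s" "arc s = \<gamma> t" "t' \<in> {0..1}" "len t' = s'" "arc s' = \<gamma> t'"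
    using arc_eq[OF assms(1)] arc_eq[OF assms(2)] by metis
  show ?thesis
    using t dist_le_len[of t t'] dist_le_len[of t' t]
    by (cases "t \<le> t'") (auto simp: dist_commute abs_if)
qed

text \<open>The chosen parameter need not be 0, but it ends a stretch of length zero, on which the
  path is constant.\<close>

lemma arc_start: "arc 0 = pathstart \<gamma>"
proof -
  obtain t where t: "t \<in> {0..1}" "len t = 0" "arc 0 = \<gamma> t"
    using arc_eq[of 0] len_1_nonneg by auto
  show ?thesis using t dist_le_len[of 0 t] by (auto simp: pathstart_def)
qed

lemma arc_finish: "arc (len 1) = pathfinish \<gamma>"
proof -
  obtain t where t: "t \<in> {0..1}" "len t = len 1" "arc (len 1) = \<gamma> t"
    using arc_eq[of "len 1"] len_1_nonneg by auto
  show ?thesis using t dist_le_len[of t 1] by (auto simp: pathfinish_def)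
qed

end

section \<open>Hausdorff null sets\<close>

text \<open>Each covering set lies in a ball about one of its points with radius its diameter, so
  covers by arbitrary sets become covers by balls at the cost of a constant factor.\<close>

lemma hausdorff_null_cover:
  fixes E :: "'a::metric_space set"
  assumes null: "hausdorff_measure s E = 0" and s: "1 \<le> s" and e: "0 < e"
  obtains z d where "\<And>i :: nat. 0 < d i \<and> d i \<le> 1" "E \<subseteq> (\<Union>i. cball (z i) (d i))"
    "(\<Sum>i. ennreal (d i ^ s)) \<le> ennreal e"
proof -
  define c where "c = unit_ball_vol (real s) / 2 ^ s"
  have c: "0 < c" by (simp add: c_def)
  have "hausdorff_content s (1/2) E \<le> hausdorff_measure s E"
    unfolding hausdorff_measure_def by (rule SUP_upper) simp
  \<comment> \<open>The scale 1/2 leaves room to enlarge diameters to radii below 1. The constant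
    \<open>c\<close> undoes the normalisation of the measure, and \<open>e / 2\<close> reserves half
    of the budget for that enlargement.\<close>
  then have "hausdorff_content s (1/2) E < ennreal (c * (e / 2))"
    using null c e by (simp add: ennreal_less_zero_iff less_le_trans[of 0])
  then obtain U :: "nat \<Rightarrow> 'a set" where U: "E \<subseteq> (\<Union>i. U i)" "\<And>i. bounded (U i)" "\<And>i. diameter (U i) \<le> 1/2"
    "(\<Sum>i. if U i = {} then 0 else ennreal (unit_ball_vol (real s) * (diameter (U i) / 2) ^ s)) < ennreal (c * (e / 2))"
    unfolding hausdorff_content_def by (auto simp: INF_less_iff)
    let ?T = "\<lambda>i. if U i = {} then 0 else ennreal (unit_ball_vol (real s) * (diameter (U i) / 2) ^ s)"
  define a where "a i = (if U i = {} then 0 else diameter (U i))" for i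
  have a: "0 \<le> a i" "a i < 1" for i
    using U(3)[of i] by (auto simp: a_def diameter_ge_0 U(2))
  \<comment> \<open>Diameters may be zero, while the radius later serves as a step length and must
    be positive. Right continuity of the power permits \<open>d > a i\<close>, at costs that add up
    to \<open>e / 2\<close>.\<close>
  have "\<exists>d>a i. d < 1 \<and> d ^ s < a i ^ s + e / 2 * (1/2) ^ Suc i" for i
  proof -
    have "((\<lambda>x. x ^ s) \<longlongrightarrow> a i ^ s) (at_right (a i))"
      by (intro tendsto_intros)
    then have "\<forall>\<^sub>F x in at_right (a i). x ^ s < a i ^ s + e / 2 * (1/2) ^ Suc i"
      by (rule order_tendstoD) (use e in simp)
    moreover have "\<forall>\<^sub>F x in at_right (a i). x \<in> {a i<..<1}"
      using a(2) by (rule eventually_at_right_real)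
    ultimately have "\<forall>\<^sub>F x in at_right (a i). x ^ s < a i ^ s + e / 2 * (1/2) ^ Suc i \<and> x \<in> {a i<..<1}"
      by (rule eventually_conj)
    then show ?thesis by (auto dest: eventually_happens'[rotated])
  qed
  then obtain d where d: "\<And>i. a i < d i" "\<And>i. d i < 1" "\<And>i. d i ^ s < a i ^ s + e / 2 * (1/2) ^ Suc i"
    by metis
  define z where "z i = (SOME x. x \<in> U i)" for i
  show thesis
  proof (rule that[of d z])
    show "0 < d i \<and> d i \<le> 1" for i using a(1)[of i] d(1,2)[of i] by simp
    show "E \<subseteq> (\<Union>i. cball (z i) (d i))"
    proof
      fix x assume "x \<in> E"
      then obtain i where i: "x \<in> U i" using U(1) by auto
      then have "z i \<in> U i" unfolding z_def by (rule someI)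
      then have "dist (z i) x \<le> a i"
        using diameter_bounded_bound[OF U(2)[of i] _ i] i by (auto simp: a_def)
      then show "x \<in> (\<Union>i. cball (z i) (d i))"
        using d(1)[of i] by (auto intro!: exI[of _ i])
    qed
    have "(\<Sum>i. ennreal (d i ^ s)) \<le> (\<Sum>i. ennreal (a i ^ s) + ennreal (e / 2 * (1/2) ^ Suc i))"
      using d(3) a(1) e by (intro suminf_le) (auto simp: ennreal_plus[symmetric] less_imp_le intro!: ennreal_leI simp del: ennreal_plus power_Suc)
    also have "\<dots> = (\<Sum>i. ennreal (a i ^ s)) + (\<Sum>i. ennreal (e / 2 * (1/2) ^ Suc i))"
      by (rule suminf_add[symmetric]) auto
    also have "(\<Sum>i. ennreal (e / 2 * (1/2) ^ Suc i)) = ennreal (e / 2)"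
      using sums_mult[OF power_half_series, of "e / 2"] e
      by (intro sums_unique[symmetric]) (simp add: sums_ennreal)
    \<comment> \<open>Here \<open>1 \<le> s\<close> gives \<open>0 ^ s = 0\<close>, so that empty
      sets contribute nothing on either side.\<close>
    also have "(\<Sum>i. ennreal (a i ^ s)) = (\<Sum>i. ennreal (1 / c) * ?T i)"
    proof (rule suminf_cong)
      fix i
      show "ennreal (a i ^ s) = ennreal (1 / c) * ?T i"
        using s c less_imp_neq[OF unit_ball_vol_pos[of "real s"]] by (auto simp: a_def ennreal_mult[symmetric] diameter_ge_0 U(2) c_def power_divide)
    qed
    also have "\<dots> = ennreal (1 / c) * (\<Sum>i. ?T i)"
      by (rule ennreal_suminf_cmult)
    also have "\<dots> \<le> ennreal (1 / c) * ennreal (c * (e / 2))"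
      using U(4) by (intro mult_left_mono) auto
    also have "\<dots> = ennreal (e / 2)"
      using c e by (simp add: ennreal_mult[symmetric])
    finally show "(\<Sum>i. ennreal (d i ^ s)) \<le> ennreal e"
      using e by (simp add: ennreal_plus[symmetric] add_right_mono del: ennreal_plus)
  qed
qed

lemma null_set_open_superset:
  fixes N :: "'a::euclidean_space set"
  assumes N: "N \<in> null_sets lebesgue" and "0 < e"
  shows "\<exists>U. open U \<and> N \<subseteq> U \<and> emeasure lebesgue U \<le> ennreal e"
proof -
  obtain U where U: "open U" "N \<subseteq> U" "emeasure lebesgue (U - N) < ennreal e"
    using sets_lebesgue_outer_open[OF null_setsD2[OF N] assms(2)] by metis
  moreover have "emeasure lebesgue (U - N) = emeasure lebesgue U"
    using U(1) N by (intro emeasure_Diff_null_set) auto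
  ultimately show ?thesis by auto
qed

text \<open>Vitali's covering lemma inside an open neighbourhood of small measure: disjoint balls
  there have small total volume, and enlarging them five times costs the factor
  \<open>5 ^ n\<close>. The index set \<open>I\<close> lets the family be finite or empty.\<close>

lemma null_set_ball_cover:
  fixes E :: "'a::euclidean_space set"
  assumes "E \<in> null_sets lebesgue" "0 < e" "0 < \<delta>"
  obtains I :: "nat set" and z d where "\<And>i. i \<in> I \<Longrightarrow> 0 < d i \<and> d i \<le> \<delta>"
    "E \<subseteq> (\<Union>i\<in>I. cball (z i) (d i))"
    "(\<Sum>i. if i \<in> I then ennreal (d i ^ DIM('a)) else 0) \<le> ennreal e"
proof -
  let ?n = "DIM('a)"
  define c where "c = unit_ball_vol (real ?n)"
  have c: "0 < c" by (simp add: c_def)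
  have "0 < c * e / 5 ^ ?n" using c assms by simp
  from null_set_open_superset[OF assms(1) this]
  obtain U where U: "open U" "E \<subseteq> U" and U_small: "emeasure lebesgue U \<le> ennreal (c * e / 5 ^ ?n)" by blast
  have "\<forall>x\<in>E. \<exists>r>0. r \<le> \<delta> / 5 \<and> cball x r \<subseteq> U"
  proof
    fix x assume "x \<in> E"
    then obtain r where "0 < r" "cball x r \<subseteq> U"
      using U open_contains_cball by (metis subsetD)
    then show "\<exists>r>0. r \<le> \<delta> / 5 \<and> cball x r \<subseteq> U"
      using assms by (intro exI[of _ "min r (\<delta> / 5)"]) (auto simp: subset_iff)
  qed
  from bchoice[OF this] obtain r where r: "\<And>x. x \<in> E \<Longrightarrow> 0 < r x \<and> r x \<le> \<delta> / 5" "\<And>x. x \<in> E \<Longrightarrow> cball x (r x) \<subseteq> U"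
    by blast
  have "E \<subseteq> (\<Union>x\<in>E. cball x (r x))" using r(1) by (fastforce simp: less_imp_le)
  from Vitali_covering_lemma_cballs[OF this r(1)]
  obtain C where C: "countable C" "C \<subseteq> E" "pairwise (\<lambda>i j. disjnt (cball i (r i)) (cball j (r j))) C"
    "E \<subseteq> (\<Union>i\<in>C. cball i (5 * r i))" by auto
  define I where "I = to_nat_on C ` C"
  define z where "z = from_nat_into C"
  have zC: "z i \<in> C" if "i \<in> I" for i
    using that C(1) by (auto simp: I_def z_def)
  have inj: "z i \<noteq> z j" if "i \<in> I" "j \<in> I" "i \<noteq> j" for i j
    using that C(1) by (auto simp: I_def z_def)
  define A where "A i = (if i \<in> I then cball (z i) (r (z i)) else {})" for i
  have "disjoint_family A"
    using C(3) zC inj unfolding disjoint_family_on_def A_def pairwise_def disjnt_def by auto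
  then have "(\<Sum>i. emeasure lborel (A i)) = emeasure lborel (\<Union>i. A i)"
    by (rule suminf_emeasure[rotated]) (simp add: A_def image_subset_iff)
  also have "\<dots> \<le> emeasure lborel U"
    using r(2) zC C(2) U(1) by (intro emeasure_mono) (auto simp: A_def split: if_splits)
  finally have sum_A: "(\<Sum>i. emeasure lborel (A i)) \<le> ennreal (c * e / 5 ^ ?n)"
    using U_small U(1) by simp
  show thesis
  proof (rule that[of I "\<lambda>i. 5 * r (z i)" z])
    show "0 < 5 * r (z i) \<and> 5 * r (z i) \<le> \<delta>" if "i \<in> I" for i
      using r(1)[of "z i"] zC[OF that] C(2) by auto
    show "E \<subseteq> (\<Union>i\<in>I. cball (z i) (5 * r (z i)))"
      using C(1,4) by (auto simp: I_def z_def)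
    have "(\<Sum>i. if i \<in> I then ennreal ((5 * r (z i)) ^ ?n) else 0) = (\<Sum>i. ennreal (5 ^ ?n / c) * emeasure lborel (A i))"
    proof (rule suminf_cong)
      fix i
      show "(if i \<in> I then ennreal ((5 * r (z i)) ^ ?n) else 0) = ennreal (5 ^ ?n / c) * emeasure lborel (A i)"
        using r(1)[of "z i"] zC[of i] C(2) c
        by (auto simp: A_def emeasure_cball less_imp_le subset_iff ennreal_mult[symmetric] c_def[symmetric] power_mult_distrib)
    qed
    also have "\<dots> = ennreal (5 ^ ?n / c) * (\<Sum>i. emeasure lborel (A i))"
      by (rule ennreal_suminf_cmult)
    also have "\<dots> \<le> ennreal (5 ^ ?n / c) * ennreal (c * e / 5 ^ ?n)"
      using sum_A by (intro mult_left_mono) auto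
    also have "\<dots> = ennreal e"
      using c assms by (simp add: ennreal_mult[symmetric])
    finally show "(\<Sum>i. if i \<in> I then ennreal ((5 * r (z i)) ^ ?n) else 0) \<le> ennreal e" .
  qed
qed

text \<open>A ball of radius \<open>d\<close> meets \<open>sphere y0 r\<close> only for
  \<open>r\<close> in an interval of length \<open>2 * d\<close>. Integrated over \<open>r\<close>,
  the sum of \<open>d ^ (n - 1)\<close> over the balls that are met is therefore at most twice the
  sum of \<open>d ^ n\<close>, which is as small as desired for a null set.\<close>

lemma AE_hausdorff_null_sphere_slice:
  fixes E :: "'a::euclidean_space set"
  assumes E: "E \<in> null_sets lebesgue"
  shows "AE r in lebesgue. hausdorff_measure (DIM('a) - 1) (E \<inter> sphere y0 r) = 0"
proof -
  let ?n = "DIM('a)"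
  let ?s = "?n - 1"
  define \<delta> where "\<delta> j = 1 / real (Suc j)" for j
  define P where "P j I z d \<longleftrightarrow> (\<forall>i\<in>I. 0 < d i \<and> d i \<le> \<delta> j) \<and> E \<subseteq> (\<Union>i\<in>I. cball (z i) (d i)) \<and>
    (\<Sum>i. if i \<in> I then ennreal (d i ^ ?n) else 0) \<le> ennreal ((1/2) ^ j)"
    for j :: nat and I :: "nat set" and z d
  have "\<exists>I z d. P j I z d" for j
  proof -
    have "0 < (1/2 :: real) ^ j" "0 < \<delta> j" by (simp_all add: \<delta>_def)
    then obtain I z d where "\<And>i. i \<in> I \<Longrightarrow> 0 < d i \<and> d i \<le> \<delta> j" "E \<subseteq> (\<Union>i\<in>I. cball (z i) (d i))"
      "(\<Sum>i. if i \<in> I then ennreal (d i ^ ?n) else 0) \<le> ennreal ((1/2) ^ j)"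
      by (rule null_set_ball_cover[OF E]) (rule that)
    then have "P j I z d" by (simp add: P_def)
    then show ?thesis by (intro exI)
  qed
  then obtain I where "\<forall>j. \<exists>z d. P j (I j) z d"
    using choice[of "\<lambda>j I. \<exists>z d. P j I z d"] by blast
  then obtain z where "\<forall>j. \<exists>d. P j (I j) (z j) d"
    using choice[of "\<lambda>j z. \<exists>d. P j (I j) z d"] by blast
  then obtain d where P: "\<And>j. P j (I j) (z j) (d j)"
    using choice[of "\<lambda>j d. P j (I j) (z j) d"] by blast
  have d: "\<And>j i. i \<in> I j \<Longrightarrow> 0 < d j i \<and> d j i \<le> \<delta> j" and
    cov: "\<And>j. E \<subseteq> (\<Union>i\<in>I j. cball (z j i) (d j i))" and
    sum: "\<And>j. (\<Sum>i. if i \<in> I j then ennreal (d j i ^ ?n) else 0) \<le> ennreal ((1/2) ^ j)"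
    using P unfolding P_def by blast+
  define hit where "hit j i = {dist (z j i) y0 - d j i .. dist (z j i) y0 + d j i}" for j i
  define \<phi> where "\<phi> j r = (\<Sum>i. if i \<in> I j then ennreal (d j i ^ ?s) * indicator (hit j i) r else 0)" for j and r :: real
  have [measurable]: "hit j i \<in> sets borel" for j i by (simp add: hit_def)
  have [measurable]: "\<phi> j \<in> borel_measurable borel" for j
    unfolding \<phi>_def by measurable
    let ?p = "\<lambda>j i r. if i \<in> I j then ennreal (d j i ^ ?s) * indicator (hit j i) r else 0"
  have int: "(\<integral>\<^sup>+ r. \<phi> j r \<partial>lborel) \<le> ennreal (2 * (1/2) ^ j)" for j
  proof -
    have "(\<integral>\<^sup>+ r. \<phi> j r \<partial>lborel) = (\<Sum>i. \<integral>\<^sup>+ r. ?p j i r \<partial>lborel)"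
      unfolding \<phi>_def by (rule nn_integral_suminf) measurable
    also have "\<dots> = (\<Sum>i. ennreal 2 * (if i \<in> I j then ennreal (d j i ^ ?n) else 0))"
    proof (rule suminf_cong)
      fix i
      show "(\<integral>\<^sup>+ r. ?p j i r \<partial>lborel)
          = ennreal 2 * (if i \<in> I j then ennreal (d j i ^ ?n) else 0)"
      proof (cases "i \<in> I j")
        case True
        then have "emeasure lborel (hit j i) = ennreal (2 * d j i)"
          using d[OF True] by (simp add: hit_def)
        moreover have "d j i ^ ?n = d j i ^ ?s * d j i"
          by (metis DIM_positive Suc_diff_1 power_Suc2)
        moreover have "(\<integral>\<^sup>+ r. ennreal (d j i ^ ?s) * indicator (hit j i) r \<partial>lborel) = ennreal (d j i ^ ?s) * emeasure lborel (hit j i)"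
          by (rule nn_integral_cmult_indicator) simp
        ultimately show ?thesis
          using True d[OF True] by (simp add: ennreal_mult'[symmetric] mult_ac flip: ennreal_numeral)
      qed simp
    qed
    also have "\<dots> = ennreal 2 * (\<Sum>i. if i \<in> I j then ennreal (d j i ^ ?n) else 0)"
      by (rule ennreal_suminf_cmult)
    also have "\<dots> \<le> ennreal 2 * ennreal ((1/2) ^ j)"
      using sum by (intro mult_left_mono) auto
    also have "\<dots> = ennreal (2 * (1/2) ^ j)" by (rule ennreal_mult[symmetric]) auto
    finally show ?thesis .
  qed
  have "(\<integral>\<^sup>+ r. (\<Sum>j. \<phi> j r) \<partial>lborel) = (\<Sum>j. \<integral>\<^sup>+ r. \<phi> j r \<partial>lborel)"
    by (rule nn_integral_suminf) measurable
  also have "\<dots> \<le> (\<Sum>j. ennreal (2 * (1/2) ^ j))"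
    using int by (intro suminf_le) auto
  also have "\<dots> = ennreal 4"
    using sums_mult[OF geometric_sums[of "1/2 :: real"], of 2]
    by (intro sums_unique[symmetric] sums_ennreal[THEN iffD2]) auto
  \<comment> \<open>Borel-Cantelli in integrated form: the bounds \<open>2 * (1/2) ^ j\<close> are
    summable, so for almost every \<open>r\<close> the series converges and its terms tend to
    0.\<close>
  finally have "(\<integral>\<^sup>+ r. (\<Sum>j. \<phi> j r) \<partial>lborel) \<noteq> \<infinity>" by (auto simp: top_unique)
  then have "AE r in lborel. (\<Sum>j. \<phi> j r) \<noteq> \<infinity>"
    by (intro nn_integral_PInf_AE) auto
  then have "AE r in lborel. hausdorff_measure ?s (E \<inter> sphere y0 r) = 0"
  proof eventually_elim
    fix r assume r: "(\<Sum>j. \<phi> j r) \<noteq> \<infinity>"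
    define \<omega> where "\<omega> = unit_ball_vol (real ?s)"
    have \<omega>: "0 \<le> \<omega>" unfolding \<omega>_def by (rule unit_ball_vol_nonneg) simp
    let ?E = "E \<inter> sphere y0 r"
    have content: "hausdorff_content ?s (2 * \<delta> j) ?E \<le> ennreal \<omega> * \<phi> j r" for j
    proof -
      \<comment> \<open>Balls that miss the sphere are replaced by the empty set, which costs
        nothing in the content.\<close>
      define U where "U i = (if i \<in> I j \<and> r \<in> hit j i then cball (z j i) (d j i) else {})" for i
      have dU: "diameter (U i) \<le> (if U i = {} then 0 else 2 * d j i)" for i
        using d[of i j] by (auto simp: U_def diameter_cball)
      have "?E \<subseteq> (\<Union>i. U i)"
      proof
        fix x assume x: "x \<in> ?E"
        then obtain i where i: "i \<in> I j" "x \<in> cball (z j i) (d j i)" using cov[of j] by auto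
        have "r \<in> hit j i"
          using x i dist_triangle[of "z j i" y0 x] dist_triangle3[of x y0 "z j i"]
          by (auto simp: hit_def dist_commute)
        then show "x \<in> (\<Union>i. U i)" using i by (auto simp: U_def)
      qed
      moreover have "bounded (U i) \<and> diameter (U i) \<le> 2 * \<delta> j" for i
      proof (cases "i \<in> I j")
        case True
        then show ?thesis using dU[of i] d[OF True] by (auto simp: U_def split: if_splits)
      qed (auto simp: U_def \<delta>_def)
      ultimately have "hausdorff_content ?s (2 * \<delta> j) ?E
          \<le> (\<Sum>i. if U i = {} then 0 else ennreal (\<omega> * (diameter (U i) / 2) ^ ?s))"
        unfolding hausdorff_content_def \<omega>_def by (intro INF_lower) auto
      also have "\<dots> \<le> (\<Sum>i. ennreal \<omega> * ?p j i r)"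
      proof (intro suminf_le)
        fix i
        show "(if U i = {} then 0 else ennreal (\<omega> * (diameter (U i) / 2) ^ ?s))
          \<le> ennreal \<omega> * ?p j i r"
        proof (cases "i \<in> I j \<and> r \<in> hit j i")
          case True
          then have "(diameter (U i) / 2) ^ ?s \<le> d j i ^ ?s"
            using dU[of i] d[of i j] diameter_ge_0[of "U i"] by (intro power_mono) (auto simp: U_def)
          then show ?thesis
            using True \<omega> d[of i j] by (auto simp: ennreal_mult[symmetric] intro!: ennreal_leI mult_left_mono)
        qed (auto simp: U_def)
      qed auto
      also have "\<dots> = ennreal \<omega> * \<phi> j r"
        unfolding \<phi>_def by (rule ennreal_suminf_cmult)
      finally show ?thesis .
    qed
    have "(\<lambda>j. \<phi> j r) \<longlonglongrightarrow> 0"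
    proof -
      have "\<phi> j r \<noteq> \<infinity>" for j
        using r ennreal_suminf_lessD[of "\<lambda>j. \<phi> j r" \<infinity> j] by (simp add: less_top)
      then have eq: "\<phi> j r = ennreal (enn2real (\<phi> j r))" for j by (simp add: less_top)
      have "(\<Sum>j. ennreal (enn2real (\<phi> j r))) \<noteq> top" using r by (simp flip: eq)
      then have "summable (\<lambda>j. enn2real (\<phi> j r))" by (intro summable_suminf_not_top) auto
      then have "(\<lambda>j. ennreal (enn2real (\<phi> j r))) \<longlonglongrightarrow> ennreal 0"
        by (intro tendsto_ennrealI summable_LIMSEQ_zero)
      then show ?thesis by (simp flip: eq)
    qed
    then have lim: "(\<lambda>j. ennreal \<omega> * \<phi> j r) \<longlonglongrightarrow> 0"
      using ennreal_tendsto_cmult[of "ennreal \<omega>" "\<lambda>j. \<phi> j r" 0] by simp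
    have "hausdorff_content ?s \<delta>' ?E = 0" if "0 < \<delta>'" for \<delta>'
    proof -
      have "(\<lambda>j. 2 * \<delta> j) \<longlonglongrightarrow> 2 * 0"
        unfolding \<delta>_def by (intro tendsto_intros LIMSEQ_Suc[OF lim_1_over_n])
      then have "\<forall>\<^sub>F j in sequentially. 2 * \<delta> j < \<delta>'"
        by (rule order_tendstoD) (use that in simp)
      then have "\<forall>\<^sub>F j in sequentially. hausdorff_content ?s \<delta>' ?E \<le> ennreal \<omega> * \<phi> j r"
      proof eventually_elim
        fix j assume "2 * \<delta> j < \<delta>'"
        then have "hausdorff_content ?s \<delta>' ?E \<le> hausdorff_content ?s (2 * \<delta> j) ?E"
          unfolding hausdorff_content_def by (intro INF_superset_mono) (auto intro: order_trans less_imp_le)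
        also note content
        finally show "hausdorff_content ?s \<delta>' ?E \<le> ennreal \<omega> * \<phi> j r" .
      qed
      from tendsto_lowerbound[OF lim this] show ?thesis by simp
    qed
    then show "hausdorff_measure ?s ?E = 0"
      unfolding hausdorff_measure_def by (auto intro!: SUP_eq_const exI[of _ "1::real"])
  qed
  then show ?thesis by (rule AE_completion)
qed

text \<open>Fix a covering ball of radius \<open>d\<close> and sample the path at multiples of
  \<open>d\<close>. A direction whose path enters the ball is, judged from a nearby sample, within
  \<open>3 * d / l0\<close> of a point that depends only on ball and sample. About
  \<open>L / d\<close> samples give directions of total measure of order \<open>d ^ (n - 1)\<close>,
  and a cover of \<open>F\<close> makes the sum small.\<close>

lemma negligible_hit_directions:
  fixes c :: "real \<Rightarrow> 'a::euclidean_space" and l :: "real \<Rightarrow> real"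
  assumes F: "hausdorff_measure (DIM('a) - 1) F = 0" and n: "2 \<le> DIM('a)"
    and c: "\<And>s s'. s \<in> {0..L} \<Longrightarrow> s' \<in> {0..L} \<Longrightarrow> dist (c s) (c s') \<le> \<bar>s - s'\<bar>"
    and l: "\<And>s s'. s \<in> {0..L} \<Longrightarrow> s' \<in> {0..L} \<Longrightarrow> \<bar>l s - l s'\<bar> \<le> \<bar>s - s'\<bar>"
    and l0: "0 < l0" "\<And>s. s \<in> {0..L} \<Longrightarrow> l0 \<le> l s"
    and L: "0 \<le> L"
  shows "negligible {w \<in> cball 0 1. \<exists>s\<in>{0..L}. c s + l s *\<^sub>R w \<in> F}"
proof -
  let ?n = "DIM('a)"
  let ?W = "{w \<in> cball 0 1. \<exists>s\<in>{0..L}. c s + l s *\<^sub>R w \<in> F}"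
  define \<omega> where "\<omega> = unit_ball_vol (real ?n)"
  \<comment> \<open>The number of samples times \<open>d\<close> is at most \<open>L + 1\<close>, as
    \<open>d \<le> 1\<close>; the other factors are the volume of a ball of radius
    \<open>3 * d / l0\<close> without its power of \<open>d\<close>.\<close>
  define C where "C = (L + 1) * \<omega> * (3 / l0) ^ ?n"
  have \<omega>: "0 < \<omega>" by (simp add: \<omega>_def)
  have C: "0 < C" using \<omega> L l0 by (simp add: C_def)
  have "\<exists>T. ?W \<subseteq> T \<and> T \<in> lmeasurable \<and> measure lebesgue T \<le> e" if e: "0 < e" for e
  proof -
    have "0 < e / C" using e C by simp
    then obtain z d where d: "\<And>i :: nat. 0 < d i \<and> d i \<le> 1" and cov: "F \<subseteq> (\<Union>i. cball (z i) (d i))"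
      and sum: "(\<Sum>i. ennreal (d i ^ (?n - 1))) \<le> ennreal (e / C)"
      using n by (elim hausdorff_null_cover[OF F, rotated]) auto
    define B where "B i j = cball ((z i - c (real j * d i)) /\<^sub>R l (real j * d i)) (3 * d i / l0)" for i and j :: nat
    define K where "K i = nat \<lfloor>L / d i\<rfloor>" for i
    define T where "T = (\<Union>i. \<Union>j\<le>K i. B i j)"
    have [measurable]: "B i j \<in> sets borel" for i j by (simp add: B_def)
    have T [measurable]: "T \<in> sets borel" unfolding T_def by measurable
    have "?W \<subseteq> T"
    proof
      fix w assume "w \<in> ?W"
      then obtain s where w: "norm w \<le> 1" and s: "s \<in> {0..L}" "c s + l s *\<^sub>R w \<in> F" by auto
      then obtain i where i: "c s + l s *\<^sub>R w \<in> cball (z i) (d i)" using cov by auto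
      \<comment> \<open>Rounding \<open>s\<close> down to a multiple of \<open>d i\<close> moves the
        parameter by at most \<open>d i\<close> and keeps it in \<open>{0..L}\<close>.\<close>
      define j where "j = nat \<lfloor>s / d i\<rfloor>"
      define t where "t = real j * d i"
      have dp: "0 < d i" using d by auto
      have j_eq: "real j = of_int \<lfloor>s / d i\<rfloor>" using s dp by (simp add: j_def)
      have "real j \<le> s / d i" "s / d i < real j + 1" unfolding j_eq by linarith+
      then have t: "t \<le> s" "s - t \<le> d i" using dp by (auto simp: t_def field_simps)
      have t_in: "t \<in> {0..L}" using t s dp by (auto simp: t_def)
      have "j \<le> K i" unfolding j_def K_def using s dp by (intro nat_mono floor_mono divide_right_mono) auto
      \<comment> \<open>Three errors of size \<open>d i\<close>: the radius of the ball, the motion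
        of \<open>c\<close>, and the change of \<open>l\<close>, the last because
        \<open>norm w \<le> 1\<close>.\<close>
      have "norm (l t *\<^sub>R w - (z i - c t)) \<le> norm (c s + l s *\<^sub>R w - z i) + norm (c t - c s) + norm ((l t - l s) *\<^sub>R w)"
      proof -
        have "l t *\<^sub>R w - (z i - c t) = (c s + l s *\<^sub>R w - z i) + (c t - c s) + (l t - l s) *\<^sub>R w"
          by (simp add: algebra_simps)
        then show ?thesis by (metis norm_triangle_le add_right_mono norm_triangle_ineq)
      qed
      also have "norm (c s + l s *\<^sub>R w - z i) \<le> d i" using i by (simp add: dist_norm norm_minus_commute)
      also have "norm (c t - c s) \<le> d i" using c[OF t_in s(1)] t by (simp add: dist_norm)
      also have "norm ((l t - l s) *\<^sub>R w) \<le> d i"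
      proof -
        have "\<bar>l t - l s\<bar> * norm w \<le> d i * 1"
          using l[OF t_in s(1)] t w by (intro mult_mono) auto
        then show ?thesis by simp
      qed
      finally have le: "norm (l t *\<^sub>R w - (z i - c t)) \<le> 3 * d i" by simp
      have lt: "l0 \<le> l t" "0 < l t" using l0 t_in by (auto intro: less_le_trans)
      have "w - (z i - c t) /\<^sub>R l t = (l t *\<^sub>R w - (z i - c t)) /\<^sub>R l t"
        using lt by (simp add: algebra_simps)
      then have "norm (w - (z i - c t) /\<^sub>R l t) = norm (l t *\<^sub>R w - (z i - c t)) / l t"
        using lt by (simp only:) (simp add: divide_inverse mult.commute)
      also have "\<dots> \<le> 3 * d i / l0"
        using le lt l0 dp by (intro frac_le) auto
      finally have "w \<in> B i j"
        by (simp add: B_def t_def[symmetric] dist_norm norm_minus_commute)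
      then show "w \<in> T" using \<open>j \<le> K i\<close> by (auto simp: T_def)
    qed
    have "emeasure lborel T \<le> (\<Sum>i. emeasure lborel (\<Union>j\<le>K i. B i j))"
      unfolding T_def by (rule emeasure_subadditive_countably) auto
    also have "\<dots> \<le> (\<Sum>i. ennreal C * ennreal (d i ^ (?n - 1)))"
    proof (intro suminf_le)
      fix i
      have dp: "0 < d i" "d i \<le> 1" using d by auto
      have "emeasure lborel (\<Union>j\<le>K i. B i j) \<le> (\<Sum>j\<le>K i. emeasure lborel (B i j))"
        by (rule emeasure_subadditive_finite) auto
      also have "\<dots> = (\<Sum>j\<le>K i. ennreal (\<omega> * (3 * d i / l0) ^ ?n))"
        using dp l0 by (simp add: B_def emeasure_cball \<omega>_def)
      also have "\<dots> = ennreal (real (Suc (K i)) * (\<omega> * (3 * d i / l0) ^ ?n))"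
        using \<omega> dp l0 by (subst sum_ennreal) auto
      also have "\<dots> \<le> ennreal (C * d i ^ (?n - 1))"
      proof (rule ennreal_leI)
        have "real (K i) \<le> L / d i"
          using L dp by (simp add: K_def)
        then have "real (Suc (K i)) * d i \<le> L + 1"
          using dp by (simp add: field_simps)
        then have "(real (Suc (K i)) * d i) * (\<omega> * (3 / l0) ^ ?n * d i ^ (?n - 1)) \<le> (L + 1) * (\<omega> * (3 / l0) ^ ?n * d i ^ (?n - 1))"
          using \<omega> dp l0 by (intro mult_right_mono) auto
        moreover have "(3 * d i / l0) ^ ?n = (3 / l0) ^ ?n * (d i * d i ^ (?n - 1))"
          by (metis DIM_positive Suc_diff_1 power_Suc power_mult_distrib times_divide_eq_left)
        ultimately show "real (Suc (K i)) * (\<omega> * (3 * d i / l0) ^ ?n) \<le> C * d i ^ (?n - 1)"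
          by (simp add: C_def mult_ac)
      qed
      also have "\<dots> = ennreal C * ennreal (d i ^ (?n - 1))"
        using C dp by (intro ennreal_mult) auto
      finally show "emeasure lborel (\<Union>j\<le>K i. B i j) \<le> ennreal C * ennreal (d i ^ (?n - 1))" .
    qed auto
    also have "\<dots> = ennreal C * (\<Sum>i. ennreal (d i ^ (?n - 1)))"
      by (rule ennreal_suminf_cmult)
    also have "\<dots> \<le> ennreal C * ennreal (e / C)"
      using sum by (intro mult_left_mono) auto
    also have "\<dots> = ennreal e"
      using C e by (simp add: ennreal_mult[symmetric])
    finally have em: "emeasure lebesgue T \<le> ennreal e" by simp
    then have "emeasure lebesgue T < \<infinity>" using le_less_trans[OF em ennreal_less_top] by simp
    then have "T \<in> lmeasurable" by (intro fmeasurableI) auto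
    moreover have "measure lebesgue T \<le> e"
      unfolding measure_def using em e by (intro enn2real_leI) auto
    ultimately have "T \<in> lmeasurable" "measure lebesgue T \<le> e" by blast+
    then show ?thesis using \<open>?W \<subseteq> T\<close> by blast
  qed
  then show ?thesis by (auto simp: negligible_outer_le)
qed

section \<open>Null images and the one-dimensional area inequality\<close>

lemma null_sets_if_outer_measure_zero:
  fixes A :: "'a::euclidean_space set"
  assumes "outer_measure_of lborel A = 0"
  shows "A \<in> null_sets lebesgue"
proof -
  obtain B where "B \<in> sets lborel" "A \<subseteq> B" "outer_measure_of lborel A = emeasure lborel B"
    using outer_measure_of_attain[of A lborel] by auto
  then have "B \<in> null_sets lborel" using assms by auto
  then show ?thesis using \<open>A \<subseteq> B\<close> null_sets_completionI null_sets_completion_subset by blast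
qed

text \<open>A capacitability argument: an image of a \<open>G\<^sub>\<delta>\<close> set need not be Borel, but its outer measure is
  approximated from within by images of compact sets.\<close>

lemma null_image_gdelta:
  fixes \<Phi> :: "'a::euclidean_space \<Rightarrow> 'b::euclidean_space"
  assumes X: "compact X" and cont: "continuous_on X \<Phi>" and V: "\<And>j :: nat. open (V j)"
    and null: "\<And>C. compact C \<Longrightarrow> C \<subseteq> X \<inter> (\<Inter>j. V j) \<Longrightarrow> emeasure lborel (\<Phi> ` C) = 0"
  shows "\<Phi> ` (X \<inter> (\<Inter>j. V j)) \<in> null_sets lebesgue"
proof (rule null_sets_if_outer_measure_zero, rule ccontr)
  define m where "m A = outer_measure_of lborel (\<Phi> ` A)" for A
  let ?E = "X \<inter> (\<Inter>j. V j)"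
  assume "outer_measure_of lborel (\<Phi> ` ?E) \<noteq> 0"
  then have "0 < m ?E" by (simp add: m_def zero_less_iff_neq_zero)
  then obtain c where c: "0 < c" "c < m ?E" using dense by blast
  \<comment> \<open>Each open \<open>V j\<close> is exhausted by an increasing sequence of compact
    sets, so that continuity of outer measure from below applies.\<close>
  define Q where "Q j K \<longleftrightarrow> (\<forall>i. compact (K i)) \<and> (\<forall>i. K i \<subseteq> V j) \<and> incseq K \<and> (\<Union>i. K i) = V j"
    for j and K :: "nat \<Rightarrow> 'a set"
  have "\<forall>j. \<exists>K. Q j K"
  proof
    fix j
    obtain K :: "nat \<Rightarrow> 'a set" where K: "\<And>i. compact (K i)" "\<And>i. K i \<subseteq> V j"
      "\<And>i. K i \<subseteq> interior (K (Suc i))" "\<Union>(range K) = V j"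
      by (rule open_Union_compact_subsets[OF V[of j]]) (rule that)
    have "incseq K"
      using K(3) by (intro incseq_SucI) (meson interior_subset subset_trans)
    then have "Q j K" using K by (simp add: Q_def)
    then show "\<exists>K. Q j K" by blast
  qed
  from choice[OF this] obtain K where "\<And>j. Q j (K j)" by blast
  then have K: "\<And>j i. compact (K j i)" "\<And>j i. K j i \<subseteq> V j" "\<And>j. incseq (K j)" "\<And>j. (\<Union>i. K j i) = V j"
    by (simp_all add: Q_def)
  \<comment> \<open>Replacing \<open>V j\<close> by a large enough compact part of it keeps the
    outer measure of the image above \<open>c\<close>; this is done for one \<open>j\<close> after
    another.\<close>
  define pick where "pick j S = (SOME i. c < m (S \<inter> K j i))" for j S
  define S where "S = rec_nat ?E (\<lambda>j S. S \<inter> K j (pick j S))"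
  have S_0: "S 0 = ?E" and S_Suc: "S (Suc j) = S j \<inter> K j (pick j (S j))" for j
    by (simp_all add: S_def)
  have S_sub: "S j \<subseteq> ?E" for j
    by (induction j) (auto simp: S_0 S_Suc)
  have S_gt: "c < m (S j)" for j
  proof (induction j)
    case (Suc j)
    have "S j = (\<Union>i. S j \<inter> K j i)" using S_sub[of j] K(4)[of j] by blast
    then have "\<Phi> ` S j = (\<Union>i. \<Phi> ` (S j \<inter> K j i))" by blast
    moreover have "incseq (\<lambda>i. \<Phi> ` (S j \<inter> K j i))"
      using K(3)[of j] by (auto simp: incseq_def)
    ultimately have "m (S j) = (SUP i. m (S j \<inter> K j i))"
      unfolding m_def by (subst SUP_outer_measure_of_incseq) auto
    then obtain i where "c < m (S j \<inter> K j i)" using Suc by (auto simp: less_SUP_iff)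
    then show ?case unfolding S_Suc pick_def by (rule someI)
  qed (simp add: S_0 c)
  \<comment> \<open>The sets \<open>S j\<close> are not compact, but the constraints collected so
    far are. So \<open>C k\<close> is compact, contains \<open>S k\<close>, and the intersection of
    all \<open>C k\<close> lies in every \<open>V j\<close>.\<close>
  define C where "C k = X \<inter> (\<Inter>j<k. K j (pick j (S j)))" for k :: nat
  have compact_C: "compact (C k)" for k
  proof -
    have "closed (\<Inter>j<k. K j (pick j (S j)))" using K(1) by (intro closed_INT) (auto intro: compact_imp_closed)
    then show ?thesis unfolding C_def using X by (rule compact_Int_closed[rotated])
  qed
  have C_dec: "decseq C" unfolding decseq_def C_def by auto
  have SC: "S k \<subseteq> C k" for k
  proof (induction k)
    case (Suc k)
    have "C (Suc k) = C k \<inter> K k (pick k (S k))" by (auto simp: C_def lessThan_Suc)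
    then show ?case using Suc by (auto simp: S_Suc)
  qed (use S_sub[of 0] in \<open>simp add: C_def\<close>)
  have contC: "continuous_on (C k) \<Phi>" for k
    using cont by (rule continuous_on_subset) (auto simp: C_def)
  have compact_img: "compact (\<Phi> ` C k)" for k
    using compact_continuous_image contC compact_C by blast
  have C_ge: "c \<le> emeasure lborel (\<Phi> ` C k)" for k
  proof -
    have "m (S k) \<le> m (C k)" unfolding m_def using SC by (intro outer_measure_of_mono) auto
    also have "m (C k) = emeasure lborel (\<Phi> ` C k)"
      unfolding m_def using compact_img[of k] by (intro outer_measure_of_eq) (auto intro: borel_compact)
    finally show ?thesis using S_gt[of k] by simp
  qed
  \<comment> \<open>For a decreasing sequence of compact sets image and intersection commute: the
    fibres over a common image point are nonempty nested compact sets.\<close>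
  have img: "(\<Inter>k. \<Phi> ` C k) = \<Phi> ` (\<Inter>k. C k)"
  proof
    show "(\<Inter>k. \<Phi> ` C k) \<subseteq> \<Phi> ` (\<Inter>k. C k)"
    proof
      fix y assume y: "y \<in> (\<Inter>k. \<Phi> ` C k)"
      define F where "F k = C k \<inter> \<Phi> -` {y}" for k
      have "compact (F k)" for k
      proof -
        have "closed (C k \<inter> \<Phi> -` {y})"
          using contC compact_imp_closed[OF compact_C] by (intro continuous_closed_preimage) auto
        then have "compact (C k \<inter> (C k \<inter> \<Phi> -` {y}))" using compact_C by (intro compact_Int_closed)
        then show ?thesis unfolding F_def by (simp add: Int_absorb1 flip: Int_assoc)
      qed
      moreover have "F k \<noteq> {}" for k using y by (auto simp: F_def)
      moreover have "F n \<subseteq> F k" if "k \<le> n" for k n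
        using decseqD[OF C_dec that] by (auto simp: F_def)
      ultimately have "\<Inter>(range F) \<noteq> {}" by (rule compact_nest)
      then show "y \<in> \<Phi> ` (\<Inter>k. C k)" by (auto simp: F_def)
    qed
  qed auto
  have "(\<lambda>k. emeasure lborel (\<Phi> ` C k)) \<longlonglongrightarrow> emeasure lborel (\<Inter>k. \<Phi> ` C k)"
  proof (rule Lim_emeasure_decseq)
    show "range (\<lambda>k. \<Phi> ` C k) \<subseteq> sets lborel" using compact_img by (auto intro: borel_compact)
    show "decseq (\<lambda>k. \<Phi> ` C k)" using C_dec unfolding decseq_def by blast
    show "emeasure lborel (\<Phi> ` C k) \<noteq> \<infinity>" for k
      using emeasure_compact_finite[OF compact_img[of k]] by auto
  qed
  then have "c \<le> emeasure lborel (\<Phi> ` (\<Inter>k. C k))"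
    unfolding img by (rule LIMSEQ_le_const) (use C_ge in auto)
  moreover have "emeasure lborel (\<Phi> ` (\<Inter>k. C k)) = 0"
  proof (rule null)
    have "closed (\<Inter>k. C k)" using compact_C by (intro closed_INT) (auto intro: compact_imp_closed)
    then have "compact (C 0 \<inter> (\<Inter>k. C k))" using compact_C by (intro compact_Int_closed)
    then show "compact (\<Inter>k. C k)" by (simp add: Int_absorb1 INT_lower)
    show "(\<Inter>k. C k) \<subseteq> ?E" using K(2) by (force simp: C_def)
  qed
  ultimately show False using c(1) by simp
qed

section \<open>Outer measure of images of subsets of the line\<close>

lemma outer_measure_of_UN_le:
  assumes "\<And>i :: nat. A i \<subseteq> space M"
  shows "outer_measure_of M (\<Union>i. A i) \<le> (\<Sum>i. outer_measure_of M (A i))"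
proof -
  have "\<forall>i. \<exists>B\<in>sets M. A i \<subseteq> B \<and> outer_measure_of M (A i) = emeasure M B"
    using outer_measure_of_attain[OF assms] by blast
  then obtain B where B: "\<And>i. B i \<in> sets M" "\<And>i. A i \<subseteq> B i" "\<And>i. outer_measure_of M (A i) = emeasure M (B i)"
    using choice[of "\<lambda>i B. B \<in> sets M \<and> A i \<subseteq> B \<and> outer_measure_of M (A i) = emeasure M B"] by blast
  have "outer_measure_of M (\<Union>i. A i) \<le> outer_measure_of M (\<Union>i. B i)"
    using B by (intro outer_measure_of_mono) auto
  also have "\<dots> = emeasure M (\<Union>i. B i)" using B by (intro outer_measure_of_eq) auto
  also have "\<dots> \<le> (\<Sum>i. emeasure M (B i))" using B by (intro emeasure_subadditive_countably) auto
  finally show ?thesis by (simp add: B)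
qed

text \<open>Cover \<open>A\<close> by nonoverlapping intervals inside an open set barely larger than
  \<open>A\<close> in outer measure. Each is short enough for the Lipschitz bound, so the image of
  its part of \<open>A\<close> fits in an interval \<open>K\<close> times as long.\<close>

lemma outer_measure_lipschitz_image:
  fixes h :: "real \<Rightarrow> real"
  assumes A: "A \<subseteq> {0..L}" and K: "0 \<le> K" and d: "0 < d"
    and lip: "\<And>s t. s \<in> A \<Longrightarrow> t \<in> A \<Longrightarrow> \<bar>s - t\<bar> < d \<Longrightarrow> \<bar>h s - h t\<bar> \<le> K * \<bar>s - t\<bar>"
  shows "outer_measure_of lborel (h ` A) \<le> ennreal K * outer_measure_of lborel A"
proof (cases "A = {}")
  case False
  then have L: "0 \<le> L" using A by auto
  have fin: "outer_measure_of lborel A \<noteq> \<infinity>"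
    using outer_measure_of_mono[OF A, of lborel] L by (auto simp: top_unique)
  obtain B where B: "B \<in> sets lborel" "A \<subseteq> B" "outer_measure_of lborel A = emeasure lborel B"
    using outer_measure_of_attain[of A lborel] by auto
  show ?thesis
  proof (rule ennreal_le_epsilon)
    fix e :: real assume "0 < e"
    \<comment> \<open>The \<open>+ 1\<close> keeps the quotient meaningful for \<open>K = 0\<close>
      and still gives \<open>K * e' \<le> e\<close>.\<close>
    define e' where "e' = e / (K + 1)"
    have e': "0 < e'" using \<open>0 < e\<close> K by (simp add: e'_def)
    obtain U where U: "open U" "B \<subseteq> U" "emeasure lebesgue (U - B) < ennreal e'"
      using sets_lebesgue_outer_open[of B, OF _ e'] B(1) by (metis sets_completionI_sets)
    have "emeasure lborel U \<le> emeasure lborel (B \<union> (U - B))"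
      using U B(1) by (intro emeasure_mono) auto
    also have "\<dots> \<le> emeasure lborel B + emeasure lborel (U - B)"
      using U B(1) by (intro emeasure_subadditive) auto
    also have "\<dots> \<le> outer_measure_of lborel A + ennreal e'"
      using U B by (intro add_mono) (auto simp: less_imp_le)
    finally have mU: "emeasure lborel U \<le> outer_measure_of lborel A + ennreal e'" .
    \<comment> \<open>Radii of at most \<open>d / 2\<close> put two points of one ball at distance
      less than \<open>d\<close>, where the Lipschitz bound holds. Points outside \<open>A\<close>
      receive a default radius so that a gauge results.\<close>
    have "\<forall>x. \<exists>r>0. r \<le> d / 2 \<and> (x \<in> A \<longrightarrow> ball x r \<subseteq> U)"
    proof
      fix x
      show "\<exists>r>0. r \<le> d / 2 \<and> (x \<in> A \<longrightarrow> ball x r \<subseteq> U)"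
      proof (cases "x \<in> A")
        case True
        then obtain r where "0 < r" "ball x r \<subseteq> U" using U B(2) by (meson openE subsetD)
        then show ?thesis using d by (intro exI[of _ "min r (d / 2)"]) (auto simp: subset_iff)
      qed (use d in \<open>auto intro!: exI[of _ "d / 2"]\<close>)
    qed
    from choice[OF this] obtain r where r: "\<And>x. 0 < r x" "\<And>x. r x \<le> d / 2" "\<And>x. x \<in> A \<Longrightarrow> ball x (r x) \<subseteq> U"
      by blast
    have g: "gauge (\<lambda>x. ball x (r x))" using r(1) by (auto simp: gauge_def)
    have sub: "A \<subseteq> cbox (-1) (L + 1)" using A by auto
    have ne: "box (-1) (L + 1) \<noteq> {}" using L by auto
    obtain \<D> where \<D>': "countable \<D>" "\<Union>\<D> \<subseteq> cbox (-1) (L + 1)"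
      "\<And>J. J \<in> \<D> \<Longrightarrow> interior J \<noteq> {} \<and> (\<exists>c d. J = cbox c d)"
      "pairwise (\<lambda>A B. interior A \<inter> interior B = {}) \<D>"
      "\<And>J. J \<in> \<D> \<Longrightarrow> \<exists>x \<in> A \<inter> J. J \<subseteq> ball x (r x)"
      "\<And>u v. cbox u v \<in> \<D> \<Longrightarrow> \<exists>n. \<forall>i \<in> Basis. v \<bullet> i - u \<bullet> i = ((L + 1) \<bullet> i - (-1) \<bullet> i) / 2^n"
      "A \<subseteq> \<Union>\<D>"
      by (rule covering_lemma[OF sub ne g]) (rule that)
    note \<D> = \<D>'(1,3,4,5,7)
    define I where "I = to_nat_on \<D> ` \<D>"
    define J where "J i = (if i \<in> I then from_nat_into \<D> i else {})" for i
    have J_in: "J i \<in> \<D>" if "i \<in> I" for i using that \<D>(1) by (auto simp: I_def J_def)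
    have J_ne: "J i \<noteq> J j" if "i \<in> I" "j \<in> I" "i \<noteq> j" for i j
      using that \<D>(1) by (auto simp: I_def J_def)
    have A_J: "A \<subseteq> (\<Union>i. J i)"
    proof
      fix x assume "x \<in> A"
      then obtain B where B: "B \<in> \<D>" "x \<in> B" using \<D>(5) by blast
      then have "J (to_nat_on \<D> B) = B" using \<D>(1) by (simp add: I_def J_def)
      then show "x \<in> (\<Union>i. J i)" using B(2) by blast
    qed
    \<comment> \<open>The image of \<open>A \<inter> J i\<close> need not be measurable; it is
      enclosed in the interval that starts at its infimum and has the length allowed by the
      Lipschitz bound.\<close>
    define R where "R i = (if i \<in> I then {Inf (h ` (A \<inter> J i)) .. Inf (h ` (A \<inter> J i)) + K * measure lborel (J i)} else {})" for i
    have R: "h ` (A \<inter> J i) \<subseteq> R i \<and> emeasure lborel (R i) \<le> ennreal K * emeasure lborel (interior (J i))"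
      and intJ: "interior (J i) \<subseteq> U" for i
    proof -
      have "(h ` (A \<inter> J i) \<subseteq> R i \<and> emeasure lborel (R i) \<le> ennreal K * emeasure lborel (interior (J i))) \<and> interior (J i) \<subseteq> U"
      proof (cases "i \<in> I")
        case True
        from \<D>(2)[OF J_in[OF True]] obtain p q where pq: "J i = {p..q}" "interior (J i) \<noteq> {}" by auto
        then have "p < q" by auto
        obtain x where x: "x \<in> A" "x \<in> J i" "J i \<subseteq> ball x (r x)" using \<D>(4)[OF J_in[OF True]] by blast
        have mJ: "measure lborel (J i) = q - p" "emeasure lborel (interior (J i)) = ennreal (q - p)"
          using \<open>p < q\<close> by (simp_all add: pq(1))
        have diam: "\<bar>h s - h t\<bar> \<le> K * (q - p)" if "s \<in> A \<inter> J i" "t \<in> A \<inter> J i" for s t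
        proof -
          have "\<bar>s - t\<bar> < d"
          proof -
            have "s \<in> ball x (r x)" "t \<in> ball x (r x)" using that x(3) by blast+
            then have "\<bar>x - s\<bar> < r x" "\<bar>x - t\<bar> < r x" by (simp_all add: dist_real_def)
            then show ?thesis using r(2)[of x] by linarith
          qed
          then have "\<bar>h s - h t\<bar> \<le> K * \<bar>s - t\<bar>" using that lip by auto
          also have "\<dots> \<le> K * (q - p)" using that K by (intro mult_left_mono) (auto simp: pq(1))
          finally show ?thesis .
        qed
        have bdd: "bdd_below (h ` (A \<inter> J i))"
          using diam[of x] x by (intro bdd_belowI[of _ "h x - K * (q - p)"]) fastforce
        have "h s \<in> R i" if s: "s \<in> A \<inter> J i" for s
        proof -
          have "Inf (h ` (A \<inter> J i)) \<le> h s" using s bdd by (intro cInf_lower) auto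
          moreover have "h s - K * (q - p) \<le> Inf (h ` (A \<inter> J i))"
          proof (rule cInf_greatest)
            fix y assume "y \<in> h ` (A \<inter> J i)"
            then obtain t where "t \<in> A \<inter> J i" "y = h t" by blast
            then show "h s - K * (q - p) \<le> y" using diam[OF s, of t] by (simp add: abs_le_iff)
          qed (use s in auto)
          ultimately show ?thesis using True by (simp add: R_def mJ)
        qed
        moreover have "emeasure lborel (R i) = ennreal K * ennreal (q - p)"
          using True K \<open>p < q\<close> by (simp add: R_def mJ ennreal_mult)
        moreover have "interior (J i) \<subseteq> U" using x r(3)[of x] interior_subset by blast
        ultimately show ?thesis by (auto simp: mJ(2))
      qed (auto simp: R_def J_def)
      then show "h ` (A \<inter> J i) \<subseteq> R i \<and> emeasure lborel (R i) \<le> ennreal K * emeasure lborel (interior (J i))"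
        "interior (J i) \<subseteq> U" by auto
    qed
    have R_sets: "R i \<in> sets borel" for i by (simp add: R_def)
    have "h ` A \<subseteq> (\<Union>i. R i)" using A_J R by blast
    then have "outer_measure_of lborel (h ` A) \<le> outer_measure_of lborel (\<Union>i. R i)" by (rule outer_measure_of_mono)
    also have "\<dots> = emeasure lborel (\<Union>i. R i)" using R_sets by (intro outer_measure_of_eq) auto
    also have "\<dots> \<le> (\<Sum>i. emeasure lborel (R i))" using R_sets by (intro emeasure_subadditive_countably) auto
    also have "\<dots> \<le> (\<Sum>i. ennreal K * emeasure lborel (interior (J i)))"
      using R by (intro suminf_le) auto
    also have "\<dots> = ennreal K * (\<Sum>i. emeasure lborel (interior (J i)))" by (rule ennreal_suminf_cmult)
    \<comment> \<open>The intervals may share end points, but their interiors are disjoint and have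
      the same length; therefore the bounds were stated with interiors.\<close>
    also have "(\<Sum>i. emeasure lborel (interior (J i))) = emeasure lborel (\<Union>i. interior (J i))"
    proof (rule suminf_emeasure)
      show "disjoint_family (\<lambda>i. interior (J i))"
        unfolding disjoint_family_on_def
      proof (intro ballI impI)
        fix i j :: nat assume ij: "i \<noteq> j"
        show "interior (J i) \<inter> interior (J j) = {}"
        proof (cases "i \<in> I \<and> j \<in> I")
          case True
          then have "J i \<in> \<D>" "J j \<in> \<D>" "J i \<noteq> J j" using J_in J_ne[OF _ _ ij] by simp_all
          then show ?thesis using \<D>(3) by (simp add: pairwise_def)
        qed (auto simp: J_def)
      qed
    qed auto
    also have "\<dots> \<le> emeasure lborel U" using intJ U(1) by (intro emeasure_mono) auto
    also have "\<dots> \<le> outer_measure_of lborel A + ennreal e'" by (rule mU)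
    finally have "outer_measure_of lborel (h ` A) \<le> ennreal K * (outer_measure_of lborel A + ennreal e')"
      by (simp add: mult_left_mono)
    also have "\<dots> = ennreal K * outer_measure_of lborel A + ennreal (K * e')"
      using K e' by (simp add: distrib_left ennreal_mult)
    also have "\<dots> \<le> ennreal K * outer_measure_of lborel A + ennreal e"
      using K \<open>0 < e\<close> by (intro add_left_mono ennreal_leI) (simp add: e'_def field_simps)
    finally show "outer_measure_of lborel (h ` A) \<le> ennreal K * outer_measure_of lborel A + ennreal e" .
  qed
qed simp

text \<open>The radius \<open>d\<close> depends on \<open>s\<close>; the points that admit
  \<open>1 / (j + 1)\<close> form an increasing sequence with union \<open>A\<close>. Outer measure
  is continuous along increasing sequences of arbitrary sets, so measurability of \<open>S j\<close>
  is never at issue.\<close>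

lemma outer_measure_local_lipschitz_image:
  fixes h :: "real \<Rightarrow> real"
  assumes A: "A \<subseteq> {0..L}" and K: "0 \<le> K"
    and lip: "\<And>s. s \<in> A \<Longrightarrow> \<exists>d>0. \<forall>t\<in>{0..L}. \<bar>t - s\<bar> < d \<longrightarrow> \<bar>h t - h s\<bar> \<le> K * \<bar>t - s\<bar>"
  shows "outer_measure_of lborel (h ` A) \<le> ennreal K * outer_measure_of lborel A"
proof -
  define S where "S j = {s \<in> A. \<forall>t\<in>{0..L}. \<bar>t - s\<bar> < 1 / real (Suc j) \<longrightarrow> \<bar>h t - h s\<bar> \<le> K * \<bar>t - s\<bar>}" for j
  have inc: "incseq S"
  proof (rule incseq_SucI)
    fix j
    have "1 / real (Suc (Suc j)) \<le> 1 / real (Suc j)" by (intro divide_left_mono) auto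
    then have "x < 1 / real (Suc j)" if "x < 1 / real (Suc (Suc j))" for x
      using that by (rule less_le_trans[rotated])
    then show "S j \<subseteq> S (Suc j)" unfolding S_def by blast
  qed
  have "A = (\<Union>j. S j)"
  proof
    show "A \<subseteq> (\<Union>j. S j)"
    proof
      fix s assume s: "s \<in> A"
      obtain d where d: "0 < d" "\<forall>t\<in>{0..L}. \<bar>t - s\<bar> < d \<longrightarrow> \<bar>h t - h s\<bar> \<le> K * \<bar>t - s\<bar>"
        using lip[OF s] by blast
      obtain j where "1 / real (Suc j) < d" using d(1) by (metis nat_approx_posE)
      then have "s \<in> S j" using s d(2) by (auto simp: S_def)
      then show "s \<in> (\<Union>j. S j)" by blast
    qed
  qed (auto simp: S_def)
  then have "outer_measure_of lborel (h ` A) = (SUP j. outer_measure_of lborel (h ` S j))"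
    using inc by (subst SUP_outer_measure_of_incseq) (auto simp: incseq_def image_UN intro: image_mono)
  also have "\<dots> \<le> ennreal K * outer_measure_of lborel A"
  proof (rule SUP_least)
    fix j
    have "outer_measure_of lborel (h ` S j) \<le> ennreal K * outer_measure_of lborel (S j)"
    proof (rule outer_measure_lipschitz_image)
      show "S j \<subseteq> {0..L}" using A by (auto simp: S_def)
      show "\<bar>h s - h t\<bar> \<le> K * \<bar>s - t\<bar>" if "s \<in> S j" "t \<in> S j" "\<bar>s - t\<bar> < 1 / real (Suc j)" for s t
        using that A by (auto simp: S_def)
    qed (use K in auto)
    also have "\<dots> \<le> ennreal K * outer_measure_of lborel A"
      by (intro mult_left_mono outer_measure_of_mono) (auto simp: S_def)
    finally show "outer_measure_of lborel (h ` S j) \<le> ennreal K * outer_measure_of lborel A" .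
  qed
  finally show ?thesis .
qed

text \<open>Cut \<open>A\<close> into strips on which \<open>M\<close> varies by at most
  \<open>e\<close>. On a strip the local Lipschitz constant is at most \<open>M + 2 * e\<close>, so
  it may be moved under the integral, and countable subadditivity joins the strips.\<close>

lemma outer_measure_image_le_integral:
  fixes h M :: "real \<Rightarrow> real"
  assumes A: "A \<subseteq> {0..L}" "A \<in> sets borel" and M [measurable]: "M \<in> borel_measurable borel" and M0: "\<And>s. 0 \<le> M s"
    and lip: "\<And>s e. s \<in> A \<Longrightarrow> 0 < e \<Longrightarrow>
      \<exists>d>0. \<forall>t\<in>{0..L}. \<bar>t - s\<bar> < d \<longrightarrow> \<bar>h t - h s\<bar> \<le> (M s + e) * \<bar>t - s\<bar>"
  shows "outer_measure_of lborel (h ` A) \<le> (\<integral>\<^sup>+ s. ennreal (M s) * indicator A s \<partial>lborel)"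
proof (rule ennreal_le_epsilon)
  fix e' :: real assume e': "0 < e'"
  \<comment> \<open>If \<open>A\<close> is empty, \<open>L\<close> may be negative. The choice of
    \<open>e\<close> makes the error \<open>2 * e\<close>, integrated over a set of length at most
    \<open>L'\<close>, no larger than \<open>e'\<close>.\<close>
  define L' where "L' = max L 0"
  define e where "e = e' / (2 * (L' + 1))"
  have e: "0 < e" using e' by (simp add: e_def L'_def)
  have [measurable]: "A \<in> sets borel" by fact
  let ?I = "\<integral>\<^sup>+ s. ennreal (M s) * indicator A s \<partial>lborel"
  define S where "S k = {s \<in> A. real k * e \<le> M s \<and> M s < (real k + 1) * e}" for k :: nat
  have [measurable]: "S k \<in> sets borel" for k unfolding S_def by measurable
  let ?m = "\<lambda>k s. (ennreal (M s) + ennreal (2 * e)) * indicator (S k) s"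
  have disj: "disjoint_family S"
  proof -
    have "i = j" if "x \<in> S i" "x \<in> S j" for x i j
    proof -
      have "real i * e < (real j + 1) * e" "real j * e < (real i + 1) * e"
        using that by (auto simp: S_def)
      then have "real i < real j + 1" "real j < real i + 1" using e by simp_all
      then show ?thesis by linarith
    qed
    then show ?thesis by (auto simp: disjoint_family_on_def)
  qed
  have A_eq: "A = (\<Union>k. S k)"
  proof
    show "A \<subseteq> (\<Union>k. S k)"
    proof
      fix s assume s: "s \<in> A"
      define k where "k = nat \<lfloor>M s / e\<rfloor>"
      have "real k = of_int \<lfloor>M s / e\<rfloor>" using M0[of s] e by (simp add: k_def)
      then have "real k \<le> M s / e" "M s / e < real k + 1" by linarith+
      then have "s \<in> S k" using s e by (simp add: S_def field_simps)
      then show "s \<in> (\<Union>k. S k)" by blast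
    qed
  qed (auto simp: S_def)
  have "outer_measure_of lborel (h ` A) \<le> (\<Sum>k. outer_measure_of lborel (h ` S k))"
    using outer_measure_of_UN_le[of "\<lambda>k. h ` S k" lborel] by (simp add: A_eq image_UN)
  also have "\<dots> \<le> (\<Sum>k. \<integral>\<^sup>+ s. ?m k s \<partial>lborel)"
  proof (intro suminf_le)
    fix k
    let ?K = "(real k + 1) * e + e"
    have K: "0 \<le> ?K" using e by simp
    have "outer_measure_of lborel (h ` S k) \<le> ennreal ?K * outer_measure_of lborel (S k)"
    proof (rule outer_measure_local_lipschitz_image[OF _ K])
      show "S k \<subseteq> {0..L}" using A by (auto simp: S_def)
      fix s assume s: "s \<in> S k"
      then obtain d where d: "0 < d" "\<forall>t\<in>{0..L}. \<bar>t - s\<bar> < d \<longrightarrow> \<bar>h t - h s\<bar> \<le> (M s + e) * \<bar>t - s\<bar>"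
        using lip[of s e] e by (auto simp: S_def)
      have "(M s + e) * x \<le> ?K * x" if "0 \<le> x" for x
        using that s by (intro mult_right_mono) (auto simp: S_def)
      then show "\<exists>d>0. \<forall>t\<in>{0..L}. \<bar>t - s\<bar> < d \<longrightarrow> \<bar>h t - h s\<bar> \<le> ?K * \<bar>t - s\<bar>"
        using d by (meson abs_ge_zero order_trans)
    qed
    also have "\<dots> = (\<integral>\<^sup>+ s. ennreal ?K * indicator (S k) s \<partial>lborel)"
      by (simp add: nn_integral_cmult_indicator)
    also have "\<dots> \<le> (\<integral>\<^sup>+ s. ?m k s \<partial>lborel)"
      using e M0 by (intro nn_integral_mono)
        (auto simp: S_def indicator_def ennreal_plus[symmetric] algebra_simps intro!: ennreal_leI simp del: ennreal_plus)
    finally show "outer_measure_of lborel (h ` S k) \<le> (\<integral>\<^sup>+ s. ?m k s \<partial>lborel)" .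
  qed auto
  also have "\<dots> = (\<integral>\<^sup>+ s. (\<Sum>k. ?m k s) \<partial>lborel)"
    by (rule nn_integral_suminf[symmetric]) measurable
  also have "\<dots> = (\<integral>\<^sup>+ s. ennreal (M s) * indicator A s + ennreal (2 * e) * indicator A s \<partial>lborel)"
  proof (rule nn_integral_cong)
    fix s
    have "(\<Sum>k. ?m k s)
        = (ennreal (M s) + ennreal (2 * e)) * indicator A s"
      by (subst ennreal_suminf_cmult, subst suminf_indicator[OF disj]) (simp add: A_eq[symmetric])
    then show "(\<Sum>k. ?m k s)
        = ennreal (M s) * indicator A s + ennreal (2 * e) * indicator A s"
      by (simp add: distrib_right)
  qed
  also have "\<dots> = ?I + ennreal (2 * e) * emeasure lborel A"
    by (subst nn_integral_add) (auto simp: nn_integral_cmult_indicator)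
  also have "\<dots> \<le> ?I + ennreal (2 * e) * ennreal L'"
  proof (intro add_left_mono mult_left_mono)
    have "A \<subseteq> {0..L'}" using A by (auto simp: L'_def)
    then have "emeasure lborel A \<le> emeasure lborel {0..L'}" by (intro emeasure_mono) auto
    then show "emeasure lborel A \<le> ennreal L'" by (simp add: L'_def)
  qed auto
  also have "\<dots> \<le> ?I + ennreal e'"
  proof (intro add_left_mono)
    have "2 * e * L' \<le> e'" using e' by (simp add: e_def L'_def field_simps)
    then show "ennreal (2 * e) * ennreal L' \<le> ennreal e'"
      using e by (simp add: ennreal_mult[symmetric] L'_def ennreal_leI)
  qed
  finally show "outer_measure_of lborel (h ` A) \<le> ?I + ennreal e'" .
qed

text \<open>The previous bound, applied to preimages of Borel sets, compares Lebesgue measure on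
  \<open>P\<close> with the pushforward under \<open>h\<close> of the density \<open>M\<close> on
  \<open>T\<close>; integrating \<open>\<eta>\<close> against both gives the weighted form. The set
  \<open>Z\<close> absorbs levels that \<open>h\<close> may reach only outside
  \<open>T\<close>.\<close>

lemma weighted_image_integral_le:
  fixes h M :: "real \<Rightarrow> real"
  assumes T: "T \<subseteq> {0..L}" "T \<in> sets borel"
    and M [measurable]: "M \<in> borel_measurable borel" and M0: "\<And>s. 0 \<le> M s"
    and h [measurable]: "h \<in> borel_measurable borel"
    and lip: "\<And>s e. s \<in> T \<Longrightarrow> 0 < e \<Longrightarrow>
      \<exists>d>0. \<forall>t\<in>{0..L}. \<bar>t - s\<bar> < d \<longrightarrow> \<bar>h t - h s\<bar> \<le> (M s + e) * \<bar>t - s\<bar>"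
    and Z: "Z \<in> null_sets lborel" and P [measurable]: "P \<in> sets borel" and cov: "P \<subseteq> Z \<union> h ` T"
    and \<eta> [measurable]: "\<eta> \<in> borel_measurable borel"
  shows "(\<integral>\<^sup>+ r. \<eta> r * indicator P r \<partial>lborel) \<le> (\<integral>\<^sup>+ s. \<eta> (h s) * ennreal (M s) * indicator T s \<partial>lborel)"
proof -
  have [measurable]: "T \<in> sets borel" by fact
  have [measurable]: "Z \<in> sets borel" using Z by auto
  define N1 where "N1 = density lborel (indicator P :: real \<Rightarrow> ennreal)"
  define N2 where "N2 = distr (density lborel (\<lambda>s. ennreal (M s) * indicator T s)) borel h"
  have "N1 \<le> N2"
  proof (subst le_measure)
    show "\<forall>B\<in>sets N1. emeasure N1 B \<le> emeasure N2 B"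
    proof
      fix B assume "B \<in> sets N1"
      then have B [measurable]: "B \<in> sets borel" by (simp add: N1_def)
      have "emeasure N1 B = emeasure lborel (P \<inter> B)"
        unfolding N1_def by (subst emeasure_density) (auto simp: indicator_inter_arith[symmetric])
      also have "\<dots> = emeasure lborel (P \<inter> B - Z)"
        using Z by (intro emeasure_Diff_null_set[symmetric]) auto
      also have "\<dots> = outer_measure_of lborel (P \<inter> B - Z)"
        by (intro outer_measure_of_eq[symmetric]) auto
      also have "\<dots> \<le> outer_measure_of lborel (h ` (T \<inter> h -` B))"
        using cov by (intro outer_measure_of_mono) blast
      also have "\<dots> \<le> (\<integral>\<^sup>+ s. ennreal (M s) * indicator (T \<inter> h -` B) s \<partial>lborel)"
      proof (rule outer_measure_image_le_integral[where L = L])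
        show "T \<inter> h -` B \<in> sets borel" using T(2) by (metis B h sets.Int measurable_sets_borel)
      qed (use T lip M0 in auto)
      also have "\<dots> = emeasure N2 B"
        unfolding N2_def by (subst emeasure_distr; simp?; subst emeasure_density)
          (use measurable_sets_borel[OF h B] in \<open>auto intro!: nn_integral_cong simp: indicator_def\<close>)
      finally show "emeasure N1 B \<le> emeasure N2 B" .
    qed
  qed (simp add: N1_def N2_def)
  then have "integral\<^sup>N N1 \<eta> \<le> integral\<^sup>N N2 \<eta>"
    by (intro nn_integral_mono_measure) (simp_all add: N1_def N2_def)
  also have "integral\<^sup>N N1 \<eta> = (\<integral>\<^sup>+ r. \<eta> r * indicator P r \<partial>lborel)"
    unfolding N1_def by (subst nn_integral_density) (auto simp: mult.commute)
  also have "integral\<^sup>N N2 \<eta> = (\<integral>\<^sup>+ s. \<eta> (h s) * ennreal (M s) * indicator T s \<partial>lborel)"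
    unfolding N2_def by (subst nn_integral_distr; simp?; subst nn_integral_density)
      (auto simp: mult_ac)
  finally show ?thesis .
qed

section \<open>Averaging over balls of variable radius\<close>

lemma ennreal_powr_ennreal: "0 \<le> x \<Longrightarrow> ennreal_powr (ennreal x) a = ennreal (x powr a)"
  by (simp add: ennreal_powr_def)

lemma ennreal_powr_0 [simp]: "ennreal_powr 0 a = 0"
  by (simp add: ennreal_powr_def)

lemma ennreal_powr_infinity [simp]: "ennreal_powr \<infinity> a = \<infinity>"
  by (simp add: ennreal_powr_def)

lemma ennreal_powr_measurable [measurable]:
  assumes [measurable]: "g \<in> borel_measurable M"
  shows "(\<lambda>x. ennreal_powr (g x) a) \<in> borel_measurable M"
  unfolding ennreal_powr_def by measurable

lemma ennreal_powr_mono: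
  assumes "x \<le> y" "0 < a"
  shows "ennreal_powr x a \<le> ennreal_powr y a"
proof (cases y)
  case (real s)
  then obtain r where r: "x = ennreal r" "0 \<le> r" "r \<le> s"
    using assms(1) by (cases x) (auto simp: top_unique)
  then show ?thesis
    using real assms(2) by (auto simp: ennreal_powr_ennreal intro!: ennreal_leI powr_mono2)
qed (use ennreal_powr_infinity[of a] in simp)

lemma ennreal_powr_mult:
  assumes "0 < a"
  shows "ennreal_powr (x * y) a = ennreal_powr x a * ennreal_powr y a"
proof (cases x; cases y)
  fix r s assume "0 \<le> r" "x = ennreal r" "0 \<le> s" "y = ennreal s"
  then show ?thesis
    by (simp add: ennreal_mult[symmetric] ennreal_powr_ennreal powr_mult)
next
  fix r assume "0 \<le> r" "x = ennreal r" "y = top"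
  then show ?thesis
    using ennreal_powr_infinity[of a]
    by (cases "r = 0") (auto simp: ennreal_powr_ennreal ennreal_mult_top)
next
  fix r assume "0 \<le> r" "y = ennreal r" "x = top"
  then show ?thesis
    using ennreal_powr_infinity[of a]
    by (cases "r = 0") (auto simp: ennreal_powr_ennreal ennreal_top_mult)
next
  assume "x = top" "y = top"
  then show ?thesis using ennreal_powr_infinity[of a] by (simp add: ennreal_mult_top)
qed

text \<open>The graph of \<open>x powr a\<close> lies above its tangent at \<open>m\<close>. Young's
  inequality with the conjugate exponent \<open>q\<close> is exactly this convexity
  statement.\<close>

lemma powr_tangent:
  fixes a m x :: real
  assumes a: "1 < a" and m: "0 < m" and x: "0 \<le> x"
  shows "a * m powr (a - 1) * x \<le> x powr a + (a - 1) * m powr a"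
proof -
  define q where "q = a / (a - 1)"
  have q: "1 < q" "1 / a + 1 / q = 1" using a by (auto simp: q_def field_simps)
  have "x * m powr (a - 1) \<le> x powr a / a + (m powr (a - 1)) powr q / q"
    using a q x by (intro Youngs_inequality) auto
  also have "(m powr (a - 1)) powr q = m powr a" using a by (simp add: powr_powr q_def)
  finally have "a * (x * m powr (a - 1)) \<le> a * (x powr a / a + m powr a / q)"
    using a by (intro mult_left_mono) auto
  also have "\<dots> = x powr a + (a - 1) * m powr a"
    using a by (simp add: q_def field_simps)
  finally show ?thesis by (simp add: mult_ac)
qed

lemma ennreal_powr_tangent:
  assumes a: "1 < a" and m: "0 < m"
  shows "ennreal (a * m powr (a - 1)) * x \<le> ennreal_powr x a + ennreal ((a - 1) * m powr a)"
proof (cases x)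
  case (real r)
  then show ?thesis
    using powr_tangent[OF a m, of r] a m
    by (simp add: ennreal_powr_ennreal ennreal_mult[symmetric] ennreal_plus[symmetric] ennreal_leI del: ennreal_plus)
qed (use ennreal_powr_infinity[of a] in simp)

text \<open>Integrating the tangent at the mean \<open>m\<close> gives
  \<open>a * m powr a \<le> R + (a - 1) * m powr a\<close>, which is Jensen's inequality. A zero
  mean is trivial, and for an infinite mean the tangent at 1 forces \<open>R\<close> to be
  infinite.\<close>

lemma weighted_average_powr_le:
  assumes a: "1 < a" and [measurable]: "k \<in> borel_measurable M" "g \<in> borel_measurable M"
    and k: "(\<integral>\<^sup>+ x. k x \<partial>M) = 1"
  shows "ennreal_powr (\<integral>\<^sup>+ x. k x * g x \<partial>M) a \<le> (\<integral>\<^sup>+ x. k x * ennreal_powr (g x) a \<partial>M)"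
proof -
  define I where "I = (\<integral>\<^sup>+ x. k x * g x \<partial>M)"
  define R where "R = (\<integral>\<^sup>+ x. k x * ennreal_powr (g x) a \<partial>M)"
  have tangent: "ennreal (a * m powr (a - 1)) * I \<le> R + ennreal ((a - 1) * m powr a)" if "0 < m" for m
  proof -
    have "ennreal (a * m powr (a - 1)) * I = (\<integral>\<^sup>+ x. k x * (ennreal (a * m powr (a - 1)) * g x) \<partial>M)"
      unfolding I_def by (subst nn_integral_cmult[symmetric]) (auto simp: mult_ac)
    also have "\<dots> \<le> (\<integral>\<^sup>+ x. k x * (ennreal_powr (g x) a + ennreal ((a - 1) * m powr a)) \<partial>M)"
      using ennreal_powr_tangent[OF a that] by (intro nn_integral_mono mult_left_mono) auto
    also have "\<dots> = R + (\<integral>\<^sup>+ x. ennreal ((a - 1) * m powr a) * k x \<partial>M)"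
      unfolding R_def distrib_left by (subst nn_integral_add) (auto simp: mult.commute)
    also have "(\<integral>\<^sup>+ x. ennreal ((a - 1) * m powr a) * k x \<partial>M) = ennreal ((a - 1) * m powr a)"
      by (simp add: nn_integral_cmult k)
    finally show ?thesis .
  qed
  have "ennreal_powr I a \<le> R"
  proof (cases I)
    case (real m)
    show ?thesis
    proof (cases "m = 0")
      case False
      then have m: "0 < m" using real by simp
      show ?thesis
      proof (cases R)
        case (real r)
        have "ennreal (a * m powr (a - 1) * m) \<le> ennreal (r + (a - 1) * m powr a)"
          using tangent[OF m] \<open>I = ennreal m\<close> real a m
          by (simp add: ennreal_mult[symmetric] ennreal_plus[symmetric] del: ennreal_plus)
        then have "a * m powr (a - 1) * m \<le> r + (a - 1) * m powr a"
          using real a m by (subst (asm) ennreal_le_iff) auto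
        moreover have "m powr (a - 1) * m = m powr a"
          using m powr_add[of m "a - 1" 1] by simp
        ultimately have "m powr a \<le> r" by (simp add: algebra_simps)
        then show ?thesis using \<open>I = ennreal m\<close> m real by (simp add: ennreal_powr_ennreal ennreal_leI)
      qed simp
    qed (use real in simp)
  next
    case top
    then have "R = top"
      using tangent[of 1] a by (auto simp: ennreal_mult_top top_unique ennreal_add_eq_top)
    then show ?thesis by simp
  qed
  then show ?thesis by (simp add: I_def R_def)
qed

section \<open>Ball averages whose radius depends on the centre\<close>

lemma continuous_on_nonexpansive:
  fixes f :: "'a::metric_space \<Rightarrow> 'b::metric_space"
  assumes "\<And>x y. dist (f x) (f y) \<le> dist x y"
  shows "continuous_on A f"
  unfolding continuous_on_iff
proof (intro ballI allI impI)
  fix x and e :: real assume "0 < e"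
  then show "\<exists>d>0. \<forall>y\<in>A. dist y x < d \<longrightarrow> dist (f y) (f x) < e"
    using assms by (intro exI[of _ e]) (auto intro: le_less_trans)
qed

definition ball_weight :: "'a::euclidean_space \<Rightarrow> ennreal" where
  "ball_weight w = ennreal (1 / unit_ball_vol (real DIM('a))) * indicator (cball 0 1) w"

lemma ball_weight_measurable [measurable]: "(ball_weight :: 'a::euclidean_space \<Rightarrow> ennreal) \<in> borel_measurable borel"
proof -
  have [measurable]: "cball (0 :: 'a) 1 \<in> sets borel" by simp
  show ?thesis unfolding ball_weight_def by measurable
qed

lemma nn_integral_ball_weight: "(\<integral>\<^sup>+ w. ball_weight (w :: 'a::euclidean_space) \<partial>lborel) = 1"
proof -
  have "unit_ball_vol (real DIM('a)) \<noteq> 0" using unit_ball_vol_pos[of "real DIM('a)"] by linarith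
  then show ?thesis
    unfolding ball_weight_def
    by (subst nn_integral_cmult_indicator) (auto simp: emeasure_cball ennreal_mult[symmetric])
qed

lemma nn_integral_ball_weight_shift:
  fixes F :: "'a::euclidean_space \<Rightarrow> ennreal"
  assumes [measurable]: "F \<in> borel_measurable borel" and l: "0 < l"
  shows "(\<integral>\<^sup>+ w. ball_weight w * F (x + l *\<^sub>R w) \<partial>lborel)
    = (\<integral>\<^sup>+ y. ennreal (1 / (unit_ball_vol (real DIM('a)) * l ^ DIM('a))) * indicator (cball x l) y * F y \<partial>lborel)"
proof -
  define c where "c = unit_ball_vol (real DIM('a))"
  have c: "0 < c" by (simp add: c_def)
  have [measurable]: "cball x l \<in> sets borel" by simp
  let ?H = "\<lambda>y. ennreal (1 / (c * l ^ DIM('a))) * indicator (cball x l) y * F y"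
  have "(\<integral>\<^sup>+ y. ?H y \<partial>lborel) = (\<integral>\<^sup>+ y. ?H y \<partial>density (distr lborel borel (\<lambda>w. x + l *\<^sub>R w)) (\<lambda>_. \<bar>l\<bar> ^ DIM('a)))"
    using lborel_affine[of l x] l by simp
  also have "\<dots> = (\<integral>\<^sup>+ y. ennreal (\<bar>l\<bar> ^ DIM('a)) * ?H y \<partial>distr lborel borel (\<lambda>w. x + l *\<^sub>R w))"
    by (rule nn_integral_density) auto
  also have "\<dots> = (\<integral>\<^sup>+ w. ennreal (\<bar>l\<bar> ^ DIM('a)) * ?H (x + l *\<^sub>R w) \<partial>lborel)"
    by (rule nn_integral_distr) auto
  also have "\<dots> = (\<integral>\<^sup>+ w. ball_weight w * F (x + l *\<^sub>R w) \<partial>lborel)"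
  proof (rule nn_integral_cong)
    fix w :: 'a
    have "indicator (cball x l) (x + l *\<^sub>R w) = (indicator (cball 0 1) w :: ennreal)"
      using l by (auto simp: indicator_def dist_norm)
    moreover have "ennreal (\<bar>l\<bar> ^ DIM('a)) * ennreal (1 / (c * l ^ DIM('a))) = ennreal (1 / c)"
      using l c by (simp add: ennreal_mult[symmetric])
    ultimately show "ennreal (\<bar>l\<bar> ^ DIM('a)) * ?H (x + l *\<^sub>R w) = ball_weight w * F (x + l *\<^sub>R w)"
      by (simp add: ball_weight_def c_def[symmetric] flip: mult.assoc)
  qed
  finally show ?thesis by (simp add: c_def)
qed

text \<open>By Tonelli it is enough to bound the kernel integrated over the centre \<open>x\<close>.
  From \<open>dist x y \<le> \<kappa> * R x\<close> and the Lipschitz bound,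
  \<open>(1 - \<kappa>) * R x \<le> R y \<le> (1 + \<kappa>) * R x\<close>. Hence \<open>x\<close>
  ranges over a ball of radius \<open>\<kappa> * R y / (1 - \<kappa>)\<close>, the density is at
  most \<open>(1 + \<kappa>) ^ n\<close> times that of the ball of radius
  \<open>\<kappa> * R y\<close>, and the product is the constant.\<close>

lemma nn_integral_smoothing_le:
  fixes F :: "'a::euclidean_space \<Rightarrow> ennreal" and R :: "'a \<Rightarrow> real"
  assumes F [measurable]: "F \<in> borel_measurable borel" and D [measurable]: "D \<in> sets borel"
    and R: "\<And>x y. \<bar>R x - R y\<bar> \<le> dist x y" and R0: "\<And>x. x \<in> D \<Longrightarrow> 0 < R x" and \<kappa>: "0 < \<kappa>" "\<kappa> < 1"
  shows "(\<integral>\<^sup>+ x. indicator D x * (\<integral>\<^sup>+ w. ball_weight w * F (x + (\<kappa> * R x) *\<^sub>R w) \<partial>lborel) \<partial>lborel)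
    \<le> ennreal (((1 + \<kappa>) / (1 - \<kappa>)) ^ DIM('a)) * (\<integral>\<^sup>+ y. F y \<partial>lborel)"
proof -
  let ?n = "DIM('a)"
  let ?P = "\<lambda>x. \<integral>\<^sup>+ w. ball_weight w * F (x + (\<kappa> * R x) *\<^sub>R w) \<partial>lborel"
  define c where "c = unit_ball_vol (real ?n)"
  have c: "0 < c" by (simp add: c_def)
  define C where "C = ((1 + \<kappa>) / (1 - \<kappa>)) ^ ?n"
  have "continuous_on UNIV R" using R by (intro continuous_on_nonexpansive) (simp add: dist_real_def)
  then have [measurable]: "R \<in> borel_measurable borel" by (rule borel_measurable_continuous_onI)
  define K where "K x y = (if x \<in> D \<and> dist x y \<le> \<kappa> * R x then ennreal (1 / (c * (\<kappa> * R x) ^ ?n)) else 0)" for x y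
  have [measurable]: "(\<lambda>(x, y). K x y) \<in> borel_measurable (borel \<Otimes>\<^sub>M borel)"
    unfolding K_def by measurable
  have [measurable]: "(\<lambda>x. K x y) \<in> borel_measurable borel" for y
    unfolding K_def by measurable
  have [measurable]: "(\<lambda>y. K x y) \<in> borel_measurable borel" for x
    unfolding K_def by measurable
  have "(\<integral>\<^sup>+ x. indicator D x * ?P x \<partial>lborel)
      = (\<integral>\<^sup>+ x. \<integral>\<^sup>+ y. K x y * F y \<partial>lborel \<partial>lborel)"
  proof (rule nn_integral_cong)
    fix x :: 'a
    show "indicator D x * ?P x = (\<integral>\<^sup>+ y. K x y * F y \<partial>lborel)"
    proof (cases "x \<in> D")
      case True
      then have "0 < \<kappa> * R x" using R0 \<kappa> by simp
      from nn_integral_ball_weight_shift[OF F this, of x] show ?thesis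
        using True by (simp add: K_def c_def[symmetric]) (auto intro!: nn_integral_cong simp: indicator_def)
    qed (simp add: K_def)
  qed
  also have "\<dots> = (\<integral>\<^sup>+ y. \<integral>\<^sup>+ x. K x y * F y \<partial>lborel \<partial>lborel)"
    by (rule lborel_pair.Fubini'[symmetric]) measurable
  also have "\<dots> = (\<integral>\<^sup>+ y. (\<integral>\<^sup>+ x. K x y \<partial>lborel) * F y \<partial>lborel)"
    by (intro nn_integral_cong nn_integral_multc) measurable
  also have "\<dots> \<le> (\<integral>\<^sup>+ y. ennreal C * F y \<partial>lborel)"
  proof (intro nn_integral_mono mult_right_mono)
    fix y :: 'a
    show "(\<integral>\<^sup>+ x. K x y \<partial>lborel) \<le> ennreal C"
    proof (cases "0 < R y")
      case True
      let ?r = "\<kappa> * R y / (1 - \<kappa>)" and ?A = "(1 + \<kappa>) ^ ?n / (c * (\<kappa> * R y) ^ ?n)"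
      have "K x y \<le> ennreal ?A * indicator (cball y ?r) x" for x
      proof (cases "x \<in> D \<and> dist x y \<le> \<kappa> * R x")
        case x: True
        have "0 < R x" using R0 x by simp
        have "\<bar>R x - R y\<bar> \<le> \<kappa> * R x" using R[of x y] x by simp
        then have le: "(1 - \<kappa>) * R x \<le> R y" "R y \<le> (1 + \<kappa>) * R x" by (auto simp: algebra_simps abs_le_iff)
        have "R x \<le> R y / (1 - \<kappa>)" using le(1) \<kappa> by (simp add: pos_le_divide_eq mult.commute)
        then have "\<kappa> * R x \<le> ?r" using \<kappa> by (simp add: mult_left_mono flip: times_divide_eq_right)
        then have mem: "x \<in> cball y ?r" using x by (simp add: dist_commute)
        have "(\<kappa> * R y) ^ ?n \<le> ((1 + \<kappa>) * (\<kappa> * R x)) ^ ?n"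
          using le(2) \<kappa> True by (intro power_mono) (auto simp: mult_left_mono mult.left_commute)
        then have pw: "(\<kappa> * R y) ^ ?n \<le> (1 + \<kappa>) ^ ?n * (\<kappa> * R x) ^ ?n" by (simp only: power_mult_distrib)
        have "1 / (c * p) \<le> a / (c * q)" if "q \<le> a * p" "0 < p" "0 < q" for p q a
          using that c by (simp add: field_simps)
        from this[OF pw] have "1 / (c * (\<kappa> * R x) ^ ?n) \<le> ?A"
          using \<kappa> True \<open>0 < R x\<close> by simp
        then show ?thesis using x mem by (simp add: K_def ennreal_leI)
      qed (auto simp: K_def)
      then have "(\<integral>\<^sup>+ x. K x y \<partial>lborel) \<le> (\<integral>\<^sup>+ x. ennreal ?A * indicator (cball y ?r) x \<partial>lborel)"
        by (intro nn_integral_mono)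
      also have "\<dots> = ennreal ?A * ennreal (c * ?r ^ ?n)"
        using True \<kappa> by (subst nn_integral_cmult_indicator) (auto simp: emeasure_cball c_def)
      also have "\<dots> = ennreal C"
        using True \<kappa> c by (simp add: ennreal_mult[symmetric] C_def power_divide)
      finally show ?thesis .
    next
      \<comment> \<open>A centre \<open>x\<close> in \<open>D\<close> that reaches \<open>y\<close>
        would force \<open>R y \<ge> (1 - \<kappa>) * R x > 0\<close>, so the kernel vanishes at
        such \<open>y\<close>.\<close>
      case False
      have "K x y = 0" for x
      proof (rule ccontr)
        assume "K x y \<noteq> 0"
        then have x: "x \<in> D" "dist x y \<le> \<kappa> * R x" by (auto simp: K_def split: if_splits)
        have "R x - R y \<le> \<kappa> * R x" using R[of x y] x by simp
        moreover have "\<kappa> * R x < R x" using R0[OF x(1)] \<kappa> by simp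
        ultimately show False using False by simp
      qed
      then show ?thesis by simp
    qed
  qed simp
  also have "\<dots> = ennreal C * (\<integral>\<^sup>+ y. F y \<partial>lborel)" by (rule nn_integral_cmult) simp
  finally show ?thesis by (simp add: C_def)
qed

text \<open>Take the supremum of radii of balls in \<open>D\<close> on which \<open>v\<close>
  oscillates by at most \<open>\<delta>\<close>. A ball inside a good ball is good, so moving the
  centre costs no more radius than the distance moved; this is the Lipschitz bound.\<close>

lemma oscillation_radius:
  fixes v :: "'a::euclidean_space \<Rightarrow> real"
  assumes D: "open D" and v: "continuous_on D v" and \<delta>: "0 < \<delta>"
  obtains R :: "'a \<Rightarrow> real" where "\<And>x. 0 \<le> R x" "\<And>x. x \<in> D \<Longrightarrow> 0 < R x" "\<And>x y. \<bar>R x - R y\<bar> \<le> dist x y"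
    "\<And>x y. dist x y < R x \<Longrightarrow> y \<in> D \<and> \<bar>v y - v x\<bar> \<le> \<delta>"
proof -
  \<comment> \<open>Oscillation is measured between arbitrary points of the ball, not from its
    centre, so that it passes to balls with other centres. The cap 1 keeps the supremum finite, and
    0 is always a member.\<close>
  define A where "A x = {s \<in> {0..1}. ball x s \<subseteq> D \<and> (\<forall>y\<in>ball x s. \<forall>z\<in>ball x s. \<bar>v y - v z\<bar> \<le> \<delta>)}" for x
  define R where "R x = Sup (A x)" for x
  have ne: "0 \<in> A x" for x by (simp add: A_def)
  have bdd: "bdd_above (A x)" for x by (intro bdd_aboveI[of _ 1]) (auto simp: A_def)
  have up: "s \<in> A x \<Longrightarrow> s \<le> R x" for s x unfolding R_def using bdd by (rule cSup_upper[rotated])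
  have R0: "0 \<le> R x" for x using up[OF ne] .
  have "R x \<le> R y + dist x y" for x y
    unfolding R_def[of x]
  proof (rule cSup_least)
    fix s assume s: "s \<in> A x"
    show "s \<le> R y + dist x y"
    proof (cases "s \<le> dist x y")
      case False
      have "z \<in> ball x s" if "z \<in> ball y (s - dist x y)" for z
        using that dist_triangle[of x z y] by simp
      then have "ball y (s - dist x y) \<subseteq> ball x s" by blast
      moreover have "s - dist x y \<in> {0..1}"
      proof -
        have "s \<le> 1" using s unfolding A_def by simp
        then show ?thesis using False zero_le_dist[of x y] unfolding atLeastAtMost_iff by linarith
      qed
      ultimately have "s - dist x y \<in> A y" using s unfolding A_def by blast
      then show ?thesis using up[of "s - dist x y" y] by simp
    qed (use R0[of y] in simp)
  qed (use ne in auto)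
  note le = this
  show thesis
  proof (rule that[of R])
    show "\<bar>R x - R y\<bar> \<le> dist x y" for x y
      using le[of x y] le[of y x] by (simp add: abs_le_iff dist_commute)
    show "0 < R x" if x: "x \<in> D" for x
    proof -
      obtain r where r: "0 < r" "ball x r \<subseteq> D" using D x by (meson openE)
      have "isCont v x" using v D x by (simp add: continuous_on_eq_continuous_at)
      then obtain d where d: "0 < d" "\<And>y. dist y x < d \<Longrightarrow> dist (v y) (v x) < \<delta> / 2"
        using \<delta> unfolding continuous_at_eps_delta by (metis half_gt_zero)
      define s where "s = min 1 (min r d)"
      have "\<bar>v y - v z\<bar> \<le> \<delta>" if "y \<in> ball x s" "z \<in> ball x s" for y z
      proof -
        have "dist y x < d" "dist z x < d" using that by (auto simp: s_def dist_commute)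
        from this[THEN d(2)] have "\<bar>v y - v x\<bar> < \<delta> / 2" "\<bar>v z - v x\<bar> < \<delta> / 2" by (simp_all add: dist_real_def)
        then show ?thesis by linarith
      qed
      then have "s \<in> A x" using r d(1) by (auto simp: A_def s_def subset_iff)
      then show ?thesis using up[of s x] r d(1) by (auto simp: s_def)
    qed
    show "y \<in> D \<and> \<bar>v y - v x\<bar> \<le> \<delta>" if xy: "dist x y < R x" for x y
    proof -
      have "A x \<noteq> {}" using ne by blast
      from less_cSup_iff[OF this bdd, of "dist x y"] obtain s where s: "s \<in> A x" "dist x y < s"
        using xy unfolding R_def by blast
      have "0 < s" using s(2) zero_le_dist[of x y] by linarith
      then have "x \<in> ball x s" "y \<in> ball x s" using s by auto
      then show ?thesis using s(1) unfolding A_def by blast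
    qed
  qed (rule R0)
qed

section \<open>Perturbed paths\<close>

text \<open>The path \<open>c\<close> is given on the whole line (constant outside
  \<open>{0..L}\<close> in the application), which keeps perturbed paths globally continuous. The
  interval loses \<open>\<delta>\<close> at each end because the end points are displaced too, and
  the factor \<open>1 + \<kappa>\<close> is the stretching of the path.\<close>

lemma AE_direction_integral_le:
  fixes v g R :: "'a::euclidean_space \<Rightarrow> real" and \<eta> :: "real \<Rightarrow> ennreal" and c :: "real \<Rightarrow> 'a"
    and V :: "nat \<Rightarrow> 'a set"
  assumes n: "2 \<le> DIM('a)" and D: "open D" and v: "continuous_on D v" and V: "\<And>j. open (V j)"
    and slices: "AE r in lborel. r1 < r \<and> r < r2 \<longrightarrow>
      hausdorff_measure (DIM('a) - 1) {x \<in> D. x \<in> (\<Inter>j. V j) \<and> v x = r} = 0"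
    and g [measurable]: "g \<in> borel_measurable borel" and g0: "\<And>x. 0 \<le> g x"
    and lip: "\<And>x e. x \<in> D \<Longrightarrow> x \<notin> (\<Inter>j. V j) \<Longrightarrow> 0 < e \<Longrightarrow>
      \<exists>d>0. \<forall>y\<in>D. dist y x < d \<longrightarrow> \<bar>v y - v x\<bar> \<le> (g x + e) * dist y x"
    and \<eta> [measurable]: "\<eta> \<in> borel_measurable borel"
    and R_pos: "\<And>x. x \<in> D \<Longrightarrow> 0 < R x" and R_lip: "\<And>x y. \<bar>R x - R y\<bar> \<le> dist x y"
    and R_osc: "\<And>x y. dist x y < R x \<Longrightarrow> y \<in> D \<and> \<bar>v y - v x\<bar> \<le> \<delta>"
    and \<kappa>: "0 < \<kappa>" "\<kappa> < 1" and \<delta>: "0 < \<delta>"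
    and c_D: "\<And>s. c s \<in> D" and c_lip: "\<And>s t. dist (c s) (c t) \<le> \<bar>s - t\<bar>"
    and L: "0 \<le> L" and ends: "v (c 0) \<le> r1" "r2 \<le> v (c L)"
  defines "G \<equiv> \<lambda>x. if x \<in> D \<and> x \<notin> (\<Inter>j. V j) \<and> r1 < v x \<and> v x < r2 then \<eta> (v x) * ennreal (g x) else 0"
  shows "AE w in lborel. w \<in> cball 0 1 \<longrightarrow>
    (\<integral>\<^sup>+ r. \<eta> r * indicator {r1 + \<delta><..<r2 - \<delta>} r \<partial>lborel)
      \<le> ennreal (1 + \<kappa>) * (\<integral>\<^sup>+ s. indicator {0..L} s * G (c s + (\<kappa> * R (c s)) *\<^sub>R w) \<partial>lborel)"
proof -
  let ?E = "\<Inter>j. V j"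
  let ?K = "\<lambda>w. \<integral>\<^sup>+ s. indicator {0..L} s * G (c s + (\<kappa> * R (c s)) *\<^sub>R w) \<partial>lborel"
  let ?H = "\<integral>\<^sup>+ r. \<eta> r * indicator {r1 + \<delta><..<r2 - \<delta>} r \<partial>lborel"
  define u where "u w s = c s + (\<kappa> * R (c s)) *\<^sub>R w" for w s
  have u_near: "u w s \<in> D \<and> \<bar>v (u w s) - v (c s)\<bar> \<le> \<delta>" if "w \<in> cball 0 1" for w s
  proof (rule R_osc)
    have "\<kappa> * R (c s) * norm w \<le> \<kappa> * R (c s) * 1"
      using that \<kappa> R_pos[OF c_D[of s]] by (intro mult_left_mono) auto
    also have "\<dots> < R (c s)" using \<kappa> R_pos[OF c_D[of s]] by simp
    finally show "dist (c s) (u w s) < R (c s)"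
      using \<kappa> R_pos[OF c_D[of s]] by (simp add: u_def dist_norm)
  qed
  have Rc_lip: "\<bar>\<kappa> * R (c s) - \<kappa> * R (c t)\<bar> \<le> \<kappa> * \<bar>s - t\<bar>" for s t
  proof -
    have "\<kappa> * \<bar>R (c s) - R (c t)\<bar> \<le> \<kappa> * \<bar>s - t\<bar>"
      using R_lip[of "c s" "c t"] c_lip[of s t] \<kappa> by (intro mult_left_mono) auto
    then show ?thesis using \<kappa> by (simp add: abs_mult flip: right_diff_distrib)
  qed
  \<comment> \<open>The summand 1 is the Lipschitz constant of \<open>c\<close>;
    \<open>\<kappa>\<close> bounds the rate at which the displacement changes, as \<open>R\<close>
    and \<open>c\<close> are 1-Lipschitz and \<open>w\<close> has norm at most 1.\<close>
  have u_lip: "dist (u w s) (u w t) \<le> (1 + \<kappa>) * \<bar>s - t\<bar>" if "w \<in> cball 0 1" for w s t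
  proof -
    have "u w s - u w t = (c s - c t) + (\<kappa> * R (c s) - \<kappa> * R (c t)) *\<^sub>R w"
      by (simp add: u_def algebra_simps)
    then have "dist (u w s) (u w t) \<le> norm (c s - c t) + \<bar>\<kappa> * R (c s) - \<kappa> * R (c t)\<bar> * norm w"
      using norm_triangle_ineq[of "c s - c t" "(\<kappa> * R (c s) - \<kappa> * R (c t)) *\<^sub>R w"] by (simp add: dist_norm)
    also have "\<dots> \<le> \<bar>s - t\<bar> + (\<kappa> * \<bar>s - t\<bar>) * 1"
      using c_lip[of s t] Rc_lip[of s t] that \<kappa> by (intro add_mono mult_mono) (auto simp: dist_norm)
    finally show ?thesis by (simp add: algebra_simps)
  qed
  have cont_c: "continuous_on A c" for A
    using c_lip by (intro continuous_on_nonexpansive) (simp add: dist_real_def)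
  have "continuous_on UNIV R" using R_lip by (intro continuous_on_nonexpansive) (simp add: dist_real_def)
  then have cont_Rc: "continuous_on A (\<lambda>s. R (c s))" for A
    using cont_c continuous_on_compose2 by blast
  define X where "X = cball (0 :: 'a) 1 \<times> {0..L}"
  have compact_X: "compact X" unfolding X_def by (intro compact_Times) auto
  have cont_u: "continuous_on X (\<lambda>z. u (fst z) (snd z))"
    unfolding u_def
    by (intro continuous_intros continuous_on_compose2[OF cont_c[of UNIV]] continuous_on_compose2[OF cont_Rc[of UNIV]]) auto
  have cont_vu: "continuous_on X (\<lambda>z. v (u (fst z) (snd z)))"
    using u_near by (intro continuous_on_compose2[OF v cont_u]) (auto simp: X_def)
    let ?uv = "\<lambda>z. (u (fst z) (snd z), v (u (fst z) (snd z)))"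
  \<comment> \<open>\<open>v\<close> is continuous only on \<open>D\<close>, and perturbed points
    are known to lie there only for directions in the unit ball. Hence openness is relative to
    \<open>X\<close>, and \<open>U j\<close> is an open set with the same trace.\<close>
  have "\<exists>U. open U \<and> X \<inter> ?uv -` (V j \<times> {r1<..<r2}) = X \<inter> U" for j
  proof -
    have "openin (top_of_set X) (X \<inter> ?uv -` (V j \<times> {r1<..<r2}))"
      using V by (intro continuous_openin_preimage_gen continuous_on_Pair cont_u cont_vu open_Times) auto
    then show ?thesis by (simp add: openin_open)
  qed
  then have "\<forall>j. \<exists>U. open U \<and> X \<inter> ?uv -` (V j \<times> {r1<..<r2}) = X \<inter> U" ..
  from choice[OF this] obtain U where U: "\<And>j. open (U j)"
    "\<And>j. X \<inter> ?uv -` (V j \<times> {r1<..<r2}) = X \<inter> U j" by blast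
  have XU: "(w, s) \<in> X \<inter> (\<Inter>j. U j) \<longleftrightarrow> w \<in> cball 0 1 \<and> s \<in> {0..L} \<and> u w s \<in> ?E \<and> r1 < v (u w s) \<and> v (u w s) < r2" for w s
  proof -
    have "X \<inter> (\<Inter>j. U j) = (\<Inter>j. X \<inter> U j)" by blast
    then show ?thesis unfolding U(2)[symmetric] by (auto simp: X_def)
  qed
  \<comment> \<open>A null image in the product of directions and levels means, by Fubini, that for
    almost every \<open>w\<close> the levels at which the perturbed path meets \<open>E\<close> form
    a null set.\<close>
  define \<Phi> where "\<Phi> z = (fst z, v (u (fst z) (snd z)))" for z
  have cont_\<Phi>: "continuous_on X \<Phi>"
    unfolding \<Phi>_def by (intro continuous_intros cont_vu)
  have "\<Phi> ` (X \<inter> (\<Inter>j. U j)) \<in> null_sets lebesgue"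
  proof (rule null_image_gdelta[OF compact_X cont_\<Phi> U(1)])
    fix C assume C: "compact C" "C \<subseteq> X \<inter> (\<Inter>j. U j)"
    have "compact (\<Phi> ` C)"
      using C cont_\<Phi> by (intro compact_continuous_image) (auto elim: continuous_on_subset)
    then have meas: "\<Phi> ` C \<in> sets (lborel \<Otimes>\<^sub>M lborel)"
      unfolding lborel_prod by (simp add: borel_compact)
    \<comment> \<open>For a fixed level \<open>r\<close> the section contains only directions whose
      path meets the part of \<open>E\<close> on that level; this is where the Hausdorff null slices
      enter.\<close>
    have slice: "emeasure lborel ((\<lambda>w. (w, r)) -` (\<Phi> ` C)) = 0"
      if r: "r1 < r \<and> r < r2 \<longrightarrow> hausdorff_measure (DIM('a) - 1) {x \<in> D. x \<in> ?E \<and> v x = r} = 0" for r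
    proof -
      let ?F = "{x \<in> D. x \<in> ?E \<and> v x = r}"
      have mem: "w \<in> cball 0 1 \<and> r1 < r \<and> r < r2 \<and> (\<exists>s\<in>{0..L}. c s + (\<kappa> * R (c s)) *\<^sub>R w \<in> ?F)"
        if "w \<in> (\<lambda>w. (w, r)) -` (\<Phi> ` C)" for w
      proof -
        from that obtain s where s: "(w, s) \<in> C" "r = v (u w s)" by (auto simp: \<Phi>_def)
        then have "(w, s) \<in> X \<inter> (\<Inter>j. U j)" using C(2) by blast
        then have w: "w \<in> cball 0 1" "s \<in> {0..L}" "u w s \<in> ?E" "r1 < v (u w s)" "v (u w s) < r2"
          unfolding XU by blast+
        moreover have "u w s \<in> D" using u_near[OF w(1)] by blast
        ultimately show ?thesis using s(2) by (auto simp: u_def)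
      qed
      show ?thesis
      proof (cases "r1 < r \<and> r < r2")
        case True
        \<comment> \<open>The displacement radius is continuous and positive along the compact
          parameter interval; its minimum is the lower bound \<open>l0\<close> required for counting
          directions.\<close>
        have "continuous_on {0..L} (\<lambda>s. \<kappa> * R (c s))" by (intro continuous_intros cont_Rc)
        then obtain s0 where s0: "s0 \<in> {0..L}" "\<And>s. s \<in> {0..L} \<Longrightarrow> \<kappa> * R (c s0) \<le> \<kappa> * R (c s)"
          using continuous_attains_inf[of "{0..L}" "\<lambda>s. \<kappa> * R (c s)"] L by auto
        have "negligible {w \<in> cball 0 1. \<exists>s\<in>{0..L}. c s + (\<kappa> * R (c s)) *\<^sub>R w \<in> ?F}"
        proof (rule negligible_hit_directions)
          show "hausdorff_measure (DIM('a) - 1) ?F = 0" using r True by blast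
          show "\<bar>\<kappa> * R (c s) - \<kappa> * R (c t)\<bar> \<le> \<bar>s - t\<bar>" for s t
          proof (rule order_trans[OF Rc_lip])
            show "\<kappa> * \<bar>s - t\<bar> \<le> \<bar>s - t\<bar>" using \<kappa> mult_right_mono[of \<kappa> 1 "\<bar>s - t\<bar>"] by simp
          qed
          show "0 < \<kappa> * R (c s0)" using \<kappa> R_pos[OF c_D] by simp
        qed (use n c_lip s0 L in auto)
        then have "(\<lambda>w. (w, r)) -` (\<Phi> ` C) \<in> null_sets lebesgue"
          unfolding negligible_iff_null_sets by (rule null_sets_completion_subset[rotated]) (use mem in blast)
        moreover have "(\<lambda>w. (w, r)) -` (\<Phi> ` C) \<in> sets lborel"
          using sets_Pair2[OF meas] .
        ultimately show ?thesis by (auto simp: null_sets_def)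
      next
        case False
        then have "(\<lambda>w. (w, r)) -` (\<Phi> ` C) = {}" using mem by blast
        then show ?thesis by simp
      qed
    qed
    have "emeasure (lborel \<Otimes>\<^sub>M lborel) (\<Phi> ` C) = (\<integral>\<^sup>+ r. emeasure lborel ((\<lambda>w. (w, r)) -` (\<Phi> ` C)) \<partial>lborel)"
      by (rule lborel_pair.emeasure_pair_measure_alt2[OF meas])
    also have "\<dots> = (\<integral>\<^sup>+ r. 0 \<partial>(lborel :: real measure))"
      using slices by (intro nn_integral_cong_AE) (auto elim!: eventually_mono intro: slice)
    finally show "emeasure lborel (\<Phi> ` C) = 0" by (simp add: lborel_prod)
  qed
  then obtain Z where Z: "Z \<in> null_sets lborel" "\<Phi> ` (X \<inter> (\<Inter>j. U j)) \<subseteq> Z"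
    unfolding null_sets_completion_iff2 by blast
  have "AE z in lborel \<Otimes>\<^sub>M lborel. z \<notin> Z"
    unfolding lborel_prod using Z(1) by (rule AE_not_in)
  then have "AE w in lborel. AE r in lborel. (w, r) \<notin> Z"
    by (rule lborel_pair.AE_pair)
  then show ?thesis
  proof eventually_elim
    fix w assume Zw: "AE r in lborel. (w, r) \<notin> Z"
    show "w \<in> cball 0 1 \<longrightarrow> ?H
      \<le> ennreal (1 + \<kappa>) * ?K w"
    proof
      assume w: "w \<in> cball 0 1"
      define Zw' where "Zw' = {r. (w, r) \<in> Z}"
      have "Z \<in> sets (lborel \<Otimes>\<^sub>M lborel)" unfolding lborel_prod using Z(1) by auto
      from sets_Pair1[OF this, of w] have "Zw' \<in> sets lborel" by (simp add: Zw'_def vimage_def)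
      then have Zw': "Zw' \<in> null_sets lborel"
        using Zw AE_iff_null_sets[of Zw' lborel] by (simp add: Zw'_def)
      define h where "h s = v (u w s)" for s
      have cont_uw: "continuous_on UNIV (u w)"
        unfolding u_def by (intro continuous_intros cont_c cont_Rc)
      have [measurable]: "u w \<in> borel_measurable borel" using cont_uw by (rule borel_measurable_continuous_onI)
      have cont_h: "continuous_on UNIV h"
        unfolding h_def using u_near[OF w] by (intro continuous_on_compose2[OF v cont_uw]) auto
      then have h [measurable]: "h \<in> borel_measurable borel" by (rule borel_measurable_continuous_onI)
      define T where "T = {s \<in> {0..L}. u w s \<notin> ?E \<and> r1 < h s \<and> h s < r2}"
      have [measurable]: "?E \<in> sets borel" using V by (intro sets.countable_INT) auto
      have T [measurable]: "T \<in> sets borel" unfolding T_def by measurable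
      have "?H
          \<le> (\<integral>\<^sup>+ s. \<eta> (h s) * ennreal ((1 + \<kappa>) * g (u w s)) * indicator T s \<partial>lborel)"
      proof (rule weighted_image_integral_le[OF _ T _ _ h _ Zw' _ _ \<eta>])
        show "T \<subseteq> {0..L}" by (auto simp: T_def)
        show "(\<lambda>s. (1 + \<kappa>) * g (u w s)) \<in> borel_measurable borel" by measurable
        show "0 \<le> (1 + \<kappa>) * g (u w s)" for s using \<kappa> g0 by simp
        show "\<exists>d>0. \<forall>t\<in>{0..L}. \<bar>t - s\<bar> < d \<longrightarrow> \<bar>h t - h s\<bar> \<le> ((1 + \<kappa>) * g (u w s) + e) * \<bar>t - s\<bar>"
          if s: "s \<in> T" and e: "0 < e" for s e
        proof -
          have "u w s \<in> D" "u w s \<notin> ?E" using s u_near[OF w] by (auto simp: T_def)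
          \<comment> \<open>Error and radius are divided by \<open>1 + \<kappa>\<close> because the
            estimate for \<open>v\<close> is composed with a path of that Lipschitz
            constant.\<close>
          then obtain d where d: "0 < d" "\<And>y. y \<in> D \<Longrightarrow> dist y (u w s) < d \<Longrightarrow>
            \<bar>v y - v (u w s)\<bar> \<le> (g (u w s) + e / (1 + \<kappa>)) * dist y (u w s)"
            using lip[of "u w s" "e / (1 + \<kappa>)"] e \<kappa> by auto
          show ?thesis
          proof (intro exI[of _ "d / (1 + \<kappa>)"] conjI ballI impI)
            show "0 < d / (1 + \<kappa>)" using d \<kappa> by simp
            fix t assume t: "\<bar>t - s\<bar> < d / (1 + \<kappa>)"
            then have "(1 + \<kappa>) * \<bar>t - s\<bar> < d" using \<kappa> by (simp add: field_simps)
            then have "dist (u w t) (u w s) < d" using u_lip[OF w, of t s] by linarith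
            then have "\<bar>h t - h s\<bar> \<le> (g (u w s) + e / (1 + \<kappa>)) * dist (u w t) (u w s)"
              unfolding h_def using u_near[OF w] by (intro d(2)) auto
            also have "\<dots> \<le> (g (u w s) + e / (1 + \<kappa>)) * ((1 + \<kappa>) * \<bar>t - s\<bar>)"
              using u_lip[OF w, of t s] g0 e \<kappa> by (intro mult_left_mono) auto
            also have "\<dots> = ((1 + \<kappa>) * g (u w s) + e) * \<bar>t - s\<bar>"
              using \<kappa> by (simp add: field_simps)
            finally show "\<bar>h t - h s\<bar> \<le> ((1 + \<kappa>) * g (u w s) + e) * \<bar>t - s\<bar>" .
          qed
        qed
        \<comment> \<open>The displaced end points still lie at levels at most
          \<open>r1 + \<delta>\<close> and at least \<open>r2 - \<delta>\<close>, so every level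
          between is attained: at a point of \<open>E\<close>, and then it belongs to the null set
          \<open>Zw'\<close>, or at a parameter in \<open>T\<close>.\<close>
        show "{r1 + \<delta><..<r2 - \<delta>} \<subseteq> Zw' \<union> h ` T"
        proof
          fix r assume r: "r \<in> {r1 + \<delta><..<r2 - \<delta>}"
          have "h 0 \<le> r1 + \<delta>" "r2 - \<delta> \<le> h L"
            using u_near[OF w, of 0] u_near[OF w, of L] ends by (auto simp: h_def abs_le_iff)
          then have "\<exists>s. 0 \<le> s \<and> s \<le> L \<and> h s = r"
            using r L by (intro IVT' continuous_on_subset[OF cont_h]) auto
          then obtain s where s: "s \<in> {0..L}" "h s = r" by auto
          have "r1 < r" "r < r2" using r \<delta> by auto
          show "r \<in> Zw' \<union> h ` T"
          proof (cases "u w s \<in> ?E")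
            case True
            then have "(w, s) \<in> X \<inter> (\<Inter>j. U j)"
              using XU[of w s] w s \<open>r1 < r\<close> \<open>r < r2\<close> by (simp add: h_def)
            then have "\<Phi> (w, s) \<in> Z" using Z(2) by blast
            then show ?thesis using s by (simp add: \<Phi>_def Zw'_def h_def)
          next
            case False
            then have "s \<in> T" using s \<open>r1 < r\<close> \<open>r < r2\<close> by (simp add: T_def)
            then show ?thesis using s by blast
          qed
        qed
      qed simp
      also have "\<dots> = (\<integral>\<^sup>+ s. ennreal (1 + \<kappa>) * (indicator {0..L} s * G (u w s)) \<partial>lborel)"
      proof (rule nn_integral_cong)
        fix s
        show "\<eta> (h s) * ennreal ((1 + \<kappa>) * g (u w s)) * indicator T s = ennreal (1 + \<kappa>) * (indicator {0..L} s * G (u w s))"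
          using u_near[OF w, of s] \<kappa> g0[of "u w s"]
          by (auto simp: T_def G_def h_def indicator_def ennreal_mult mult_ac)
      qed
      also have "\<dots> = ennreal (1 + \<kappa>) * (\<integral>\<^sup>+ s. indicator {0..L} s * G (u w s) \<partial>lborel)"
      proof (rule nn_integral_cmult)
        have [measurable]: "D \<in> sets borel" using D by simp
        have "(\<lambda>s. indicator {0..L} s * (if s \<in> T then \<eta> (h s) * ennreal (g (u w s)) else 0)) \<in> borel_measurable lborel"
          by measurable
        moreover have "indicator {0..L} s * (if s \<in> T then \<eta> (h s) * ennreal (g (u w s)) else 0) = indicator {0..L} s * G (u w s)" for s
          using u_near[OF w, of s] by (auto simp: T_def G_def h_def indicator_def)
        ultimately show "(\<lambda>s. indicator {0..L} s * G (u w s)) \<in> borel_measurable lborel" by simp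
      qed
      finally show "?H
        \<le> ennreal (1 + \<kappa>) * ?K w"
        by (simp add: u_def)
    qed
  qed
qed

section \<open>A bound for the modulus\<close>

lemma path_modulus_mono: "\<Gamma> \<subseteq> \<Gamma>' \<Longrightarrow> path_modulus \<alpha> \<Gamma> \<le> path_modulus \<alpha> \<Gamma>'"
  unfolding path_modulus_def admissible_def by (intro INF_superset_mono) auto

text \<open>Clamping the parameter makes \<open>arc\<close> 1-Lipschitz on the whole line, so the
  integrand is Borel and Tonelli for \<open>lborel\<close> becomes applicable.\<close>

lemma (in rectifiable) line_integral_eq:
  assumes [measurable]: "\<rho> \<in> borel_measurable borel"
  shows "line_integral \<gamma> \<rho> = (\<integral>\<^sup>+ s. indicator {0..len 1} s * \<rho> (arc (max 0 (min s (len 1)))) \<partial>lborel)"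
proof -
  let ?c = "\<lambda>s. arc (max 0 (min s (len 1)))"
  have "continuous_on UNIV ?c"
  proof (rule continuous_on_nonexpansive)
    fix t s :: real
    have "dist (?c t) (?c s) \<le> \<bar>max 0 (min t (len 1)) - max 0 (min s (len 1))\<bar>"
      using len_1_nonneg by (intro arc_lipschitz) auto
    also have "\<dots> \<le> dist t s" by (auto simp: max_def min_def dist_real_def)
    finally show "dist (?c t) (?c s) \<le> dist t s" .
  qed
  then have [measurable]: "?c \<in> borel_measurable borel" by (rule borel_measurable_continuous_onI)
  have "line_integral \<gamma> \<rho> = (\<integral>\<^sup>+ s. \<rho> (arc s) * indicator {0..len 1} s \<partial>lebesgue)"
    unfolding line_integral_def arc_def len_def by (subst nn_integral_restrict_space) auto
  also have "\<dots> = (\<integral>\<^sup>+ s. indicator {0..len 1} s * \<rho> (?c s) \<partial>lebesgue)"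
    by (intro nn_integral_cong) (auto simp: indicator_def max_def min_def)
  also have "\<dots> = (\<integral>\<^sup>+ s. indicator {0..len 1} s * \<rho> (?c s) \<partial>lborel)"
    by (rule nn_integral_completion)
  finally show ?thesis .
qed

text \<open>For each \<open>\<kappa>\<close> the averaged weight times \<open>q \<kappa>\<close>
  competes in the modulus. Scaling costs \<open>q \<kappa> powr \<alpha>\<close>, smoothing costs
  \<open>q \<kappa> ^ n\<close>, and both disappear in the limit.\<close>

lemma path_modulus_le_integral:
  fixes v g :: "'a::euclidean_space \<Rightarrow> real" and \<eta> :: "real \<Rightarrow> ennreal" and V :: "nat \<Rightarrow> 'a set"
  assumes n: "2 \<le> DIM('a)" and D: "open D" and v: "continuous_on D v" and V: "\<And>j. open (V j)"
    and slices: "AE r in lborel. r1 < r \<and> r < r2 \<longrightarrow>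
      hausdorff_measure (DIM('a) - 1) {x \<in> D. x \<in> (\<Inter>j. V j) \<and> v x = r} = 0"
    and g [measurable]: "g \<in> borel_measurable borel" and g0: "\<And>x. 0 \<le> g x"
    and lip: "\<And>x e. x \<in> D \<Longrightarrow> x \<notin> (\<Inter>j. V j) \<Longrightarrow> 0 < e \<Longrightarrow>
      \<exists>d>0. \<forall>y\<in>D. dist y x < d \<longrightarrow> \<bar>v y - v x\<bar> \<le> (g x + e) * dist y x"
    and \<eta> [measurable]: "\<eta> \<in> borel_measurable borel"
    and \<eta>1: "1 \<le> (\<integral>\<^sup>+ r. \<eta> r * indicator {r1<..<r2} r \<partial>lborel)" and \<alpha>: "1 < \<alpha>"
  defines "G \<equiv> \<lambda>x. if x \<in> D \<and> x \<notin> (\<Inter>j. V j) \<and> r1 < v x \<and> v x < r2 then \<eta> (v x) * ennreal (g x) else 0"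
  shows "path_modulus \<alpha> {\<gamma>. path \<gamma> \<and> path_image \<gamma> \<subseteq> D \<and> v (pathstart \<gamma>) \<le> r1 \<and> r2 \<le> v (pathfinish \<gamma>)}
    \<le> (\<integral>\<^sup>+ x. ennreal_powr (G x) \<alpha> \<partial>lborel)" (is "path_modulus \<alpha> ?\<Gamma> \<le> ?I")
proof -
  let ?n = "DIM('a)"
  \<comment> \<open>For admissibility the numerator pays for the stretching of perturbed paths, the
    denominator for the mass of \<open>\<eta>\<close> lost at the ends; the smoothing bound involves
    the same quotient.\<close>
  define q where "q \<kappa> = (1 + \<kappa>) / (1 - \<kappa>)" for \<kappa> :: real
  have [measurable]: "D \<in> sets borel" using D by simp
  have [measurable]: "(\<Inter>j. V j) \<in> sets borel" using V by (intro sets.countable_INT) auto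
  define v0 where "v0 x = (if x \<in> D then v x else 0)" for x
  have [measurable]: "v0 \<in> borel_measurable borel"
    using borel_measurable_continuous_on_if[of D v "\<lambda>_. 0"] v unfolding v0_def by auto
  have "(\<lambda>x. if x \<in> D \<and> x \<notin> (\<Inter>j. V j) \<and> r1 < v0 x \<and> v0 x < r2 then \<eta> (v0 x) * ennreal (g x) else 0) \<in> borel_measurable borel"
    by measurable
  moreover have "(\<lambda>x. if x \<in> D \<and> x \<notin> (\<Inter>j. V j) \<and> r1 < v0 x \<and> v0 x < r2 then \<eta> (v0 x) * ennreal (g x) else 0) = G"
    unfolding G_def by (rule ext) (auto simp: v0_def)
  ultimately have G [measurable]: "G \<in> borel_measurable borel" by simp
  have bound: "path_modulus \<alpha> ?\<Gamma> \<le> ?I * ennreal (q \<kappa> powr \<alpha> * q \<kappa> ^ ?n)" if \<kappa>: "0 < \<kappa>" "\<kappa> < 1" for \<kappa>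
  proof -
    have q: "0 < q \<kappa>" using \<kappa> by (simp add: q_def)
    \<comment> \<open>Continuity from below of the measure with density \<open>\<eta>\<close>:
      slightly shorter intervals keep mass above \<open>1 - \<kappa>\<close>, also when the total
      mass is infinite.\<close>
    have "\<exists>\<delta>>0. ennreal (1 - \<kappa>) < (\<integral>\<^sup>+ r. \<eta> r * indicator {r1 + \<delta><..<r2 - \<delta>} r \<partial>lborel)"
    proof -
      define S where "S j = {r1 + 1 / real (Suc j)<..<r2 - 1 / real (Suc j)}" for j
      have [measurable]: "S j \<in> sets borel" for j by (simp add: S_def)
      have "S j \<subseteq> S (Suc j)" for j
      proof -
        have "1 / real (Suc (Suc j)) \<le> 1 / real (Suc j)" by (intro divide_left_mono) auto
        then show ?thesis by (auto simp: S_def)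
      qed
      then have inc: "incseq S" by (rule incseq_SucI)
      have S_UN: "(\<Union>j. S j) = {r1<..<r2}"
      proof
        show "{r1<..<r2} \<subseteq> (\<Union>j. S j)"
        proof
          fix r assume "r \<in> {r1<..<r2}"
          then have "0 < min (r - r1) (r2 - r)" by simp
          then obtain j where "1 / real (Suc j) < min (r - r1) (r2 - r)" by (metis nat_approx_posE)
          then have "r \<in> S j" by (auto simp: S_def)
          then show "r \<in> (\<Union>j. S j)" by blast
        qed
        show "(\<Union>j. S j) \<subseteq> {r1<..<r2}"
        proof
          fix r assume "r \<in> (\<Union>j. S j)"
          then obtain j where "r \<in> S j" by blast
          moreover have "0 < 1 / real (Suc j)" by simp
          ultimately show "r \<in> {r1<..<r2}" unfolding S_def greaterThanLessThan_iff by linarith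
        qed
      qed
      define \<nu> where "\<nu> = density lborel \<eta>"
      have em: "emeasure \<nu> A = (\<integral>\<^sup>+ r. \<eta> r * indicator A r \<partial>lborel)" if "A \<in> sets borel" for A
        using that unfolding \<nu>_def by (subst emeasure_density) auto
      have "(SUP j. emeasure \<nu> (S j)) = emeasure \<nu> (\<Union>j. S j)"
        using inc by (intro SUP_emeasure_incseq) (auto simp: \<nu>_def)
      then have "1 \<le> (SUP j. emeasure \<nu> (S j))"
        unfolding S_UN using \<eta>1 em[of "{r1<..<r2}"] by simp
      moreover have "ennreal (1 - \<kappa>) < 1" using \<kappa> by (simp add: ennreal_less_one_iff)
      ultimately have "ennreal (1 - \<kappa>) < (SUP j. emeasure \<nu> (S j))" by (rule less_le_trans[rotated])
      then obtain j where "ennreal (1 - \<kappa>) < emeasure \<nu> (S j)" by (auto simp: less_SUP_iff)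
      then show ?thesis
        using em[of "S j"] by (intro exI[of _ "1 / real (Suc j)"]) (auto simp: S_def)
    qed
    then obtain \<delta> where \<delta>: "0 < \<delta>" and
      big: "ennreal (1 - \<kappa>) < (\<integral>\<^sup>+ r. \<eta> r * indicator {r1 + \<delta><..<r2 - \<delta>} r \<partial>lborel)" by blast
    obtain R :: "'a \<Rightarrow> real" where R: "\<And>x. 0 \<le> R x" "\<And>x. x \<in> D \<Longrightarrow> 0 < R x" "\<And>x y. \<bar>R x - R y\<bar> \<le> dist x y"
      "\<And>x y. dist x y < R x \<Longrightarrow> y \<in> D \<and> \<bar>v y - v x\<bar> \<le> \<delta>"
      by (rule oscillation_radius[OF D v \<delta>]) blast
      let ?P = "\<lambda>x. \<integral>\<^sup>+ w. ball_weight w * ennreal_powr (G (x + (\<kappa> * R x) *\<^sub>R w)) \<alpha> \<partial>lborel"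
      let ?H = "\<integral>\<^sup>+ r. \<eta> r * indicator {r1 + \<delta><..<r2 - \<delta>} r \<partial>lborel"
    have "continuous_on UNIV R" using R(3) by (intro continuous_on_nonexpansive) (simp add: dist_real_def)
    then have [measurable]: "R \<in> borel_measurable borel" by (rule borel_measurable_continuous_onI)
    define avg where "avg x = (\<integral>\<^sup>+ w. ball_weight w * G (x + (\<kappa> * R x) *\<^sub>R w) \<partial>lborel)" for x
    have [measurable]: "avg \<in> borel_measurable borel"
      unfolding avg_def by measurable
    \<comment> \<open>The cut-off restricts the average to \<open>D\<close>, where \<open>R\<close>
      is positive and where all paths of the family run.\<close>
    define \<rho> where "\<rho> x = ennreal (q \<kappa>) * (indicator D x * avg x)" for x
    have \<rho> [measurable]: "\<rho> \<in> borel_measurable borel" unfolding \<rho>_def by measurable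
    have "admissible \<rho> ?\<Gamma>"
      unfolding admissible_def
    proof (intro conjI \<rho> ballI impI)
      fix \<gamma> assume \<gamma>: "\<gamma> \<in> ?\<Gamma>" and "rectifiable_path \<gamma>"
      interpret rectifiable \<gamma> by unfold_locales fact
      define L where "L = len 1"
      have L: "0 \<le> L" using len_1_nonneg by (simp add: L_def)
      define c where "c s = arc (max 0 (min s L))" for s
      have c_D: "c s \<in> D" for s
        using \<gamma> arc_in_path_image[of "max 0 (min s L)"] L by (auto simp: c_def L_def)
      have c_lip: "dist (c s) (c t) \<le> \<bar>s - t\<bar>" for s t
      proof -
        have "dist (c s) (c t) \<le> \<bar>max 0 (min s L) - max 0 (min t L)\<bar>"
          unfolding c_def using L by (intro arc_lipschitz) (auto simp: L_def)
        also have "\<dots> \<le> \<bar>s - t\<bar>" by (auto simp: max_def min_def)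
        finally show ?thesis .
      qed
      have "continuous_on UNIV c" using c_lip by (intro continuous_on_nonexpansive) (simp add: dist_real_def)
      then have [measurable]: "c \<in> borel_measurable borel" by (rule borel_measurable_continuous_onI)
      have ends: "v (c 0) \<le> r1" "r2 \<le> v (c L)"
        using \<gamma> L arc_start arc_finish by (auto simp: c_def L_def)
      define J where "J w = (\<integral>\<^sup>+ s. indicator {0..L} s * G (c s + (\<kappa> * R (c s)) *\<^sub>R w) \<partial>lborel)" for w
      have [measurable]: "J \<in> borel_measurable borel" unfolding J_def by measurable
      have AE: "AE w in lborel. w \<in> cball 0 1 \<longrightarrow>
        ?H \<le> ennreal (1 + \<kappa>) * J w"
        unfolding J_def G_def
        by (rule AE_direction_integral_le[OF n D v V slices g g0 lip \<eta> R(2,3,4) \<kappa> \<delta> c_D c_lip L ends])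
      \<comment> \<open>Averaging over directions with \<open>ball_weight\<close> turns, by Tonelli,
        the integrals along perturbed paths into the integral of \<open>avg\<close> along the path
        itself.\<close>
      have "ennreal (1 - \<kappa>) = (\<integral>\<^sup>+ w. ennreal (1 - \<kappa>) * ball_weight (w :: 'a) \<partial>lborel)"
        by (simp add: nn_integral_cmult nn_integral_ball_weight)
      also have "\<dots> \<le> (\<integral>\<^sup>+ w. ennreal (1 + \<kappa>) * (ball_weight w * J w) \<partial>lborel)"
      proof (rule nn_integral_mono_AE)
        show "AE w in lborel. ennreal (1 - \<kappa>) * ball_weight w \<le> ennreal (1 + \<kappa>) * (ball_weight w * J w)"
          using AE
        proof eventually_elim
          fix w :: 'a
          assume w: "w \<in> cball 0 1 \<longrightarrow>
            ?H \<le> ennreal (1 + \<kappa>) * J w"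
          show "ennreal (1 - \<kappa>) * ball_weight w \<le> ennreal (1 + \<kappa>) * (ball_weight w * J w)"
          proof (cases "w \<in> cball 0 1")
            case True
            then have "ennreal (1 - \<kappa>) \<le> ennreal (1 + \<kappa>) * J w" using w big by (meson less_imp_le order_trans)
            then have "ennreal (1 - \<kappa>) * ball_weight w \<le> (ennreal (1 + \<kappa>) * J w) * ball_weight w"
              by (rule mult_right_mono) simp
            then show ?thesis by (simp add: mult_ac)
          qed (simp add: ball_weight_def)
        qed
      qed
      also have "\<dots> = ennreal (1 + \<kappa>) * (\<integral>\<^sup>+ w. ball_weight w * J w \<partial>lborel)"
        by (rule nn_integral_cmult) measurable
      also have "(\<integral>\<^sup>+ w. ball_weight w * J w \<partial>lborel) =
          (\<integral>\<^sup>+ w. \<integral>\<^sup>+ s. indicator {0..L} s * (ball_weight w * G (c s + (\<kappa> * R (c s)) *\<^sub>R w)) \<partial>lborel \<partial>lborel)"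
        unfolding J_def
        by (intro nn_integral_cong, subst nn_integral_cmult[symmetric]) (auto simp: mult_ac)
      also have "\<dots> = (\<integral>\<^sup>+ s. \<integral>\<^sup>+ w. indicator {0..L} s * (ball_weight w * G (c s + (\<kappa> * R (c s)) *\<^sub>R w)) \<partial>lborel \<partial>lborel)"
        by (rule lborel_pair.Fubini') measurable
      also have "\<dots> = (\<integral>\<^sup>+ s. indicator {0..L} s * avg (c s) \<partial>lborel)"
        unfolding avg_def by (intro nn_integral_cong nn_integral_cmult) measurable
      finally have "ennreal (1 - \<kappa>) \<le> ennreal (1 + \<kappa>) * (\<integral>\<^sup>+ s. indicator {0..L} s * avg (c s) \<partial>lborel)" .
      then have "ennreal (1 / (1 - \<kappa>)) * ennreal (1 - \<kappa>)
          \<le> ennreal (1 / (1 - \<kappa>)) * (ennreal (1 + \<kappa>) * (\<integral>\<^sup>+ s. indicator {0..L} s * avg (c s) \<partial>lborel))"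
        by (rule mult_left_mono) simp
      moreover have "ennreal (1 / (1 - \<kappa>)) * ennreal (1 - \<kappa>) = 1"
        using \<kappa> by (simp add: ennreal_mult[symmetric])
      moreover have "ennreal (1 / (1 - \<kappa>)) * (ennreal (1 + \<kappa>) * x) = ennreal (q \<kappa>) * x" for x
      proof -
        have "ennreal (1 / (1 - \<kappa>)) * ennreal (1 + \<kappa>) = ennreal (q \<kappa>)"
          using \<kappa> by (subst ennreal_mult[symmetric]) (auto simp: q_def)
        then show ?thesis by (simp only: mult.assoc[symmetric])
      qed
      ultimately have "1 \<le> ennreal (q \<kappa>) * (\<integral>\<^sup>+ s. indicator {0..L} s * avg (c s) \<partial>lborel)" by simp
      also have "\<dots> = (\<integral>\<^sup>+ s. ennreal (q \<kappa>) * (indicator {0..L} s * avg (c s)) \<partial>lborel)"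
        by (rule nn_integral_cmult[symmetric]) measurable
      also have "\<dots> = (\<integral>\<^sup>+ s. indicator {0..L} s * \<rho> (c s) \<partial>lborel)"
        using c_D by (intro nn_integral_cong) (simp add: \<rho>_def mult_ac)
      also have "\<dots> = line_integral \<gamma> \<rho>"
        unfolding line_integral_eq[OF \<rho>] c_def L_def ..
      finally show "1 \<le> line_integral \<gamma> \<rho>" .
    qed
    then have "path_modulus \<alpha> ?\<Gamma> \<le> (\<integral>\<^sup>+ x. ennreal_powr (\<rho> x) \<alpha> \<partial>lebesgue)"
      unfolding path_modulus_def by (intro INF_lower) simp
    also have "\<dots> = (\<integral>\<^sup>+ x. ennreal_powr (\<rho> x) \<alpha> \<partial>lborel)"
      by (rule nn_integral_completion)
    also have "\<dots> \<le> (\<integral>\<^sup>+ x. ennreal (q \<kappa> powr \<alpha>) * (indicator D x *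
        ?P x) \<partial>lborel)"
    proof (rule nn_integral_mono)
      fix x
      \<comment> \<open>Jensen moves the power inside the average, so that the smoothing bound can
        be applied to the power of \<open>G\<close>.\<close>
      have "ennreal_powr (avg x) \<alpha> \<le> ?P x"
        unfolding avg_def by (intro weighted_average_powr_le \<alpha> nn_integral_ball_weight) measurable
      then show "ennreal_powr (\<rho> x) \<alpha> \<le> ennreal (q \<kappa> powr \<alpha>) * (indicator D x *
          ?P x)"
        using \<alpha> q by (cases "x \<in> D") (auto simp: \<rho>_def ennreal_powr_mult ennreal_powr_ennreal mult_left_mono)
    qed
    also have "\<dots> = ennreal (q \<kappa> powr \<alpha>) * (\<integral>\<^sup>+ x. indicator D x *
        ?P x \<partial>lborel)"
      by (rule nn_integral_cmult) measurable
    also have "\<dots> \<le> ennreal (q \<kappa> powr \<alpha>) * (ennreal (q \<kappa> ^ ?n) * ?I)"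
      unfolding q_def using R \<kappa> by (intro mult_left_mono nn_integral_smoothing_le) auto
    also have "\<dots> = ?I * ennreal (q \<kappa> powr \<alpha> * q \<kappa> ^ ?n)"
      using q by (simp add: ennreal_mult mult_ac)
    finally show ?thesis .
  qed
  show ?thesis
  proof (cases "?I = \<infinity>")
    case False
    \<comment> \<open>The shift by two keeps \<open>\<kappa> j\<close> strictly below 1. Finiteness
      of the integral is what lets the product pass to the limit.\<close>
    define \<kappa> where "\<kappa> j = 1 / real (Suc (Suc j))" for j
    have \<kappa>: "0 < \<kappa> j" "\<kappa> j < 1" for j by (simp_all add: \<kappa>_def)
    have "\<kappa> \<longlonglongrightarrow> 0"
      unfolding \<kappa>_def by (intro LIMSEQ_Suc lim_1_over_n)
    then have "(\<lambda>j. q (\<kappa> j)) \<longlonglongrightarrow> (1 + 0) / (1 - 0)"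
      unfolding q_def by (intro tendsto_intros) auto
    then have "(\<lambda>j. q (\<kappa> j) powr \<alpha> * q (\<kappa> j) ^ ?n) \<longlonglongrightarrow> 1 powr \<alpha> * 1 ^ ?n"
      by (intro tendsto_intros) auto
    then have "(\<lambda>j. ennreal (q (\<kappa> j) powr \<alpha> * q (\<kappa> j) ^ ?n)) \<longlonglongrightarrow> ennreal 1"
      by (intro tendsto_ennrealI) simp
    then have "(\<lambda>j. ?I * ennreal (q (\<kappa> j) powr \<alpha> * q (\<kappa> j) ^ ?n)) \<longlonglongrightarrow> ?I * ennreal 1"
      using False by (intro ennreal_tendsto_cmult) (simp_all add: less_top)
    then have "path_modulus \<alpha> ?\<Gamma> \<le> ?I * ennreal 1"
      by (rule LIMSEQ_le_const) (use bound \<kappa> in auto)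
    then show ?thesis by simp
  qed simp
qed

section \<open>The inverse Poletsky inequality\<close>

lemma hausdorff_measure_mono: "A \<subseteq> B \<Longrightarrow> hausdorff_measure s A \<le> hausdorff_measure s B"
  unfolding hausdorff_measure_def hausdorff_content_def
  by (intro SUP_mono' INF_superset_mono) auto

text \<open>The factor may be infinite, since \<open>\<eta>\<close> takes the value infinity; finite
  partial sums are compared.\<close>

lemma infsum_ennreal_le_cmult:
  fixes F K :: "'a \<Rightarrow> ennreal"
  assumes "A \<subseteq> B" and "\<And>x. x \<in> A \<Longrightarrow> F x \<le> c * K x"
  shows "(\<Sum>\<^sub>\<infinity>x\<in>A. F x) \<le> c * (\<Sum>\<^sub>\<infinity>x\<in>B. K x)"
proof (subst nonneg_infsum_complete[of A F])
  show "(SUP S\<in>{S. finite S \<and> S \<subseteq> A}. sum F S) \<le> c * (\<Sum>\<^sub>\<infinity>x\<in>B. K x)"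
  proof (rule SUP_least)
    fix S assume S: "S \<in> {S. finite S \<and> S \<subseteq> A}"
    have "sum F S \<le> (\<Sum>x\<in>S. c * K x)" using S assms(2) by (intro sum_mono) auto
    also have "\<dots> = c * (\<Sum>x\<in>S. K x)" by (rule sum_distrib_left[symmetric])
    also have "\<dots> = c * (\<Sum>\<^sub>\<infinity>x\<in>S. K x)" using S by simp
    also have "\<dots> \<le> c * (\<Sum>\<^sub>\<infinity>x\<in>B. K x)"
      using S assms(1) by (intro mult_left_mono infsum_mono_neutral nonneg_summable_on_complete) auto
    finally show "sum F S \<le> c * (\<Sum>\<^sub>\<infinity>x\<in>B. K x)" .
  qed
qed simp

text \<open>A Borel function equal to \<open>\<eta>\<close> almost everywhere is set to 0 on a Borel
  null set containing the exceptions. This leaves the integral unchanged and gives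
  \<open>\<eta>' \<le> \<eta>\<close> at every point, so composition with the distance to
  \<open>y0\<close> raises no question about null sets.\<close>

lemma borel_minorant:
  fixes \<eta> :: "real \<Rightarrow> ennreal"
  assumes \<eta>: "\<eta> \<in> borel_measurable (lebesgue_on {a<..<b})"
  obtains \<eta>' where "\<eta>' \<in> borel_measurable borel" "\<And>r. r \<in> {a<..<b} \<Longrightarrow> \<eta>' r \<le> \<eta> r"
    "(\<integral>\<^sup>+ r. \<eta>' r * indicator {a<..<b} r \<partial>lborel) = (\<integral>\<^sup>+ r. \<eta> r \<partial>(lebesgue_on {a<..<b}))"
proof -
  let ?\<eta> = "\<lambda>r. \<eta> r * indicator {a<..<b} r"
  have "?\<eta> \<in> borel_measurable lebesgue"
    using \<eta> by (subst (asm) borel_measurable_restrict_space_iff_ennreal) auto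
  then obtain \<eta>1 where \<eta>1: "\<eta>1 \<in> borel_measurable lborel" and ae: "AE r in lborel. ?\<eta> r = \<eta>1 r"
    using completion_ex_borel_measurable by blast
  have [measurable]: "\<eta>1 \<in> borel_measurable borel" using \<eta>1 by simp
  obtain N where N: "N \<in> null_sets lborel" "{r \<in> space lborel. \<not> ?\<eta> r = \<eta>1 r} \<subseteq> N"
    using ae unfolding eventually_ae_filter by blast
  have [measurable]: "N \<in> sets borel" using N(1) by auto
  define \<eta>' where "\<eta>' r = (if r \<in> N then 0 else \<eta>1 r)" for r
  have eq: "\<eta>' r = ?\<eta> r" if "r \<notin> N" for r
  proof -
    have "?\<eta> r = \<eta>1 r" by (rule ccontr) (use that N(2) in auto)
    then show ?thesis using that by (simp add: \<eta>'_def)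
  qed
  show thesis
  proof (rule that[of \<eta>'])
    show \<eta>' [measurable]: "\<eta>' \<in> borel_measurable borel" unfolding \<eta>'_def by measurable
    show "\<eta>' r \<le> \<eta> r" if "r \<in> {a<..<b}" for r
      using eq[of r] that by (cases "r \<in> N") (auto simp: \<eta>'_def)
    have "(\<integral>\<^sup>+ r. \<eta> r \<partial>(lebesgue_on {a<..<b})) = (\<integral>\<^sup>+ r. ?\<eta> r \<partial>lebesgue)"
      by (subst nn_integral_restrict_space) auto
    also have "\<dots> = (\<integral>\<^sup>+ r. \<eta>' r * indicator {a<..<b} r \<partial>lebesgue)"
    proof (rule nn_integral_cong_AE)
      have "AE r in lebesgue. r \<notin> N" using N(1) by (intro AE_completion AE_not_in)
      then show "AE r in lebesgue. ?\<eta> r = \<eta>' r * indicator {a<..<b} r"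
        by eventually_elim (simp add: eq indicator_def)
    qed
    also have "\<dots> = (\<integral>\<^sup>+ r. \<eta>' r * indicator {a<..<b} r \<partial>lborel)"
      by (rule nn_integral_completion)
    finally show "(\<integral>\<^sup>+ r. \<eta>' r * indicator {a<..<b} r \<partial>lborel) = (\<integral>\<^sup>+ r. \<eta> r \<partial>(lebesgue_on {a<..<b}))" ..
  qed
qed

lemma null_set_gdelta_hull:
  fixes N :: "'a::euclidean_space set"
  assumes N: "N \<in> null_sets lebesgue"
  obtains V :: "nat \<Rightarrow> 'a set" where "\<And>j. open (V j)" "N \<subseteq> (\<Inter>j. V j)" "(\<Inter>j. V j) \<in> null_sets lebesgue"
proof -
  have "\<forall>j. \<exists>U. open U \<and> N \<subseteq> U \<and> emeasure lebesgue U \<le> ennreal (1 / real (Suc j))"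
    using null_set_open_superset[OF N] by simp
  from choice[OF this] obtain V where V: "\<And>j. open (V j)" "\<And>j. N \<subseteq> V j"
    "\<And>j. emeasure lebesgue (V j) \<le> ennreal (1 / real (Suc j))" by blast
  have sets: "(\<Inter>j. V j) \<in> sets borel" using V(1) by (intro sets.countable_INT) auto
  have "emeasure lebesgue (\<Inter>j. V j) \<le> ennreal (1 / real (Suc j))" for j
    using V sets by (intro order_trans[OF emeasure_mono V(3)]) auto
  moreover have "(\<lambda>j. ennreal (1 / real (Suc j))) \<longlonglongrightarrow> ennreal 0"
    by (intro tendsto_ennrealI LIMSEQ_Suc[OF lim_1_over_n])
  ultimately have "emeasure lebesgue (\<Inter>j. V j) \<le> ennreal 0"
    by (intro LIMSEQ_le_const) auto
  then show thesis using V sets by (intro that[of V]) auto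
qed

lemma locally_lipschitz_onorm:
  fixes f :: "'a::real_normed_vector \<Rightarrow> 'b::real_normed_vector"
  assumes "f differentiable (at x)" and e: "0 < e"
  shows "\<exists>d>0. \<forall>y. dist y x < d \<longrightarrow> dist (f y) (f x) \<le> (onorm (frechet_derivative f (at x)) + e) * dist y x"
proof -
  let ?f' = "frechet_derivative f (at x)"
  have der: "(f has_derivative ?f') (at x)" using assms(1) frechet_derivative_works by blast
  then obtain d where d: "0 < d" "\<And>y. norm (y - x) < d \<Longrightarrow> norm (f y - f x - ?f' (y - x)) \<le> e * norm (y - x)"
    using e unfolding has_derivative_at_alt by blast
  show ?thesis
  proof (intro exI[of _ d] conjI allI impI)
    fix y assume "dist y x < d"
    then have "norm (f y - f x - ?f' (y - x)) \<le> e * norm (y - x)" by (intro d(2)) (simp add: dist_norm)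
    moreover have "norm (?f' (y - x)) \<le> onorm ?f' * norm (y - x)"
      using der by (intro onorm has_derivative_bounded_linear)
    moreover have "norm (f y - f x) \<le> norm (f y - f x - ?f' (y - x)) + norm (?f' (y - x))"
      using norm_triangle_ineq[of "f y - f x - ?f' (y - x)" "?f' (y - x)"] by simp
    ultimately show "dist (f y) (f x) \<le> (onorm ?f' + e) * dist y x"
      by (simp add: dist_norm distrib_right)
  qed (rule d(1))
qed

theorem corollary1p1:
  fixes D :: "(real ^ 'n) set"
    and f :: "real ^ 'n \<Rightarrow> real ^ 'n"
    and y0 :: "real ^ 'n"
    and \<alpha> :: real
    and r0 :: ereal
  assumes "CARD('n) \<ge> 2"
    and "open D" and "connected D" and "D \<noteq> {}"
    and "compact (closure D)"
    and "real CARD('n) - 1 < \<alpha>" and "\<alpha> \<le> real CARD('n)"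
    and "continuous_on D f"
    and "open_map (top_of_set D) euclidean f"
    and "\<And>y. discrete {x\<in>D. f x = y}"
    and "closed_map (top_of_set D) (top_of_set (f ` D)) f"
    and "AE x in lebesgue_on D. f differentiable (at x)"
    and "luzin_N f D"
    and "y0 \<in> closure (f ` D)"
    and "r0 = (SUP y\<in>f ` D. ereal (dist y y0))" and "r0 > 0"
    and "AE x in lebesgue_on D. det (jacobian f (at x)) \<noteq> 0"
    and "\<And>\<epsilon>::real. 0 < \<epsilon> \<Longrightarrow> ereal \<epsilon> < r0 \<Longrightarrow>
           AE r in lebesgue. \<epsilon> < r \<and> ereal r < r0 \<longrightarrow> luzin_N_inverse_on_sphere f D y0 r"
    and "inner_dilatation D \<alpha> f \<in> borel_measurable (lebesgue_on (f ` D))"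
    and "(\<integral>\<^sup>+ y. inner_dilatation D \<alpha> f y \<partial>(lebesgue_on (f ` D))) < \<infinity>"
  shows "inverse_poletsky_at D f \<alpha>
           (\<lambda>y. ennreal_powr (map_multiplicity f D) \<alpha> * inner_dilatation D \<alpha> f y) y0"
proof -
  note n = assms(1) and D = assms(2) and \<alpha> = assms(6) and f = assms(8)
  have dim: "DIM(real ^ 'n) = CARD('n)" by simp
  have \<alpha>1: "1 < \<alpha>" using n \<alpha> by linarith
  have D_borel [measurable]: "D \<in> sets borel" using D by simp
  define Q where "Q = inner_dilatation D \<alpha> f"
  define N\<alpha> where "N\<alpha> = ennreal_powr (map_multiplicity f D) \<alpha>"
  have fD: "open (f ` D)"
    using assms(9) D unfolding open_map_def by (simp add: openin_open_eq)
  define v where "v x = dist (f x) y0" for x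
  have v: "continuous_on D v" unfolding v_def by (intro continuous_intros f)

  have "AE x in lebesgue. x \<in> D \<longrightarrow> f differentiable (at x) \<and> det (jacobian f (at x)) \<noteq> 0"
    using AE_conjI[OF assms(12) assms(17)] D_borel by (subst (asm) AE_restrict_space_iff) auto
  then obtain N where N: "N \<in> null_sets lebesgue"
    "{x \<in> space lebesgue. \<not> (x \<in> D \<longrightarrow> f differentiable (at x) \<and> det (jacobian f (at x)) \<noteq> 0)} \<subseteq> N"
    unfolding eventually_ae_filter by blast
  obtain V :: "nat \<Rightarrow> (real ^ 'n) set" where V: "\<And>j. open (V j)" "N \<subseteq> (\<Inter>j. V j)" "(\<Inter>j. V j) \<in> null_sets lebesgue"
    by (rule null_set_gdelta_hull[OF N(1)]) blast
  define E where "E = (\<Inter>j. V j)"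
  have E_borel [measurable]: "E \<in> sets borel" unfolding E_def using V by (intro sets.countable_INT) auto
  have DE_null: "D \<inter> E \<in> null_sets lebesgue"
    using V(3) null_sets_completion_subset[of "D \<inter> E" E lborel] by (auto simp: E_def)
  \<comment> \<open>The Luzin property transfers the null set to the image side: almost every
    \<open>y\<close> has all its preimages in \<open>W\<close>.\<close>
  then have fE_null: "f ` (D \<inter> E) \<in> null_sets lebesgue"
    using assms(13) by (auto simp: luzin_N_def)
  define W where "W = D - E"
  have W [measurable]: "W \<in> sets borel" and WD: "W \<subseteq> D" by (auto simp: W_def)
  have diff: "f differentiable (at x)" and det: "det (jacobian f (at x)) \<noteq> 0" if "x \<in> W" for x
    using that N(2) V(2) by (auto simp: W_def E_def)

  define g where "g x = (if x \<in> W then onorm (frechet_derivative f (at x)) else 0)" for x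
  have g [measurable]: "g \<in> borel_measurable borel"
    unfolding g_def by (rule onorm_derivative_borel_measurable[OF D f W WD diff])
  have g0: "0 \<le> g x" for x
  proof (cases "x \<in> W")
    case True
    then have "bounded_linear (frechet_derivative f (at x))"
      using diff frechet_derivative_works has_derivative_bounded_linear by blast
    then show ?thesis using True by (simp add: g_def onorm_pos_le)
  qed (simp add: g_def)
  define J where "J x = (if x \<in> W then det (jacobian f (at x)) else 0)" for x
  have J [measurable]: "J \<in> borel_measurable borel"
    unfolding J_def by (rule det_jacobian_borel_measurable[OF D f W WD diff])

  have "path_modulus \<alpha> (lifted_paths D f y0 r1 r2 C1 C2)
      \<le> (\<integral>\<^sup>+ y. N\<alpha> * Q y * ennreal_powr (\<eta> (dist y y0)) \<alpha> \<partial>(lebesgue_on (annulus y0 r1 r2 \<inter> f ` D)))"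
    if r: "0 < r1" "r1 < r2" and C1: "C1 \<subseteq> cball y0 r1 \<inter> f ` D"
      and C2: "continuum C2" "C2 \<subseteq> f ` D - ball y0 r2"
      and \<eta>: "\<eta> \<in> borel_measurable (lebesgue_on {r1<..<r2})"
      and \<eta>1: "1 \<le> (\<integral>\<^sup>+ r. \<eta> r \<partial>(lebesgue_on {r1<..<r2}))"
    for r1 r2 C1 C2 and \<eta> :: "real \<Rightarrow> ennreal"
  proof -
    let ?A = "annulus y0 r1 r2 \<inter> f ` D"
    let ?F = "\<lambda>r. {x \<in> D. f x \<in> f ` (D \<inter> E) \<inter> sphere y0 r}"
    let ?S = "\<lambda>r. {x \<in> D. x \<in> (\<Inter>j. V j) \<and> v x = r}"
    obtain \<eta>' where \<eta>' [measurable]: "\<eta>' \<in> borel_measurable borel" and le: "\<And>r. r \<in> {r1<..<r2} \<Longrightarrow> \<eta>' r \<le> \<eta> r"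
      and int: "(\<integral>\<^sup>+ r. \<eta>' r * indicator {r1<..<r2} r \<partial>lborel) = (\<integral>\<^sup>+ r. \<eta> r \<partial>(lebesgue_on {r1<..<r2}))"
      by (rule borel_minorant[OF \<eta>]) blast
    \<comment> \<open>A point of \<open>C2\<close> shows \<open>r2 \<le> r0\<close>, so the
      hypothesis on spheres with \<open>\<epsilon> = r1\<close> covers every level between
      \<open>r1\<close> and \<open>r2\<close>.\<close>
    obtain y2 where "y2 \<in> C2" using C2(1) by (auto simp: continuum_def)
    then have y2: "y2 \<in> f ` D" "r2 \<le> dist y2 y0" using C2(2) by (auto simp: dist_commute)
    have "ereal r2 \<le> ereal (dist y2 y0)" using y2 by simp
    also have "\<dots> \<le> r0" unfolding assms(15) using y2(1) by (rule SUP_upper)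
    finally have r2_le: "ereal r2 \<le> r0" .
    have "ereal r1 < r0" using r(2) r2_le by (metis less_ereal.simps(1) less_le_trans)
    then have "AE r in lebesgue. r1 < r \<and> ereal r < r0 \<longrightarrow> luzin_N_inverse_on_sphere f D y0 r"
      by (rule assms(18)[OF r(1)])
    moreover have "AE r in lebesgue. hausdorff_measure (CARD('n) - 1) (f ` (D \<inter> E) \<inter> sphere y0 r) = 0"
      using AE_hausdorff_null_sphere_slice[OF fE_null, of y0] by simp
    \<comment> \<open>Slicing takes place in the image, where the levels of \<open>v\<close>
      correspond to spheres, and the slices are then pulled back by the inverse Luzin
      property.\<close>
    ultimately have "AE r in lebesgue. r1 < r \<and> r < r2 \<longrightarrow>
        hausdorff_measure (DIM(real ^ 'n) - 1) (?S r) = 0"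
    proof eventually_elim
      fix r assume N_inv: "r1 < r \<and> ereal r < r0 \<longrightarrow> luzin_N_inverse_on_sphere f D y0 r"
        and null: "hausdorff_measure (CARD('n) - 1) (f ` (D \<inter> E) \<inter> sphere y0 r) = 0"
      show "r1 < r \<and> r < r2 \<longrightarrow>
        hausdorff_measure (DIM(real ^ 'n) - 1) (?S r) = 0"
      proof
        assume "r1 < r \<and> r < r2"
        then have "r1 < r \<and> ereal r < r0" using r2_le by (metis less_ereal.simps(1) less_le_trans)
        then have "luzin_N_inverse_on_sphere f D y0 r" using N_inv by blast
        moreover have "f ` (D \<inter> E) \<inter> sphere y0 r \<subseteq> sphere y0 r \<inter> f ` D" by blast
        ultimately have "hausdorff_measure (CARD('n) - 1) (?F r) = 0"
          using null unfolding luzin_N_inverse_on_sphere_def by blast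
        moreover have "(?S r) \<subseteq> (?F r)"
          by (auto simp: v_def E_def dist_commute)
        from hausdorff_measure_mono[OF this, of "CARD('n) - 1"]
        have "hausdorff_measure (CARD('n) - 1) (?S r)
            \<le> hausdorff_measure (CARD('n) - 1) (?F r)" .
        ultimately show "hausdorff_measure (DIM(real ^ 'n) - 1) (?S r) = 0"
          unfolding dim by simp
      qed
    qed
    then have slices: "AE r in lborel. r1 < r \<and> r < r2 \<longrightarrow>
        hausdorff_measure (DIM(real ^ 'n) - 1) (?S r) = 0"
      by (simp only: AE_completion_iff)
    have lip: "\<exists>d>0. \<forall>y\<in>D. dist y x < d \<longrightarrow> \<bar>v y - v x\<bar> \<le> (g x + e) * dist y x"
      if "x \<in> D" "x \<notin> (\<Inter>j. V j)" and e: "0 < e" for x e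
    proof -
      have x: "x \<in> W" using that by (simp add: W_def E_def)
      obtain d where "0 < d" "\<forall>y. dist y x < d \<longrightarrow> dist (f y) (f x) \<le> (g x + e) * dist y x"
        using locally_lipschitz_onorm[OF diff[OF x] e] x by (auto simp: g_def)
      moreover have "\<bar>v y - v x\<bar> \<le> dist (f y) (f x)" for y
        using dist_triangle[of "f y" y0 "f x"] dist_triangle[of "f x" y0 "f y"]
        by (simp add: v_def abs_le_iff dist_commute)
      ultimately show ?thesis by (meson order_trans)
    qed
    define G where "G = (\<lambda>x. if x \<in> D \<and> x \<notin> (\<Inter>j. V j) \<and> r1 < v x \<and> v x < r2 then \<eta>' (v x) * ennreal (g x) else 0)"
    let ?\<Gamma> = "{\<gamma>. path \<gamma> \<and> path_image \<gamma> \<subseteq> D \<and> v (pathstart \<gamma>) \<le> r1 \<and> r2 \<le> v (pathfinish \<gamma>)}"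
    \<comment> \<open>Only the levels of the end points are kept from the definition of the family;
      enlarging it can only increase the modulus.\<close>
    have "lifted_paths D f y0 r1 r2 C1 C2 \<subseteq> ?\<Gamma>"
    proof
      fix \<gamma> assume \<gamma>: "\<gamma> \<in> lifted_paths D f y0 r1 r2 C1 C2"
      then have "f (pathstart \<gamma>) \<in> C1" "f (pathfinish \<gamma>) \<in> C2"
        by (simp_all add: lifted_paths_def connecting_paths_def pathstart_def pathfinish_def)
      then have "f (pathstart \<gamma>) \<in> cball y0 r1" "f (pathfinish \<gamma>) \<notin> ball y0 r2" using C1 C2(2) by blast+
      then show "\<gamma> \<in> ?\<Gamma>"
        using \<gamma> by (simp add: lifted_paths_def v_def dist_commute not_less)
    qed
    then have "path_modulus \<alpha> (lifted_paths D f y0 r1 r2 C1 C2) \<le>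
        path_modulus \<alpha> ?\<Gamma>"
      by (rule path_modulus_mono)
    also have "\<dots> \<le> (\<integral>\<^sup>+ x. ennreal_powr (G x) \<alpha> \<partial>lborel)"
      unfolding G_def
      by (rule path_modulus_le_integral[OF _ D v V(1) slices g g0 lip \<eta>' _ \<alpha>1]) (use n int \<eta>1 in auto)
    also have "\<dots> \<le> (\<integral>\<^sup>+ y. N\<alpha> * Q y * ennreal_powr (\<eta> (dist y y0)) \<alpha> \<partial>(lebesgue_on ?A))"
    proof -
      define v0 where "v0 x = (if x \<in> D then v x else 0)" for x
      have [measurable]: "v0 \<in> borel_measurable borel"
        using borel_measurable_continuous_on_if[of D v "\<lambda>_. 0"] v unfolding v0_def by auto
      \<comment> \<open>Chosen so that \<open>F\<close> times the Jacobian is the power of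
        \<open>G\<close>, while its sum over a fibre is a power of \<open>\<eta>'\<close> times a
        sum of outer dilatations.\<close>
      define F where "F x = (if x \<in> W \<and> r1 < v0 x \<and> v0 x < r2
          then ennreal_powr (\<eta>' (v0 x)) \<alpha> * ennreal (g x powr \<alpha> / \<bar>J x\<bar>) else 0)" for x
      have F [measurable]: "F \<in> borel_measurable borel"
        unfolding F_def by measurable
      let ?d = "\<lambda>x. ennreal \<bar>det (jacobian f (at x))\<bar>"
        let ?N = "\<lambda>y. N\<alpha> * Q y * ennreal_powr (\<eta> (dist y y0)) \<alpha>"
        let ?M = "\<lambda>y. \<Sum>\<^sub>\<infinity>x\<in>{x \<in> W. f x = y}. F x"
      have "(\<integral>\<^sup>+ x. ennreal_powr (G x) \<alpha> \<partial>lborel)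
          = (\<integral>\<^sup>+ x. F x * (indicator W x * ?d x) \<partial>lborel)"
      proof (rule nn_integral_cong)
        fix x
        show "ennreal_powr (G x) \<alpha> = F x * (indicator W x * ?d x)"
        proof (cases "x \<in> W \<and> r1 < v x \<and> v x < r2")
          case True
          then have "x \<in> D" "x \<notin> (\<Inter>j. V j)" by (auto simp: W_def E_def)
          have "ennreal (g x powr \<alpha> / \<bar>J x\<bar>) * ?d x = ennreal (g x powr \<alpha>)"
            using True det[of x] by (simp add: J_def ennreal_mult[symmetric])
          moreover have "ennreal_powr (G x) \<alpha> = ennreal_powr (\<eta>' (v x)) \<alpha> * ennreal (g x powr \<alpha>)"
            using True \<open>x \<in> D\<close> \<open>x \<notin> (\<Inter>j. V j)\<close> \<alpha>1 g0[of x]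
            by (simp add: G_def ennreal_powr_mult ennreal_powr_ennreal)
          ultimately show ?thesis
            using True \<open>x \<in> D\<close> by (simp add: F_def v0_def mult.assoc)
        next
          case False
          then have "G x = 0" by (auto simp: G_def W_def E_def)
          moreover have "F x = 0" using False WD by (auto simp: F_def v0_def)
          ultimately show ?thesis by simp
        qed
      qed
      also have "\<dots> \<le> (\<integral>\<^sup>+ y. ?M y \<partial>lebesgue)"
        by (rule area_inequality[OF D f W WD diff det F])
      also have "\<dots> \<le> (\<integral>\<^sup>+ y. ?N y * indicator ?A y \<partial>lebesgue)"
      proof (rule nn_integral_mono_AE)
        have "AE y in lebesgue. y \<notin> f ` (D \<inter> E)" using fE_null by (rule AE_not_in)
        then show "AE y in lebesgue. ?M y
            \<le> ?N y * indicator ?A y"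
        proof eventually_elim
          fix y assume y: "y \<notin> f ` (D \<inter> E)"
          show "?M y \<le> ?N y * indicator ?A y"
          proof (cases "y \<in> ?A")
            case False
            have "F x = 0" if "x \<in> {x \<in> W. f x = y}" for x
              using that False WD by (auto simp: F_def v0_def v_def annulus_def)
            then have "?M y = 0" by (intro infsum_0) auto
            then show ?thesis by simp
          next
            case True
            then have ry: "dist y y0 \<in> {r1<..<r2}" by (simp add: annulus_def)
            \<comment> \<open>As \<open>y\<close> has no preimage in \<open>E\<close>,
              \<open>f\<close> is differentiable at all of them and \<open>inner_dilatation\<close>
              has its genuine value instead of the default 0.\<close>
            have "\<forall>x\<in>D. f x = y \<longrightarrow> f differentiable (at x)"
              using y diff by (auto simp: W_def)
            then have Q_eq: "Q y = (\<Sum>\<^sub>\<infinity>x\<in>{x \<in> D. f x = y}. outer_dilatation \<alpha> f x)"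
              by (simp add: Q_def inner_dilatation_def)
            have "?M y \<le> ennreal_powr (\<eta> (dist y y0)) \<alpha> * Q y"
              unfolding Q_eq
            proof (rule infsum_ennreal_le_cmult)
              fix x assume x: "x \<in> {x \<in> W. f x = y}"
              then have "ennreal (g x powr \<alpha> / \<bar>J x\<bar>) = outer_dilatation \<alpha> f x"
                using det[of x] by (simp add: outer_dilatation_def g_def J_def Let_def)
              moreover have "v0 x = dist y y0" using x WD by (auto simp: v0_def v_def)
              ultimately show "F x \<le> ennreal_powr (\<eta> (dist y y0)) \<alpha> * outer_dilatation \<alpha> f x"
                using le[OF ry] \<alpha>1 by (auto simp: F_def intro!: mult_right_mono ennreal_powr_mono)
            qed (use WD in auto)
            also have "\<dots> \<le> N\<alpha> * Q y * ennreal_powr (\<eta> (dist y y0)) \<alpha>"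
            proof -
              \<comment> \<open>A point of the image has at least one preimage, so the multiplicity
                and its power are at least 1, and the factor \<open>N\<alpha>\<close> only enlarges
                the bound.\<close>
              obtain x where x: "x \<in> D" "f x = y" using True by auto
              have "1 = emeasure (count_space UNIV) {x}" by simp
              also have "\<dots> \<le> emeasure (count_space UNIV) {x \<in> D. f x = y}"
                using x by (intro emeasure_mono) auto
              also have "\<dots> \<le> map_multiplicity f D"
                unfolding map_multiplicity_def by (rule SUP_upper) simp
              finally have "ennreal_powr 1 \<alpha> \<le> N\<alpha>"
                unfolding N\<alpha>_def using \<alpha>1 by (intro ennreal_powr_mono) auto
              then have "1 \<le> N\<alpha>" using ennreal_powr_ennreal[of 1 \<alpha>] by simp
              then have "1 * (Q y * ennreal_powr (\<eta> (dist y y0)) \<alpha>) \<le> N\<alpha> * (Q y * ennreal_powr (\<eta> (dist y y0)) \<alpha>)"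
                by (rule mult_right_mono) simp
              then show ?thesis by (simp add: mult_ac)
            qed
            finally show ?thesis using True by simp
          qed
        qed
      qed
      also have "\<dots> = (\<integral>\<^sup>+ y. N\<alpha> * Q y * ennreal_powr (\<eta> (dist y y0)) \<alpha> \<partial>(lebesgue_on ?A))"
      proof (rule nn_integral_restrict_space[symmetric])
        have "open {y. r1 < dist y y0 \<and> dist y y0 < r2}"
          by (intro open_Collect_conj open_Collect_less continuous_intros)
        then have "open ?A" using fD by (simp add: annulus_def open_Int)
        then show "?A \<inter> space lebesgue \<in> sets lebesgue" by simp
      qed
      finally show ?thesis .
    qed
    finally show ?thesis .
  qed
  note main = this
  have "(\<lambda>y. N\<alpha> * Q y) \<in> borel_measurable (lebesgue_on (f ` D))"
    using assms(19) unfolding Q_def by measurable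
  \<comment> \<open>The estimate holds for all \<open>0 < r1 < r2\<close>, so any positive
    \<open>R0\<close> serves; 1 is taken.\<close>
  then show ?thesis
    unfolding inverse_poletsky_at_def N\<alpha>_def[symmetric] Q_def[symmetric]
    using assms(14) main by (intro conjI exI[of _ 1]) auto
qed

end
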